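(* Let $f:\mathbb{R}^n\to\mathbb{R}^n$ be a $\mathcal{C}^1$ function, $\bar u\in\mathbb{R}^n$, and let $\varphi:\mathbb{R}^n\to\overline{\mathbb{R}}$ be finite at $\bar x\in\mathbb{R}^n$ and have the composite representation $\varphi=g\circ\Phi$ around $\bar x$. Assume that $\bar x$ is a nondegenerate solution to the generalized equation $\bar u\in f(x)+\partial\varphi(x)$, i.e. $\bar u-f(\bar x)\in\mathrm{ri}\,\partial\varphi(\bar x)$, and that the second-order qualification condition (SOQC) holds at $(\bar x,\bar\lambda)$, where $\bar\lambda$ is the unique vector in $\Lambda(\bar x,\bar u-f(\bar x))$. Set $G(x)=f(x)+\partial\varphi(x)$ for $x\in\mathbb{R}^n$, $S=G^{-1}$, $\overline K:=K_\varphi(\bar x,\bar u-f(\bar x))$ and $A:=\nabla f(\bar x)+\nabla^2\langle\bar\lambda,\Phi\rangle(\bar x)$. Then the following hold. (a) The mapping $G$ is metrically regular at $\bar x$ for $\bar u$ if and only if it is strongly metrically regular at $\bar x$ for $\bar u$. (b) One of the (mutually equivalent) properties (i) $G$ is metrically regular at $\bar x$ for $\bar u$; (ii) $\{w\in\mathbb{R}^n : A^*w\in\overline K^\perp\}\cap\overline K=\{0\}$; (iii) $A\overline K+\overline K^\perp=\mathbb{R}^n$; (iv) $\mathrm{rge}\,DG(\bar x,\bar u)=\mathbb{R}^n$ holds if and only if the solution mapping $S$ has a Lipschitz continuous (single-valued) localization $\sigma$ around $\bar u$ for $\bar x$ which is $\mathcal{C}^1$ in a neighborhood of $\bar u$ and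 satisfies $$\nabla\sigma(\bar u)=B\big(B^*AB\big)^{-1}B^*,$$ where $B\in\mathbb{R}^{n\times s}$ is a matrix whose columns form a basis for the linear subspace $\overline K$ and $s=\dim\overline K$.
   Context: $\overline{\mathbb{R}}=[-\infty,\infty]$; $\mathrm{ri}$ denotes relative interior; $^*$ on matrices is transpose. "$\varphi$ has the composite representation around $\bar x$" means: there are a neighborhood $O$ of $\bar x$, a mapping $\Phi:\mathbb{R}^n\to\mathbb{R}^m$ twice continuously differentiable around $\bar x$, and a polyhedral function $g:\mathbb{R}^m\to\overline{\mathbb{R}}$ (proper, with $\mathrm{epi}\,g$ a polyhedral convex set) such that $\varphi(x)=g(\Phi(x))$ for all $x\in O$. $\nabla^2\langle\bar\lambda,\Phi\rangle(\bar x)$ is the Hessian at $\bar x$ of $x\mapsto\langle\bar\lambda,\Phi(x)\rangle$. Tangent cone: $T_\Omega(\bar x)=\limsup_{t\searrow0}(\Omega-\bar x)/t$. Regular normal cone: $\widehat N_\Omega(\bar x)=T_\Omega(\bar x)^*$ (polar cone). Limiting normal cone $N_\Omega(\bar x)$: all limits of $v^k\in\widehat N_\Omega(x^k)$ with $x^k\to\bar x$, $x^k\in\Omega$. Subdifferential: $\partial h(\bar x)=\{v : (v,-1)\in N_{\mathrm{epi} h}(\bar x,h(\bar x))\}$. Graphical derivative: $\mathrm{gph}\,DF(\bar x,\bar y)=T_{\mathrm{gph}F}(\bar x,\bar y)$. Coderivative: $w\in D^*F(\bar x,\bar y)(u)\iff(w,-u)\in N_{\mathrm{gph}F}(\bar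 x,\bar y)$. $\mathrm{rge}$ denotes the range of a set-valued mapping. Multipliers: $\Lambda(x,v)=\{\lambda\in\mathbb{R}^m : \nabla\Phi(x)^*\lambda=v,\ \lambda\in\partial g(\Phi(x))\}$. SOQC at $(\bar x,\bar\lambda)$: $D^*(\partial g)(\Phi(\bar x),\bar\lambda)(0)\cap\ker\nabla\Phi(\bar x)^*=\{0\}$. Subderivative: $\mathrm{d}h(\bar x)(w)=\liminf_{t\searrow0,\,w'\to w}\frac{h(\bar x+tw')-h(\bar x)}{t}$. Critical cone: $K_h(\bar x,\bar v)=\{w : \langle\bar v,w\rangle=\mathrm{d}h(\bar x)(w)\}$. (Under the present assumptions $\overline K$ is a linear subspace.) Metric regularity of $F:\mathbb{R}^n\rightrightarrows\mathbb{R}^m$ at $\bar x$ for $\bar y\in F(\bar x)$: there are $\kappa\ge0$ and neighborhoods $U$ of $\bar x$, $V$ of $\bar y$ with $\mathrm{dist}(x,F^{-1}(y))\le\kappa\,\mathrm{dist}(y,F(x))$ for all $(x,y)\in U\times V$. Strong metric regularity: $F^{-1}$ has a Lipschitz continuous single-valued localization around $\bar y$ for $\bar x$, i.e. there are neighborhoods $U$ of $\bar x$, $V$ of $\bar y$ such that $y\mapsto F^{-1}(y)\cap U$ is single-valued and Lipschitz continuous on $V$; that single-valued mapping is the localization. *)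

theory Defs
  imports
    "HOL-Analysis.Analysis"
    "HOL-Library.Liminf_Limsup"
    "Jordan_Normal_Form.Matrix"
begin

section \<open>Smoothness\<close>

text \<open>In the following two definitions \<open>S\<close> is meant to be open.\<close>

definition C1_on :: "'a::real_normed_vector set \<Rightarrow> ('a \<Rightarrow> 'b::real_normed_vector) \<Rightarrow> bool" where
  "C1_on S F \<longleftrightarrow>
     (\<exists>F'. (\<forall>x\<in>S. (F has_derivative blinfun_apply (F' x)) (at x)) \<and> continuous_on S F')"

definition C2_on :: "'a::real_normed_vector set \<Rightarrow> ('a \<Rightarrow> 'b::real_normed_vector) \<Rightarrow> bool" where
  "C2_on S F \<longleftrightarrow>
     (\<exists>F'. (\<forall>x\<in>S. (F has_derivative blinfun_apply (F' x)) (at x)) \<and> C1_on S F')"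

definition gradient :: "(real^'n \<Rightarrow> real) \<Rightarrow> real^'n \<Rightarrow> real^'n" where
  "gradient h x = (\<chi> j. frechet_derivative h (at x) (axis j 1))"

definition hessian :: "(real^'n \<Rightarrow> real) \<Rightarrow> real^'n \<Rightarrow> real^'n^'n" where
  "hessian h x = jacobian (gradient h) (at x)"


section \<open>Tangent and normal cones\<close>

text \<open>The outer limit of \<open>(\<Omega> - x) / t\<close> as \<open>t\<close> decreases to \<open>0\<close>, written with sequences.\<close>

definition tangent_cone :: "'a::real_normed_vector set \<Rightarrow> 'a \<Rightarrow> 'a set" where
  "tangent_cone \<Omega> x =
     {w. \<exists>t w'. (\<forall>k::nat. t k > 0) \<and> t \<longlonglongrightarrow> 0 \<and> w' \<longlonglongrightarrow> w \<and>
                (\<forall>k. x + t k *\<^sub>R w' k \<in> \<Omega>)}"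

definition polar_cone :: "'a::real_inner set \<Rightarrow> 'a set" where
  "polar_cone C = {v. \<forall>w\<in>C. inner v w \<le> 0}"

definition regular_normal_cone :: "'a::real_inner set \<Rightarrow> 'a \<Rightarrow> 'a set" where
  "regular_normal_cone \<Omega> x = polar_cone (tangent_cone \<Omega> x)"

definition limiting_normal_cone :: "'a::real_inner set \<Rightarrow> 'a \<Rightarrow> 'a set" where
  "limiting_normal_cone \<Omega> x =
     {v. \<exists>x' v'. (\<forall>k::nat. x' k \<in> \<Omega> \<and> v' k \<in> regular_normal_cone \<Omega> (x' k)) \<and>
                 x' \<longlonglongrightarrow> x \<and> v' \<longlonglongrightarrow> v}"


section \<open>Extended-real-valued functions\<close>

definition epi :: "('a \<Rightarrow> ereal) \<Rightarrow> ('a \<times> real) set" where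
  "epi h = {(x, a). h x \<le> ereal a}"

definition polyhedral_fun :: "('a::euclidean_space \<Rightarrow> ereal) \<Rightarrow> bool" where
  "polyhedral_fun g \<longleftrightarrow> (\<forall>y. g y \<noteq> -\<infinity>) \<and> (\<exists>y. g y \<noteq> \<infinity>) \<and> polyhedron (epi g)"

text \<open>As usual, the subdifferential is empty at points where the function is not finite.\<close>

definition subdiff :: "('a::real_inner \<Rightarrow> ereal) \<Rightarrow> 'a \<Rightarrow> 'a set" where
  "subdiff h x =
     {v. \<bar>h x\<bar> \<noteq> \<infinity> \<and> (v, -1) \<in> limiting_normal_cone (epi h) (x, real_of_ereal (h x))}"

definition subderivative :: "('a::real_normed_vector \<Rightarrow> ereal) \<Rightarrow> 'a \<Rightarrow> 'a \<Rightarrow> ereal" where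
  "subderivative h x w =
     Liminf (at_right 0 \<times>\<^sub>F nhds w) (\<lambda>(t, w'). (h (x + t *\<^sub>R w') - h x) / ereal t)"

definition critical_cone :: "('a::real_inner \<Rightarrow> ereal) \<Rightarrow> 'a \<Rightarrow> 'a \<Rightarrow> 'a set" where
  "critical_cone h x v = {w. ereal (inner v w) = subderivative h x w}"


section \<open>Set-valued mappings\<close>

definition gph :: "('a \<Rightarrow> 'b set) \<Rightarrow> ('a \<times> 'b) set" where
  "gph F = {(x, y). y \<in> F x}"

definition setval_inverse :: "('a \<Rightarrow> 'b set) \<Rightarrow> 'b \<Rightarrow> 'a set" where
  "setval_inverse F y = {x. y \<in> F x}"

definition rge :: "('a \<Rightarrow> 'b set) \<Rightarrow> 'b set" where
  "rge F = (\<Union>x. F x)"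

definition graphical_derivative ::
    "('a::real_normed_vector \<Rightarrow> 'b::real_normed_vector set) \<Rightarrow> 'a \<Rightarrow> 'b \<Rightarrow> 'a \<Rightarrow> 'b set" where
  "graphical_derivative F x y w = {z. (w, z) \<in> tangent_cone (gph F) (x, y)}"

definition coderivative ::
    "('a::real_inner \<Rightarrow> 'b::real_inner set) \<Rightarrow> 'a \<Rightarrow> 'b \<Rightarrow> 'b \<Rightarrow> 'a set" where
  "coderivative F x y u = {w. (w, - u) \<in> limiting_normal_cone (gph F) (x, y)}"

text \<open>Unlike \<^const>\<open>infdist\<close>, the distance to the empty set is \<open>\<infinity>\<close> here.\<close>

definition point_dist :: "'a::metric_space \<Rightarrow> 'a set \<Rightarrow> ereal" where
  "point_dist x S = (INF y\<in>S. ereal (dist x y))"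

definition metrically_regular ::
    "('a::metric_space \<Rightarrow> 'b::metric_space set) \<Rightarrow> 'a \<Rightarrow> 'b \<Rightarrow> bool" where
  "metrically_regular F x0 y0 \<longleftrightarrow> y0 \<in> F x0 \<and>
     (\<exists>\<kappa>\<ge>0. \<exists>U V. open U \<and> x0 \<in> U \<and> open V \<and> y0 \<in> V \<and>
        (\<forall>x\<in>U. \<forall>y\<in>V. point_dist x (setval_inverse F y) \<le> ereal \<kappa> * point_dist y (F x)))"

text \<open>\<open>\<sigma>\<close> represents a Lipschitz continuous single-valued localization of \<open>S\<close> around \<open>y0\<close>
  for \<open>x0\<close>; only its values near \<open>y0\<close> matter.\<close>

definition lipschitz_localization ::
    "('b::metric_space \<Rightarrow> 'a::metric_space set) \<Rightarrow> 'b \<Rightarrow> 'a \<Rightarrow> ('b \<Rightarrow> 'a) \<Rightarrow> bool" where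
  "lipschitz_localization S y0 x0 \<sigma> \<longleftrightarrow> x0 \<in> S y0 \<and>
     (\<exists>U V. open U \<and> x0 \<in> U \<and> open V \<and> y0 \<in> V \<and>
        (\<forall>y\<in>V. S y \<inter> U = {\<sigma> y}) \<and> (\<exists>L. L-lipschitz_on V \<sigma>))"

definition strongly_metrically_regular ::
    "('a::metric_space \<Rightarrow> 'b::metric_space set) \<Rightarrow> 'a \<Rightarrow> 'b \<Rightarrow> bool" where
  "strongly_metrically_regular F x0 y0 \<longleftrightarrow>
     (\<exists>\<sigma>. lipschitz_localization (setval_inverse F) y0 x0 \<sigma>)"


section \<open>Composite functions, multipliers and the second-order qualification condition\<close>

definition composite_representation ::
    "(real^'n \<Rightarrow> ereal) \<Rightarrow> (real^'m \<Rightarrow> ereal) \<Rightarrow> (real^'n \<Rightarrow> real^'m) \<Rightarrow> real^'n \<Rightarrow> bool" where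
  "composite_representation \<phi> g \<Phi> xbar \<longleftrightarrow>
     polyhedral_fun g \<and>
     (\<exists>W. open W \<and> xbar \<in> W \<and> C2_on W \<Phi>) \<and>
     (\<exists>N. open N \<and> xbar \<in> N \<and> (\<forall>x\<in>N. \<phi> x = g (\<Phi> x)))"

definition multipliers ::
    "(real^'m \<Rightarrow> ereal) \<Rightarrow> (real^'n \<Rightarrow> real^'m) \<Rightarrow> real^'n \<Rightarrow> real^'n \<Rightarrow> (real^'m) set" where
  "multipliers g \<Phi> x v =
     {l. transpose (jacobian \<Phi> (at x)) *v l = v \<and> l \<in> subdiff g (\<Phi> x)}"

definition SOQC ::
    "(real^'m \<Rightarrow> ereal) \<Rightarrow> (real^'n \<Rightarrow> real^'m) \<Rightarrow> real^'n \<Rightarrow> real^'m \<Rightarrow> bool" where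
  "SOQC g \<Phi> x l \<longleftrightarrow>
     coderivative (subdiff g) (\<Phi> x) l 0 \<inter> {z. transpose (jacobian \<Phi> (at x)) *v z = 0} = {0}"


section \<open>Matrices given by their columns\<close>

text \<open>An \<open>n \<times> s\<close> matrix \<open>B\<close> is given by its columns \<open>B 0, \<dots>, B (s - 1)\<close> in \<open>real^'n\<close>.
  The number \<open>s\<close> is a term (possibly \<open>0\<close>), so vectors of length \<open>s\<close> and \<open>s \<times> s\<close> matrices
  are those of the Jordan normal form entry.\<close>

definition columns_basis :: "(nat \<Rightarrow> real^'n) \<Rightarrow> nat \<Rightarrow> (real^'n) set \<Rightarrow> bool" where
  "columns_basis B s K \<longleftrightarrow>
     B ` {..<s} \<subseteq> K \<and> K \<subseteq> span (B ` {..<s}) \<and> inj_on B {..<s} \<and> independent (B ` {..<s})"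

text \<open>The products \<open>B c\<close> and \<open>B\<^sup>* h\<close>, and the matrix \<open>B\<^sup>* A B\<close>, whose \<open>(i, j)\<close> entry is the
  \<open>i\<close>th entry of \<open>B\<^sup>*\<close> applied to \<open>A\<close> times the \<open>j\<close>th column of \<open>B\<close>.\<close>

definition columns_mult :: "(nat \<Rightarrow> real^'n) \<Rightarrow> real Matrix.vec \<Rightarrow> real^'n" where
  "columns_mult B c = (\<Sum>j<dim_vec c. vec_index c j *\<^sub>R B j)"

definition columns_transpose_mult :: "(nat \<Rightarrow> real^'n) \<Rightarrow> nat \<Rightarrow> real^'n \<Rightarrow> real Matrix.vec" where
  "columns_transpose_mult B s h = Matrix.vec s (\<lambda>i. inner (B i) h)"

definition compression :: "(nat \<Rightarrow> real^'n) \<Rightarrow> nat \<Rightarrow> real^'n^'n \<Rightarrow> real Matrix.mat" where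
  "compression B s A = Matrix.mat s s (\<lambda>(i, j). inner (B i) (A *v B j))"

end

theory Submission
  imports Defs "Jordan_Normal_Form.Determinant"
begin

text \<open>
  Let \<open>L\<close> be the subspace parallel to the affine hull of \<open>\<partial>g(\<Phi>(xbar))\<close>. At the points
  \<open>(\<Phi>(xbar), l)\<close> with \<open>l\<close> in the relative interior of \<open>\<partial>g(\<Phi>(xbar))\<close> the graph of \<open>\<partial>g\<close> is locally
  a product of affine spaces with directions \<open>L\<^sup>\<bottom>\<close> and \<open>L\<close>; letting \<open>l\<close> tend to \<open>lbar\<close> shows that \<open>L\<close>
  is contained in \<open>D\<^sup>*(\<partial>g)(\<Phi>(xbar), lbar)(0)\<close>. Hence SOQC makes \<open>\<nabla>\<Phi>(xbar)\<^sup>*\<close> injective on \<open>L\<close>.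
  The epigraph of \<open>\<phi>\<close> is then locally the preimage of the polyhedron \<open>epi g\<close> under a map that is a
  submersion modulo the lineality space of the tangent cone there, which gives the chain rule
  \<open>\<partial>\<phi>(x) = \<nabla>\<Phi>(x)\<^sup>* \<partial>g(\<Phi>(x))\<close> near \<open>xbar\<close>, and nondegeneracy puts \<open>lbar\<close> in the relative interior of
  \<open>\<partial>g(\<Phi>(xbar))\<close>. So near \<open>(xbar, ubar)\<close> the relation \<open>u \<in> G(x)\<close> is the smooth square system
  \<open>f(x) + \<nabla>\<Phi>(x)\<^sup>* l = u\<close>, \<open>\<Phi>(x) - \<Phi>(xbar) \<in> L\<^sup>\<bottom>\<close>, \<open>l - lbar \<in> L\<close>. Its linearization is invertible
  exactly when the compression of \<open>A\<close> to the critical subspace \<open>{w. \<nabla>\<Phi>(xbar) w \<in> L\<^sup>\<bottom>}\<close> is, and then the inverse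
  function theorem yields the localization. Conversely, metric regularity makes \<open>DG(xbar, ubar)\<close> onto by
  compactness, and \<open>DG(xbar, ubar)(w)\<close> is contained in \<open>A w + K\<^sup>\<bottom>\<close> for \<open>w \<in> K\<close> and empty otherwise.
\<close>

section \<open>Normal cones of convex and polyhedral sets\<close>

text \<open>It is not known at the start that \<open>lbar\<close> is a relative interior point of
  the subdifferential of \<open>g\<close>: nondegeneracy has to be carried over by the chain rule,
  and the chain rule already relies on the injectivity supplied by SOQC. The chain rule concerns
  limiting normals, hence all points near \<open>xbar\<close>; injectivity is therefore put into the
  form of a lower bound \<open>c * norm l\<close>, which persists under perturbation and keeps
  multipliers bounded in limits. Working with epigraphs treats horizontal normals together with
  subgradients. Since the subspaces \<open>L\<close> and \<open>K\<close> are not types, linear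
  problems posed on them are completed by the identity on the orthogonal complement to operators on
  the whole space; this is the origin of the recurring summand \<open>y - P y\<close>.\<close>

definition normal_cone :: "'a::real_inner set \<Rightarrow> 'a \<Rightarrow> 'a set" where
  "normal_cone E p = {n. \<forall>y\<in>E. inner n (y - p) \<le> 0}"

lemma convex_diff_in_tangent_cone:
  assumes "convex E" "p \<in> E" "y \<in> E"
  shows "y - p \<in> tangent_cone E p"
proof -
  have "p + (1 / real (Suc k)) *\<^sub>R (y - p) \<in> E" for k
  proof -
    have "(1 - 1 / real (Suc k)) *\<^sub>R p + (1 / real (Suc k)) *\<^sub>R y \<in> E"
      using assms by (intro convexD) auto
    then show ?thesis by (simp add: algebra_simps)
  qed
  moreover have "(\<lambda>k. 1 / real (Suc k)) \<longlonglongrightarrow> 0"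
    using LIMSEQ_inverse_real_of_nat by (simp add: inverse_eq_divide)
  ultimately show ?thesis
    unfolding tangent_cone_def
    by (intro CollectI exI[of _ "\<lambda>k. 1 / real (Suc k)"] exI[of _ "\<lambda>_. y - p"]) auto
qed

lemma limiting_normal_coneI:
  assumes "\<And>k::nat. x k \<in> \<Omega>" "\<And>k. v k \<in> regular_normal_cone \<Omega> (x k)"
    and "x \<longlonglongrightarrow> x0" "v \<longlonglongrightarrow> v0"
  shows "v0 \<in> limiting_normal_cone \<Omega> x0"
proof -
  have "(\<forall>k. x k \<in> \<Omega> \<and> v k \<in> regular_normal_cone \<Omega> (x k)) \<and> x \<longlonglongrightarrow> x0 \<and> v \<longlonglongrightarrow> v0"
    using assms by blast
  then show ?thesis unfolding limiting_normal_cone_def by (intro CollectI exI)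
qed

text \<open>Each \<open>y - p\<close> is a tangent direction, so regular normals are given by
  inequalities over all of \<open>E\<close>. Such inequalities survive limits of base points and
  normals, and the limiting construction adds nothing.\<close>

lemma limiting_normal_cone_convex:
  assumes "convex E" "p \<in> E"
  shows "limiting_normal_cone E p = normal_cone E p"
proof -
  have reg: "regular_normal_cone E q = normal_cone E q" if q: "q \<in> E" for q
  proof
    show "regular_normal_cone E q \<subseteq> normal_cone E q"
      using convex_diff_in_tangent_cone[OF assms(1) q]
      unfolding regular_normal_cone_def polar_cone_def normal_cone_def by blast
    show "normal_cone E q \<subseteq> regular_normal_cone E q"
    proof
      fix n assume n: "n \<in> normal_cone E q"
      have "inner n w \<le> 0" if w: "w \<in> tangent_cone E q" for w
      proof -
        obtain t w' where t: "\<And>k::nat. t k > (0::real)" and w': "w' \<longlonglongrightarrow> w"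
          and mem: "\<And>k. q + t k *\<^sub>R w' k \<in> E"
          using w unfolding tangent_cone_def by blast
        have "inner n (w' k) \<le> 0" for k
        proof -
          have "inner n (q + t k *\<^sub>R w' k - q) \<le> 0"
            using n mem unfolding normal_cone_def by blast
          then show ?thesis using t[of k] by (simp add: mult_le_0_iff)
        qed
        moreover have "(\<lambda>k. inner n (w' k)) \<longlonglongrightarrow> inner n w"
          by (intro tendsto_intros w')
        ultimately show ?thesis by (meson LIMSEQ_le_const2)
      qed
      then show "n \<in> regular_normal_cone E q"
        unfolding regular_normal_cone_def polar_cone_def by blast
    qed
  qed
  show ?thesis
  proof
    show "normal_cone E p \<subseteq> limiting_normal_cone E p"
    proof
      fix n assume "n \<in> normal_cone E p"
      then show "n \<in> limiting_normal_cone E p"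
        using reg[OF assms(2)] assms(2)
        by (intro limiting_normal_coneI[of "\<lambda>_. p" _ "\<lambda>_. n"]) auto
    qed
    show "limiting_normal_cone E p \<subseteq> normal_cone E p"
    proof
      fix n assume "n \<in> limiting_normal_cone E p"
      then obtain x v where xv: "\<And>k::nat. x k \<in> E" "\<And>k. v k \<in> regular_normal_cone E (x k)"
        and lim: "x \<longlonglongrightarrow> p" "v \<longlonglongrightarrow> n"
        unfolding limiting_normal_cone_def by blast
      have "inner n (y - p) \<le> 0" if y: "y \<in> E" for y
      proof -
        have "inner (v k) (y - x k) \<le> 0" for k
          using xv y reg[OF xv(1)] unfolding normal_cone_def by blast
        moreover have "(\<lambda>k. inner (v k) (y - x k)) \<longlonglongrightarrow> inner n (y - p)"
          by (intro tendsto_intros lim)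
        ultimately show ?thesis by (meson LIMSEQ_le_const2)
      qed
      then show "n \<in> normal_cone E p" unfolding normal_cone_def by blast
    qed
  qed
qed

text \<open>Of the finitely many half-spaces defining \<open>E\<close>, those active at
  \<open>p\<close> have their normals in the normal cone, and the inactive ones contain a
  neighbourhood of \<open>p\<close>.\<close>

lemma polyhedron_locally_conic:
  fixes E :: "'a::euclidean_space set"
  assumes "polyhedron E" "p \<in> E"
  shows "\<exists>\<delta>>0. \<forall>y\<in>ball p \<delta>. (\<forall>n\<in>normal_cone E p. inner n (y - p) \<le> 0) \<longrightarrow> y \<in> E"
proof -
  obtain F where F: "finite F" "E = \<Inter> F" and hs: "\<And>h. h \<in> F \<Longrightarrow> \<exists>a b. h = {x. inner a x \<le> b}"
    using assms(1) unfolding polyhedron_def by metis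
  have ev: "\<forall>\<^sub>F y in nhds p. (\<forall>n\<in>normal_cone E p. inner n (y - p) \<le> 0) \<longrightarrow> y \<in> h"
    if hF: "h \<in> F" for h
  proof -
    obtain a b where h: "h = {x. inner a x \<le> b}" using hs[OF hF] by blast
    have "inner a p \<le> b" using assms(2) F(2) hF h by blast
    then consider "inner a p = b" | "inner a p < b" by linarith
    then show ?thesis
    proof cases
      case 1
      have "inner a (y - p) \<le> 0" if "y \<in> E" for y
        using that F(2) hF h 1 by (auto simp: inner_diff_right)
      then have "a \<in> normal_cone E p" unfolding normal_cone_def by blast
      then have "(\<forall>n\<in>normal_cone E p. inner n (y - p) \<le> 0) \<longrightarrow> y \<in> h" for y
        using 1 h by (fastforce simp: inner_diff_right)
      then show ?thesis by simp
    next
      case 2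
      have "open {x. inner a x < b}" by (rule open_halfspace_lt)
      then have "\<forall>\<^sub>F y in nhds p. y \<in> {x. inner a x < b}"
        using 2 by (intro eventually_nhds_in_open) auto
      then show ?thesis by eventually_elim (auto simp: h)
    qed
  qed
  have "\<forall>\<^sub>F y in nhds p. \<forall>h\<in>F. (\<forall>n\<in>normal_cone E p. inner n (y - p) \<le> 0) \<longrightarrow> y \<in> h"
    by (rule eventually_ball_finite[OF F(1)]) (use ev in blast)
  then obtain d where "d > 0"
    "\<And>y. dist y p < d \<Longrightarrow> \<forall>h\<in>F. (\<forall>n\<in>normal_cone E p. inner n (y - p) \<le> 0) \<longrightarrow> y \<in> h"
    unfolding eventually_nhds_metric by metis
  moreover have "y \<in> E" if "\<forall>h\<in>F. Q \<longrightarrow> y \<in> h" Q for y Q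
    using that F(2) by simp
  ultimately show ?thesis
    by (intro exI[of _ d]) (simp add: dist_commute)
qed

text \<open>Since \<open>E\<close> is conic near \<open>p\<close>, a direction \<open>y - p\<close>
  with \<open>y\<close> in \<open>E\<close> is also feasible at every nearby \<open>q\<close> in
  \<open>E\<close>. Testing a normal at \<open>q\<close> against it gives the inequality at
  \<open>p\<close>.\<close>

lemma polyhedron_normal_cone_mono:
  fixes E :: "'a::euclidean_space set"
  assumes "polyhedron E" "p \<in> E"
  shows "\<exists>\<delta>>0. \<forall>q\<in>E \<inter> ball p \<delta>. normal_cone E q \<subseteq> normal_cone E p"
proof -
  obtain d where d: "d > 0"
    and loc: "\<And>y. y \<in> ball p d \<Longrightarrow> (\<forall>n\<in>normal_cone E p. inner n (y - p) \<le> 0) \<Longrightarrow> y \<in> E"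
    using polyhedron_locally_conic[OF assms] by blast
  have "n \<in> normal_cone E p" if q: "q \<in> E" "q \<in> ball p d" and n: "n \<in> normal_cone E q" for q n
    unfolding normal_cone_def
  proof (intro CollectI ballI)
    fix y assume y: "y \<in> E"
    have "\<forall>\<^sub>F t in at_right 0. q + t *\<^sub>R (y - p) \<in> ball p d"
    proof -
      have "((\<lambda>t. q + t *\<^sub>R (y - p)) \<longlongrightarrow> q + 0 *\<^sub>R (y - p)) (at_right 0)"
        by (intro tendsto_intros)
      then show ?thesis using q(2) by (intro topological_tendstoD) auto
    qed
    then have "\<forall>\<^sub>F t in at_right 0. t > 0 \<and> q + t *\<^sub>R (y - p) \<in> ball p d"
      using eventually_at_right_less[of "0::real"] by eventually_elim auto
    then obtain t :: real where t: "t > 0" "q + t *\<^sub>R (y - p) \<in> ball p d"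
      using eventually_happens'[OF trivial_limit_at_right_real] by blast
    have "inner m (q + t *\<^sub>R (y - p) - p) \<le> 0" if m: "m \<in> normal_cone E p" for m
    proof -
      have "inner m (q - p) \<le> 0" "inner m (y - p) \<le> 0"
        using m q y unfolding normal_cone_def by auto
      moreover have "inner m (q + t *\<^sub>R (y - p) - p) = inner m (q - p) + t * inner m (y - p)"
        by (simp add: inner_diff_right inner_add_right algebra_simps)
      ultimately show ?thesis using t(1) by (simp add: add_nonpos_nonpos mult_nonneg_nonpos)
    qed
    then have "q + t *\<^sub>R (y - p) \<in> E" using loc t(2) by blast
    then have "inner n (q + t *\<^sub>R (y - p) - q) \<le> 0" using n unfolding normal_cone_def by blast
    then show "inner n (y - p) \<le> 0" using t(1) by (simp add: mult_le_0_iff)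
  qed
  then show ?thesis using d by blast
qed

section \<open>The inverse function theorem for continuously differentiable maps\<close>

text \<open>In finite dimensions continuity of \<open>D x h\<close> for each fixed \<open>h\<close>
  already is continuity in the operator norm. This lets later derivatives be written as plain
  functions of the direction.\<close>

lemma has_derivative_imp_blinfun:
  fixes F :: "'a::euclidean_space \<Rightarrow> 'b::real_normed_vector"
  assumes "\<And>x. x \<in> W \<Longrightarrow> (F has_derivative D x) (at x)"
    and "\<And>h. continuous_on W (\<lambda>x. D x h)"
  obtains F' where "\<And>x. x \<in> W \<Longrightarrow> blinfun_apply (F' x) = D x" "continuous_on W F'"
proof
  show app: "blinfun_apply (Blinfun (D x)) = D x" if "x \<in> W" for x
    using assms(1)[OF that] by (intro bounded_linear_Blinfun_apply has_derivative_bounded_linear)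
  have "continuous_on W (\<lambda>x. blinfun_apply (Blinfun (D x)) i)" for i
    using assms(2)[of i] app by (subst continuous_on_cong[OF refl, where g = "\<lambda>x. D x i"]) auto
  then show "continuous_on W (\<lambda>x. Blinfun (D x))"
    by (rule continuous_on_blinfun_componentwise)
qed

lemma C1_onI:
  fixes F :: "'a::euclidean_space \<Rightarrow> 'b::real_normed_vector"
  assumes "\<And>x. x \<in> W \<Longrightarrow> (F has_derivative D x) (at x)"
    and "\<And>h. continuous_on W (\<lambda>x. D x h)"
  shows "C1_on W F"
proof -
  obtain F' where "\<And>x. x \<in> W \<Longrightarrow> blinfun_apply (F' x) = D x" "continuous_on W F'"
    using has_derivative_imp_blinfun[OF assms] by blast
  then show ?thesis unfolding C1_on_def using assms(1) by (intro exI[of _ F']) auto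
qed

text \<open>The inverse function theorem with two additions: the inverse is again
  \<open>C1_on\<close>, and its derivative is characterized by an equation, ready for linearized
  systems.\<close>

lemma C1_inverse_function:
  fixes F :: "'a::euclidean_space \<Rightarrow> 'a"
  assumes W: "open W" "q \<in> W"
    and der: "\<And>x. x \<in> W \<Longrightarrow> (F has_derivative D x) (at x)"
    and cont: "\<And>h. continuous_on W (\<lambda>x. D x h)"
    and inj: "\<And>h. D q h = 0 \<Longrightarrow> h = 0"
  obtains U V R R' where "open U" "U \<subseteq> W" "q \<in> U" "open V" "F q \<in> V" "homeomorphism U V F R"
    "\<And>y. y \<in> V \<Longrightarrow> (R has_derivative R' y) (at y)"
    "\<And>y h. y \<in> V \<Longrightarrow> D (R y) (R' y h) = h"
    "C1_on V R"
proof -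
  obtain F' where F': "\<And>x. x \<in> W \<Longrightarrow> blinfun_apply (F' x) = D x" and contF': "continuous_on W F'"
    using has_derivative_imp_blinfun[OF der cont] by blast
  have linq: "linear (blinfun_apply (F' q))"
    by (simp add: blinfun.bounded_linear_right bounded_linear.linear)
  have "inj (blinfun_apply (F' q))"
    using inj F'[OF W(2)] linear_injective_0[OF linq] by auto
  then obtain I where I: "linear I" "\<And>x. I (blinfun_apply (F' q) x) = x"
    using linear_injective_isomorphism[OF linq] by blast
  have "Blinfun I o\<^sub>L F' q = id_blinfun"
    by (rule blinfun_eqI) (simp add: bounded_linear_Blinfun_apply I linear_linear)
  moreover have "(F has_derivative blinfun_apply (F' x)) (at x)" if "x \<in> W" for x
    using der[OF that] F'[OF that] by simp
  ultimately obtain U V R R' where UV: "open U" "U \<subseteq> W" "q \<in> U" "open V" "F q \<in> V"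
    and hom: "homeomorphism U V F R"
    and R: "\<And>y. y \<in> V \<Longrightarrow> (R has_derivative (R' y)) (at y)"
    and R': "\<And>y. y \<in> V \<Longrightarrow> R' y = inv_into UNIV (blinfun_apply (F' (R y)))"
    and bij: "\<And>y. y \<in> V \<Longrightarrow> bij (blinfun_apply (F' (R y)))"
    using inverse_function_theorem[of W F F' q "Blinfun I"] W contF' by metis
  have RW: "R y \<in> W" if "y \<in> V" for y
    using hom that UV(2) unfolding homeomorphism_def by blast
  have inv': "blinfun_apply (F' (R y)) (R' y h) = h" if "y \<in> V" for y h
    using R'[OF that] bij[OF that] by (simp add: bij_is_surj surj_f_inv_f)
  have contR: "continuous_on V R" using hom unfolding homeomorphism_def by blast
  have contFR: "continuous_on V (\<lambda>y. F' (R y))"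
    using RW by (intro continuous_on_compose2[OF contF' contR]) auto
  have "continuous_on V (\<lambda>y. R' y h)" for h
    unfolding continuous_on_def
  proof
    fix y0 assume y0: "y0 \<in> V"
    define x0 where "x0 = R' y0 h"
    \<comment> \<open>\<open>c\<close> bounds the inverse operator at \<open>y0\<close>; operators
      closer than \<open>c / 2\<close> keep the bound \<open>c / 2\<close>. As \<open>R' y h\<close>
      and \<open>x0\<close> solve the two linear equations with the same right-hand side
      \<open>h\<close>, they differ by at most a multiple of the distance of the operators.\<close>
    obtain c where c: "c > 0" "\<And>x. c * norm x \<le> norm (blinfun_apply (F' (R y0)) x)"
      using linear_inj_bounded_below_pos[of "blinfun_apply (F' (R y0))"] bij[OF y0]
      by (metis bij_is_inj blinfun.bounded_linear_right bounded_linear.linear)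
    have lim: "((\<lambda>y. norm (F' (R y0) - F' (R y))) \<longlongrightarrow> 0) (at y0 within V)"
    proof -
      have "((\<lambda>y. F' (R y)) \<longlongrightarrow> F' (R y0)) (at y0 within V)"
        using contFR y0 unfolding continuous_on_def by blast
      then show ?thesis using tendsto_norm_zero[OF LIM_zero, of _ "F' (R y0)"]
        by (simp add: norm_minus_commute)
    qed
    have "\<forall>\<^sub>F y in at y0 within V. norm (F' (R y0) - F' (R y)) < c / 2"
      by (rule order_tendstoD(2)[OF lim]) (use c(1) in simp)
    moreover have "\<forall>\<^sub>F y in at y0 within V. y \<in> V"
      by (simp add: eventually_at_filter)
    ultimately have "\<forall>\<^sub>F y in at y0 within V. norm (R' y h - R' y0 h)
        \<le> (2 / c) * (norm (F' (R y0) - F' (R y)) * norm x0)"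
    proof eventually_elim
      case (elim y)
      let ?z = "R' y h - x0"
      have "c * norm ?z \<le> norm (blinfun_apply (F' (R y0)) ?z)" by (rule c(2))
      also have "blinfun_apply (F' (R y0)) ?z =
          blinfun_apply (F' (R y)) ?z + blinfun_apply (F' (R y0) - F' (R y)) ?z"
        by (simp add: blinfun.diff_left)
      also have "norm \<dots> \<le> norm (blinfun_apply (F' (R y)) ?z) + norm (F' (R y0) - F' (R y)) * norm ?z"
        by (meson add_left_mono norm_blinfun norm_triangle_le)
      also have "norm (F' (R y0) - F' (R y)) * norm ?z \<le> c / 2 * norm ?z"
        using elim(1) by (intro mult_right_mono) auto
      also have "blinfun_apply (F' (R y)) ?z = blinfun_apply (F' (R y0) - F' (R y)) x0"
        using inv'[OF elim(2), of h] inv'[OF y0, of h]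
        by (simp add: x0_def blinfun.diff_left blinfun.diff_right)
      also have "norm \<dots> \<le> norm (F' (R y0) - F' (R y)) * norm x0" by (rule norm_blinfun)
      finally have "c * norm ?z \<le> norm (F' (R y0) - F' (R y)) * norm x0 + c / 2 * norm ?z" by simp
      then have "c / 2 * norm ?z \<le> norm (F' (R y0) - F' (R y)) * norm x0" by simp
      then show ?case using c(1) unfolding x0_def by (simp add: field_simps)
    qed
    moreover have "((\<lambda>y. (2 / c) * (norm (F' (R y0) - F' (R y)) * norm x0)) \<longlongrightarrow> (2 / c) * (0 * norm x0)) (at y0 within V)"
      by (intro tendsto_intros lim)
    ultimately have "((\<lambda>y. R' y h - R' y0 h) \<longlongrightarrow> 0) (at y0 within V)"
      by (intro Lim_null_comparison[of "\<lambda>y. R' y h - R' y0 h"]) auto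
    then show "((\<lambda>y. R' y h) \<longlongrightarrow> R' y0 h) (at y0 within V)" by (rule LIM_zero_cancel)
  qed
  then have "C1_on V R" using R by (intro C1_onI)
  moreover have "D (R y) (R' y h) = h" if "y \<in> V" for y h
    using inv'[OF that] F'[OF RW[OF that]] by simp
  ultimately show ?thesis by (intro that[OF UV hom R])
qed

text \<open>The two recorded properties, values in \<open>L\<close> and unchanged inner products
  with \<open>L\<close>, determine the projection; idempotence is derived from them where it is
  used.\<close>

lemma orthogonal_projection_exists:
  fixes L :: "'a::euclidean_space set"
  assumes "subspace L"
  obtains P where "linear P" "\<And>x. P x \<in> L" "\<And>x n. n \<in> L \<Longrightarrow> inner n (P x) = inner n x"
proof -
  obtain B where B: "B \<subseteq> L" "pairwise Linear_Algebra.orthogonal B" "\<And>x. x \<in> B \<Longrightarrow> norm x = 1"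
    "independent B" "card B = dim L" "span B = L"
    using orthonormal_basis_subspace[OF assms] by metis
  have fin: "finite B" using B(4) independent_imp_finite by blast
  let ?P = "\<lambda>x. \<Sum>b\<in>B. inner b x *\<^sub>R b"
  have lin: "linear ?P"
    by (intro linear_compose_sum ballI linearI) (auto simp: inner_add_right scaleR_left_distrib)
  have mem: "?P x \<in> L" for x
    using B(1) assms by (intro subspace_sum subspace_scale) auto
  have basis: "inner b (?P x) = inner b x" if b: "b \<in> B" for b x
  proof -
    have "inner b (?P x) = (\<Sum>c\<in>B. inner c x * inner b c)" by (simp add: inner_sum_right)
    also have "\<dots> = (\<Sum>c\<in>B. if c = b then inner b x else 0)"
      using B(2,3) b by (intro sum.cong) (auto simp: pairwise_def Linear_Algebra.orthogonal_def norm_eq_1)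
    finally show ?thesis using fin b by simp
  qed
  have "inner n (?P x) = inner n x" if "n \<in> L" for n x
  proof -
    have "n \<in> span B" using that B(6) by simp
    then show ?thesis
      by (induction rule: span_induct_alt) (auto simp: inner_add_left basis)
  qed
  then show ?thesis using that[OF lin mem] by blast
qed

section \<open>Submersions modulo a subspace\<close>

text \<open>The operator below is the identity on the orthogonal complement of \<open>L\<close> and, up to
  projection, the Gram operator \<open>T T\<^sup>*\<close> on \<open>L\<close>.\<close>

lemma gram_inj:
  fixes T :: "'a::euclidean_space \<Rightarrow> 'b::euclidean_space"
  assumes "linear T" "linear P" "\<And>x. P x \<in> L" "\<And>x n. n \<in> L \<Longrightarrow> inner n (P x) = inner n x"
    and inj: "\<And>n. n \<in> L \<Longrightarrow> (\<And>w. inner n (T w) = 0) \<Longrightarrow> n = 0"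
    and zero: "P (T (adjoint T (P y))) + (y - P y) = 0"
  shows "y = 0"
proof -
  have "inner (P y) (P (T (adjoint T (P y))) + (y - P y)) = inner (P y) (T (adjoint T (P y)))"
    using assms(3,4) by (simp add: inner_add_right inner_diff_right)
  also have "\<dots> = inner (adjoint T (P y)) (adjoint T (P y))"
    using adjoint_works[OF assms(1)] by (simp add: inner_commute)
  finally have "adjoint T (P y) = 0" using zero by simp
  then have "inner (P y) (T w) = 0" for w
    using adjoint_works[OF assms(1)] by (metis inner_commute inner_zero_left)
  then have "P y = 0" using inj assms(3) by blast
  moreover have "P (T (adjoint T 0)) = 0"
    using assms(1,2) adjoint_linear[OF assms(1)] by (simp add: linear_0)
  ultimately show ?thesis using zero by simp
qed

text \<open>Injectivity of the adjoint on \<open>L\<close> is dual to \<open>T\<close> being onto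
  modulo the orthogonal complement of \<open>L\<close>. The operator of \<open>gram_inj\<close> is
  injective, hence onto; pairing with \<open>n\<close> in \<open>L\<close> removes the summand
  \<open>y - P y\<close> and leaves the witness \<open>adjoint T (P y)\<close>.\<close>

lemma surj_onto_subspace:
  fixes T :: "'a::euclidean_space \<Rightarrow> 'b::euclidean_space"
  assumes T: "linear T" and L: "subspace L"
    and inj: "\<And>n. n \<in> L \<Longrightarrow> (\<And>w. inner n (T w) = 0) \<Longrightarrow> n = 0"
  shows "\<exists>w. \<forall>n\<in>L. inner n (T w) = inner n l"
proof -
  obtain P where P: "linear P" "\<And>x. P x \<in> L" "\<And>x n. n \<in> L \<Longrightarrow> inner n (P x) = inner n x"
    using orthogonal_projection_exists[OF L] by metis
  let ?G = "\<lambda>y. P (T (adjoint T (P y))) + (y - P y)"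
  have lin: "linear ?G"
    using P(1) T adjoint_linear[OF T]
    by (intro linearI) (simp_all add: linear_add linear_cmul algebra_simps)
  have "inj ?G"
    unfolding linear_injective_0[OF lin] using gram_inj[OF T P inj] by blast
  then have "surj ?G" using linear_injective_imp_surjective[OF lin] by blast
  then have "\<exists>y. l = ?G y" by (rule surjD)
  then obtain y where y: "?G y = l" by (elim exE) (rule that, rule sym)
  have "inner n (T (adjoint T (P y))) = inner n l" if "n \<in> L" for n
    using arg_cong[OF y, of "inner n"] P(3)[OF that] by (simp add: inner_add_right inner_diff_right)
  then show ?thesis by blast
qed

text \<open>The curve is \<open>q + t w + (D q)\<^sup>* y(t)\<close>, where the inverse function theorem provides \<open>y(t) = o(t)\<close>.\<close>

lemma lift_line:
  fixes F :: "'a::euclidean_space \<Rightarrow> 'b::euclidean_space"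
  assumes W: "open W" "q \<in> W"
    and der: "\<And>x. x \<in> W \<Longrightarrow> (F has_derivative D x) (at x)"
    and cont: "\<And>h. continuous_on W (\<lambda>x. D x h)"
    and L: "subspace L"
    and inj: "\<And>n. n \<in> L \<Longrightarrow> (\<And>w. inner n (D q w) = 0) \<Longrightarrow> n = 0"
    and w: "\<And>n. n \<in> L \<Longrightarrow> inner n (D q w) = inner n l"
  shows "\<exists>c. (c has_vector_derivative w) (at 0) \<and> c 0 = q \<and>
    (\<forall>\<^sub>F t in nhds 0. \<forall>n\<in>L. inner n (F (c t)) = inner n (F q + t *\<^sub>R l))"
proof -
  obtain P where P: "linear P" "\<And>x. P x \<in> L" "\<And>x n. n \<in> L \<Longrightarrow> inner n (P x) = inner n x"
    using orthogonal_projection_exists[OF L] by metis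
  have T: "linear (D q)" using has_derivative_linear[OF der[OF W(2)]] .
  define S where "S y = adjoint (D q) (P y)" for y
  have linS: "linear S"
    unfolding S_def using P(1) adjoint_linear[OF T] by (intro linearI) (simp_all add: linear_add linear_cmul)
  have blP: "bounded_linear P" and blS: "bounded_linear S"
    using P(1) linS by (simp_all add: linear_conv_bounded_linear)
  have LP: "P n = n" if "n \<in> L" for n
  proof -
    have "inner (P n - n) (P n - n) = 0"
      using P(2)[of n] P(3)[of "P n - n" n] that L by (simp add: subspace_diff inner_diff_right)
    then show ?thesis by simp
  qed
  \<comment> \<open>\<open>S\<close> moves in the image of \<open>L\<close> under the adjoint, where
    \<open>F\<close> can correct its components along \<open>L\<close>. Keeping the parameter as
    first coordinate of \<open>H\<close> lets one application of the inverse function theorem serve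
    all small parameters.\<close>
  define \<gamma> where "\<gamma> z = q + fst z *\<^sub>R w + S (snd z)" for z :: "real \<times> 'b"
  define H where "H z = (fst z, P (F (\<gamma> z) - F q) + (snd z - P (snd z)))" for z :: "real \<times> 'b"
  define DH where "DH z h = (fst h, P (D (\<gamma> z) (fst h *\<^sub>R w + S (snd h))) + (snd h - P (snd h)))"
    for z h :: "real \<times> 'b"
  have der\<gamma>: "(\<gamma> has_derivative (\<lambda>h. fst h *\<^sub>R w + S (snd h))) (at z)" for z
  proof -
    have "((\<lambda>z::real \<times> 'b. S (snd z)) has_derivative (\<lambda>h. S (snd h))) (at z)"
      by (intro bounded_linear.has_derivative[OF blS] derivative_intros)
    then show ?thesis unfolding \<gamma>_def by (auto intro!: derivative_eq_intros)
  qed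
  have cont\<gamma>: "continuous_on A \<gamma>" for A
    using der\<gamma> by (meson continuous_at_imp_continuous_on has_derivative_continuous)
  have opn: "open (\<gamma> -` W)" by (rule open_vimage[OF W(1) cont\<gamma>])
  have \<gamma>0: "\<gamma> 0 = q" unfolding \<gamma>_def using linear_0[OF linS] by simp
  have derH: "(H has_derivative DH z) (at z)" if z: "z \<in> \<gamma> -` W" for z
  proof -
    have "((\<lambda>z. F (\<gamma> z)) has_derivative (\<lambda>h. D (\<gamma> z) (fst h *\<^sub>R w + S (snd h)))) (at z)"
      using has_derivative_compose[OF der\<gamma> der] z by simp
    then have "((\<lambda>z. P (F (\<gamma> z) - F q)) has_derivative (\<lambda>h. P (D (\<gamma> z) (fst h *\<^sub>R w + S (snd h)) - 0))) (at z)"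
      by (intro bounded_linear.has_derivative[OF blP] derivative_intros)
    then show ?thesis
      unfolding H_def DH_def
      by (auto intro!: derivative_eq_intros bounded_linear.has_derivative[OF blP])
  qed
  have contDH: "continuous_on (\<gamma> -` W) (\<lambda>z. DH z h)" for h
  proof -
    have "continuous_on (\<gamma> -` W) (\<lambda>z. D (\<gamma> z) (fst h *\<^sub>R w + S (snd h)))"
      by (rule continuous_on_compose2[OF cont cont\<gamma>]) auto
    then have "continuous_on (\<gamma> -` W) (\<lambda>z. P (D (\<gamma> z) (fst h *\<^sub>R w + S (snd h))))"
      by (rule bounded_linear.continuous_on[OF blP])
    then show ?thesis unfolding DH_def by (intro continuous_intros)
  qed
  have injH: "h = 0" if "DH 0 h = 0" for h
  proof -
    have "fst h = 0" using that unfolding DH_def by (simp add: prod_eq_iff)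
    moreover from this have "P (D q (adjoint (D q) (P (snd h)))) + (snd h - P (snd h)) = 0"
      using that unfolding DH_def by (simp add: prod_eq_iff \<gamma>0 S_def)
    then have "snd h = 0" using gram_inj[OF T P inj] by blast
    ultimately show ?thesis by (simp add: prod_eq_iff)
  qed
  have in0: "0 \<in> \<gamma> -` W" using \<gamma>0 W(2) by simp
  obtain U V R R' where UV: "open U" "U \<subseteq> \<gamma> -` W" "0 \<in> U" "open V" "H 0 \<in> V"
    and hom: "homeomorphism U V H R"
    and R: "\<And>y. y \<in> V \<Longrightarrow> (R has_derivative R' y) (at y)"
    and R': "\<And>y h. y \<in> V \<Longrightarrow> DH (R y) (R' y h) = h"
    using C1_inverse_function[OF opn in0 derH contDH injH] by metis
  have H0: "H 0 = 0" unfolding H_def \<gamma>0 by (simp add: linear_0[OF P(1)] zero_prod_def)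
  have V0: "0 \<in> V" using UV(5) H0 by simp
  have R0: "R 0 = 0" using hom UV(3) H0 unfolding homeomorphism_def by metis
  define c where "c t = \<gamma> (R (t, P (t *\<^sub>R l)))" for t :: real
  have line: "((\<lambda>t::real. (t, P (t *\<^sub>R l))) has_derivative (\<lambda>s. (s, P (s *\<^sub>R l)))) (at t)" for t
    by (intro has_derivative_Pair bounded_linear.has_derivative[OF blP] derivative_intros)
  have line0: "(0::real, P (0 *\<^sub>R l)) = 0" by (simp add: linear_0[OF P(1)] zero_prod_def)
  \<comment> \<open>By the choice of \<open>w\<close> the linearized equation is satisfied without
    any correction; hence the correction has derivative zero at 0 and the curve has velocity exactly
    \<open>w\<close>.\<close>
  have "R' 0 (s, P (s *\<^sub>R l)) = (s, 0)" for s
  proof -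
    have "DH 0 (R' 0 (s, P (s *\<^sub>R l)) - (s, 0)) = DH 0 (R' 0 (s, P (s *\<^sub>R l))) - DH 0 (s, 0)"
      using linear_diff[OF has_derivative_linear[OF derH[OF in0]]] .
    also have "DH 0 (s, 0) = (s, P (s *\<^sub>R l))"
    proof -
      have "P (D q (s *\<^sub>R w)) - P (s *\<^sub>R l) = 0"
      proof -
        have m: "P (D q (s *\<^sub>R w)) - P (s *\<^sub>R l) \<in> L" using P(2) L by (simp add: subspace_diff)
        have "inner n (P (D q (s *\<^sub>R w)) - P (s *\<^sub>R l)) = 0" if "n \<in> L" for n
          using P(3)[OF that] w[OF that] by (simp add: inner_diff_right linear_cmul[OF T])
        then show ?thesis using m by (metis inner_eq_zero_iff)
      qed
      then show ?thesis unfolding DH_def \<gamma>0 by (simp add: linear_0[OF linS] linear_0[OF P(1)])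
    qed
    finally have "DH 0 (R' 0 (s, P (s *\<^sub>R l)) - (s, 0)) = 0" using R'[OF V0] R0 by simp
    then show ?thesis using injH by fastforce
  qed
  then have "((\<lambda>t. R (t, P (t *\<^sub>R l))) has_derivative (\<lambda>s. (s, 0))) (at 0)"
    using has_derivative_compose[OF line[of 0], of R "R' 0"] R[OF V0] line0 by simp
  then have "((\<lambda>t. \<gamma> (R (t, P (t *\<^sub>R l)))) has_derivative (\<lambda>s. fst (s, 0::'b) *\<^sub>R w + S (snd (s, 0::'b)))) (at 0)"
    by (rule has_derivative_compose[OF _ der\<gamma>])
  then have c1: "(c has_vector_derivative w) (at 0)"
    unfolding has_vector_derivative_def c_def by (simp add: linear_0[OF linS])
  have c2: "c 0 = q" unfolding c_def using line0 R0 \<gamma>0 by simp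
  have "continuous (at 0) (\<lambda>t::real. (t, P (t *\<^sub>R l)))"
    using has_derivative_continuous[OF line] .
  then have "((\<lambda>t::real. (t, P (t *\<^sub>R l))) \<longlongrightarrow> 0) (at 0)"
    unfolding isCont_def using line0 by simp
  then have "\<forall>\<^sub>F t::real in at 0. (t, P (t *\<^sub>R l)) \<in> V"
    using UV(4) V0 by (rule topological_tendstoD)
  then have "\<forall>\<^sub>F t::real in nhds 0. (t, P (t *\<^sub>R l)) \<in> V"
    unfolding eventually_at_filter using line0 V0 by (elim eventually_mono) auto
  then have c3: "\<forall>\<^sub>F t in nhds 0. \<forall>n\<in>L. inner n (F (c t)) = inner n (F q + t *\<^sub>R l)"
  proof eventually_elim
    case (elim t)
    define z where "z = R (t, P (t *\<^sub>R l))"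
    have "H z = (t, P (t *\<^sub>R l))" using hom elim unfolding homeomorphism_def z_def by blast
    then have "P (F (c t) - F q) + (snd z - P (snd z)) = P (t *\<^sub>R l)"
      unfolding H_def c_def z_def by simp
    then have eq: "inner n (P (F (c t) - F q) + (snd z - P (snd z))) = inner n (P (t *\<^sub>R l))" for n
      by simp
    show ?case
    proof
      fix n assume "n \<in> L"
      then show "inner n (F (c t)) = inner n (F q + t *\<^sub>R l)"
        using eq[of n] P(3)[of n] by (simp add: inner_add_right inner_diff_right)
    qed
  qed
  show ?thesis using c1 c2 c3 by blast
qed

lemma tangent_cone_curve:
  assumes "(c has_vector_derivative w) (at 0)" "c 0 = q" "\<forall>\<^sub>F t in at_right 0. c t \<in> \<Omega>"
  shows "w \<in> tangent_cone \<Omega> q"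
proof -
  obtain e where e: "e > 0" "\<And>t. 0 < t \<Longrightarrow> t < e \<Longrightarrow> c t \<in> \<Omega>"
    using assms(3) unfolding eventually_at_right_field by blast
  \<comment> \<open>The factor 1/2 keeps even \<open>t 0\<close> strictly below
    \<open>e\<close>.\<close>
  define t where "t k = e / 2 * (1 / real (Suc k))" for k
  have t: "t k > 0" "t k < e" for k
  proof -
    show "t k > 0" using e(1) unfolding t_def by simp
    have "e / 2 * (1 / real (Suc k)) \<le> e / 2 * 1"
      using e(1) by (intro mult_left_mono) auto
    then show "t k < e" using e(1) unfolding t_def by linarith
  qed
  have lim: "t \<longlonglongrightarrow> 0"
    unfolding t_def using tendsto_mult_right_zero[OF LIMSEQ_inverse_real_of_nat, of "e / 2"]
    by (simp only: inverse_eq_divide)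
  have DQ: "((\<lambda>s. (c s - c 0) /\<^sub>R s) \<longlongrightarrow> w) (at 0)"
    if "(c has_derivative (\<lambda>x. x *\<^sub>R w)) (at 0)"
  proof -
    have "((\<lambda>s. norm (c (0 + s) - c 0 - s *\<^sub>R w) / norm s) \<longlongrightarrow> 0) (at 0)"
      using that unfolding has_derivative_at by blast
    then have "((\<lambda>s. norm ((c s - c 0) /\<^sub>R s - w)) \<longlongrightarrow> 0) (at 0)"
    proof (rule Lim_transform_eventually)
      show "\<forall>\<^sub>F s in at 0. norm (c (0 + s) - c 0 - s *\<^sub>R w) / norm s = norm ((c s - c 0) /\<^sub>R s - w)"
        unfolding eventually_at_filter
      proof (intro always_eventually allI impI)
        fix s :: real assume "s \<noteq> 0"
        then have "(c s - c 0) /\<^sub>R s - w = (c s - c 0 - s *\<^sub>R w) /\<^sub>R s"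
          by (simp add: scaleR_diff_right)
        then show "norm (c (0 + s) - c 0 - s *\<^sub>R w) / norm s = norm ((c s - c 0) /\<^sub>R s - w)"
          by (simp add: divide_inverse mult.commute)
      qed
    qed
    then show ?thesis by (rule LIM_zero_cancel[OF tendsto_norm_zero_cancel])
  qed
  have "((\<lambda>s. (c s - c 0) /\<^sub>R s) \<longlongrightarrow> w) (at 0)"
    by (rule DQ) (use assms(1) in \<open>simp add: has_vector_derivative_def\<close>)
  then have "(\<lambda>k. (c (t k) - c 0) /\<^sub>R t k) \<longlonglongrightarrow> w"
  proof (rule filterlim_compose)
    have "\<forall>\<^sub>F k in sequentially. t k \<in> UNIV \<and> t k \<noteq> 0"
      using t(1) by (intro always_eventually) (metis UNIV_I less_irrefl)
    then show "filterlim t (at 0) sequentially" using lim unfolding filterlim_at by blast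
  qed
  moreover have "q + t k *\<^sub>R ((c (t k) - c 0) /\<^sub>R t k) = c (t k)" for k
    using t(1)[of k] assms(2) by simp
  moreover have "c (t k) \<in> \<Omega>" for k using e(2) t by blast
  ultimately have "(\<forall>k. t k > 0) \<and> t \<longlonglongrightarrow> 0 \<and> (\<lambda>k. (c (t k) - c 0) /\<^sub>R t k) \<longlonglongrightarrow> w \<and>
      (\<forall>k. q + t k *\<^sub>R ((c (t k) - c 0) /\<^sub>R t k) \<in> \<Omega>)"
    using t(1) lim by simp
  then show ?thesis unfolding tangent_cone_def by blast
qed

text \<open>The hypotheses mean that \<open>E\<close> is, near \<open>F q\<close>, a union of parallels to the
  orthogonal complement of \<open>L\<close>, and \<open>F\<close> is a submersion modulo that complement.\<close>

lemma tangent_cone_preimage: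
  fixes F :: "'a::euclidean_space \<Rightarrow> 'b::euclidean_space"
  assumes W: "open W" "q \<in> W"
    and der: "\<And>x. x \<in> W \<Longrightarrow> (F has_derivative D x) (at x)"
    and cont: "\<And>h. continuous_on W (\<lambda>x. D x h)"
    and L: "subspace L"
    and inj: "\<And>n. n \<in> L \<Longrightarrow> (\<And>w. inner n (D q w) = 0) \<Longrightarrow> n = 0"
    and E: "convex E" "F q \<in> E" "y \<in> E"
    and B: "open B" "F q \<in> B" "\<And>y z. y \<in> E \<inter> B \<Longrightarrow> z \<in> B \<Longrightarrow> (\<And>n. n \<in> L \<Longrightarrow> inner n z = inner n y) \<Longrightarrow> z \<in> E"
    and \<Omega>: "\<And>x. x \<in> W \<Longrightarrow> F x \<in> E \<Longrightarrow> x \<in> \<Omega>"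
    and w: "\<And>n. n \<in> L \<Longrightarrow> inner n (D q w) = inner n (y - F q)"
  shows "w \<in> tangent_cone \<Omega> q"
proof -
  have ex: "\<exists>c. (c has_vector_derivative w) (at 0) \<and> c 0 = q \<and>
      (\<forall>\<^sub>F t in nhds 0. \<forall>n\<in>L. inner n (F (c t)) = inner n (F q + t *\<^sub>R (y - F q)))"
    by (rule lift_line[of W q F D L w "y - F q"]) (fact assms)+
  obtain c where c: "(c has_vector_derivative w) (at 0)" "c 0 = q"
    and lin: "\<forall>\<^sub>F t in nhds 0. \<forall>n\<in>L. inner n (F (c t)) = inner n (F q + t *\<^sub>R (y - F q))"
    using ex by blast
  have ccont: "(c \<longlongrightarrow> q) (at 0)"
    using has_vector_derivative_continuous[OF c(1)] c(2) unfolding isCont_def by simp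
  then have evW: "\<forall>\<^sub>F t in at 0. c t \<in> W" using W by (rule topological_tendstoD)
  have "isCont F q" using has_derivative_continuous[OF der[OF W(2)]] .
  then have "((\<lambda>t. F (c t)) \<longlongrightarrow> F q) (at 0)" using isCont_tendsto_compose ccont by blast
  then have evB: "\<forall>\<^sub>F t in at 0. F (c t) \<in> B" using B(1,2) by (rule topological_tendstoD)
  have "((\<lambda>t. F q + t *\<^sub>R (y - F q)) \<longlongrightarrow> F q + 0 *\<^sub>R (y - F q)) (at 0)"
    by (intro tendsto_intros)
  then have evS: "\<forall>\<^sub>F t in at 0. F q + t *\<^sub>R (y - F q) \<in> B"
    using B(1,2) by (intro topological_tendstoD) auto
  have one: "\<forall>\<^sub>F t::real in at_right 0. t \<in> {0<..<1}" by (rule eventually_at_right_real) simp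
  have "\<forall>\<^sub>F t in at_right 0. c t \<in> \<Omega>"
    using eventually_at_right_less[of "0::real"]
      one
      filter_leD[OF at_le[OF subset_UNIV], OF evW] filter_leD[OF at_le[OF subset_UNIV], OF evB]
      filter_leD[OF at_le[OF subset_UNIV], OF evS]
      filter_leD[OF at_within_le_nhds, OF lin]
  proof eventually_elim
    case (elim t)
    \<comment> \<open>The segment from \<open>F q\<close> to \<open>y\<close> stays in
      \<open>E\<close>; \<open>F (c t)\<close> differs from its point only orthogonally to
      \<open>L\<close>, a difference that \<open>E\<close> ignores inside \<open>B\<close>.\<close>
    have "(1 - t) *\<^sub>R F q + t *\<^sub>R y \<in> E" using E elim(1,2) by (intro convexD[OF E(1)]) auto
    then have "F q + t *\<^sub>R (y - F q) \<in> E \<inter> B" using elim(5) by (simp add: algebra_simps)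
    then have "F (c t) \<in> E" using B(3) elim(4,6) by blast
    then show ?case using \<Omega> elim(3) by blast
  qed
  then show ?thesis by (rule tangent_cone_curve[OF c])
qed

text \<open>Vectors that the derivative sends into the orthogonal complement of \<open>L\<close> are
  tangent together with their negatives, so \<open>\<nu>\<close> annihilates them and has the form
  \<open>adjoint (D q) n\<close> with \<open>n\<close> in \<open>L\<close>. Modulo that complement
  every direction \<open>y - F q\<close> is the image of a tangent vector, which makes
  \<open>n\<close> normal to \<open>E\<close>.\<close>

lemma regular_normal_cone_preimage:
  fixes F :: "'a::euclidean_space \<Rightarrow> 'b::euclidean_space"
  assumes W: "open W" "q \<in> W"
    and der: "\<And>x. x \<in> W \<Longrightarrow> (F has_derivative D x) (at x)"
    and cont: "\<And>h. continuous_on W (\<lambda>x. D x h)"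
    and L: "subspace L"
    and inj: "\<And>n. n \<in> L \<Longrightarrow> (\<And>w. inner n (D q w) = 0) \<Longrightarrow> n = 0"
    and E: "convex E" "F q \<in> E"
    and B: "open B" "F q \<in> B" "\<And>y z. y \<in> E \<inter> B \<Longrightarrow> z \<in> B \<Longrightarrow> (\<And>n. n \<in> L \<Longrightarrow> inner n z = inner n y) \<Longrightarrow> z \<in> E"
    and \<Omega>: "\<And>x. x \<in> W \<Longrightarrow> F x \<in> E \<Longrightarrow> x \<in> \<Omega>"
    and \<nu>: "\<nu> \<in> regular_normal_cone \<Omega> q"
  shows "\<exists>n \<in> normal_cone E (F q) \<inter> L. \<forall>w. inner \<nu> w = inner n (D q w)"
proof -
  have T: "linear (D q)" using has_derivative_linear[OF der[OF W(2)]] .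
  have tan: "inner \<nu> w \<le> 0" if "y \<in> E" "\<And>n. n \<in> L \<Longrightarrow> inner n (D q w) = inner n (y - F q)" for y w
  proof -
    have "w \<in> tangent_cone \<Omega> q"
      by (rule tangent_cone_preimage[of W q F D L E y B]) (fact assms that)+
    then show ?thesis using \<nu> unfolding regular_normal_cone_def polar_cone_def by blast
  qed
  let ?Z = "adjoint (D q) ` L"
  have Z: "subspace ?Z" using linear_subspace_image[OF adjoint_linear[OF T] L] .
  have "inner \<nu> w = 0" if "w \<in> orthogonal_comp ?Z" for w
  proof -
    have 0: "inner n (D q w) = 0" if "n \<in> L" for n
    proof -
      have "inner (adjoint (D q) n) w = 0"
        using \<open>w \<in> orthogonal_comp ?Z\<close> that
        unfolding orthogonal_comp_def Linear_Algebra.orthogonal_def by blast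
      then show ?thesis using adjoint_works[OF T, of w n] by (metis inner_commute)
    qed
    have "inner \<nu> w \<le> 0" using tan[OF E(2)] 0 by simp
    moreover have "inner \<nu> (- w) \<le> 0" using tan[OF E(2), of "- w"] 0 by (simp add: linear_neg[OF T])
    ultimately show ?thesis by simp
  qed
  then have "\<nu> \<in> orthogonal_comp (orthogonal_comp ?Z)"
    unfolding orthogonal_comp_def[of "orthogonal_comp ?Z"] Linear_Algebra.orthogonal_def
    by (simp add: inner_commute[of _ \<nu>])
  then have "\<nu> \<in> ?Z" unfolding orthogonal_comp_self[OF Z] .
  then obtain n where n: "n \<in> L" "\<nu> = adjoint (D q) n" by blast
  have eq: "inner \<nu> w = inner n (D q w)" for w
    using adjoint_works[OF T, of w n] n(2) by (metis inner_commute)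
  have "inner n (y - F q) \<le> 0" if "y \<in> E" for y
  proof -
    obtain w where w: "\<forall>m\<in>L. inner m (D q w) = inner m (y - F q)"
      using surj_onto_subspace[OF T L inj, of "y - F q"] by blast
    then have "inner \<nu> w \<le> 0" using tan[OF that] by blast
    then show ?thesis using eq w n(1) by simp
  qed
  then show ?thesis using n(1) eq unfolding normal_cone_def by blast
qed

section \<open>Polyhedral functions\<close>

lemma subdiff_polyhedral_iff:
  fixes g :: "'a::euclidean_space \<Rightarrow> ereal"
  assumes "polyhedral_fun g" "g z = ereal r"
  shows "l \<in> subdiff g z \<longleftrightarrow> (l, -1) \<in> normal_cone (epi g) (z, r)"
proof -
  have "convex (epi g)" using assms(1) unfolding polyhedral_fun_def by (simp add: polyhedron_imp_convex)
  moreover have "(z, r) \<in> epi g" using assms(2) unfolding epi_def by simp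
  ultimately show ?thesis
    unfolding subdiff_def using assms(2) by (simp add: limiting_normal_cone_convex)
qed

lemma subdiff_ineq:
  fixes g :: "'a::euclidean_space \<Rightarrow> ereal"
  assumes "polyhedral_fun g" "g z = ereal r" "l \<in> subdiff g z" "g y \<le> ereal b"
  shows "r + inner l (y - z) \<le> b"
proof -
  have "(y, b) \<in> epi g" using assms(4) unfolding epi_def by simp
  then have "inner (l, -1) ((y, b) - (z, r)) \<le> 0"
    using assms(3) unfolding subdiff_polyhedral_iff[OF assms(1,2)] normal_cone_def by blast
  then show ?thesis by (simp add: inner_prod_def)
qed

lemma subdiffI:
  fixes g :: "'a::euclidean_space \<Rightarrow> ereal"
  assumes "polyhedral_fun g" "g z = ereal r" "\<And>y b. g y \<le> ereal b \<Longrightarrow> r + inner l (y - z) \<le> b"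
  shows "l \<in> subdiff g z"
proof -
  have "inner (l, -1) (p - (z, r)) \<le> 0" if "p \<in> epi g" for p
    using assms(3)[of "fst p" "snd p"] that unfolding epi_def
    by (simp add: inner_prod_def case_prod_beta)
  then show ?thesis unfolding subdiff_polyhedral_iff[OF assms(1,2)] normal_cone_def by blast
qed

lemma subdiff_finite: "l \<in> subdiff h x \<Longrightarrow> \<exists>r. h x = ereal r"
  unfolding subdiff_def by (cases "h x") auto

lemma convex_subdiff:
  fixes g :: "'a::euclidean_space \<Rightarrow> ereal"
  assumes "polyhedral_fun g"
  shows "convex (subdiff g z)"
proof (cases "\<exists>r. g z = ereal r")
  case True
  then obtain r where r: "g z = ereal r" by blast
  show ?thesis
  proof (rule convexI)
    fix l m and u v :: real
    assume lm: "l \<in> subdiff g z" "m \<in> subdiff g z" "0 \<le> u" "0 \<le> v" "u + v = 1"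
    show "u *\<^sub>R l + v *\<^sub>R m \<in> subdiff g z"
    proof (rule subdiffI[OF assms r])
      fix y b assume b: "g y \<le> ereal b"
      have "u * (r + inner l (y - z)) + v * (r + inner m (y - z)) \<le> u * b + v * b"
        using subdiff_ineq[OF assms r lm(1) b] subdiff_ineq[OF assms r lm(2) b] lm(3,4)
        by (intro add_mono mult_left_mono)
      also have "\<dots> = b" using lm(5) by (metis distrib_right mult_1)
      also have "u * (r + inner l (y - z)) + v * (r + inner m (y - z))
          = (u + v) * r + inner (u *\<^sub>R l + v *\<^sub>R m) (y - z)"
        by (simp add: inner_add_left algebra_simps)
      finally show "r + inner (u *\<^sub>R l + v *\<^sub>R m) (y - z) \<le> b" using lm(5) by simp
    qed
  qed
next
  case False
  then have "subdiff g z = {}" using subdiff_finite by blast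
  then show ?thesis by simp
qed

section \<open>The direction space of the affine hull of a subdifferential\<close>

definition parallel_subspace :: "'a::real_vector set \<Rightarrow> 'a set" where
  "parallel_subspace C = span {a - b | a b. a \<in> C \<and> b \<in> C}"

lemma subspace_parallel_subspace [simp]: "subspace (parallel_subspace C)"
  unfolding parallel_subspace_def by simp

lemma diff_in_parallel_subspace: "a \<in> C \<Longrightarrow> b \<in> C \<Longrightarrow> a - b \<in> parallel_subspace C"
  unfolding parallel_subspace_def by (intro span_base) blast

text \<open>A normal \<open>(l, -s)\<close> with \<open>s > 0\<close> rescales to the subgradient \<open>l / s\<close>; one with \<open>s = 0\<close> is a
  recession direction of the subdifferential.\<close>

lemma span_normal_cone_epi:
  fixes g :: "'a::euclidean_space \<Rightarrow> ereal"
  assumes "polyhedral_fun g" "g z = ereal r" "l0 \<in> subdiff g z"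
    and "n \<in> span (normal_cone (epi g) (z, r))"
  shows "fst n + snd n *\<^sub>R l0 \<in> parallel_subspace (subdiff g z)"
proof -
  let ?N = "normal_cone (epi g) (z, r)" and ?L = "parallel_subspace (subdiff g z)"
  have base: "fst m + snd m *\<^sub>R l0 \<in> ?L" if m: "m \<in> ?N" for m
  proof -
    have "(z, r + 1) \<in> epi g" using assms(2) unfolding epi_def by simp
    then have "inner m ((z, r + 1) - (z, r)) \<le> 0" using m unfolding normal_cone_def by blast
    then have le: "snd m \<le> 0" by (simp add: inner_prod_def)
    have l0: "(l0, -1) \<in> ?N" using assms(3) subdiff_polyhedral_iff[OF assms(1,2)] by blast
    show ?thesis
    proof (cases "snd m = 0")
      case True
      have "(l0 + fst m, -1) \<in> ?N" unfolding normal_cone_def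
      proof (intro CollectI ballI)
        fix p assume p: "p \<in> epi g"
        have "inner (l0, -1) (p - (z, r)) \<le> 0" "inner m (p - (z, r)) \<le> 0"
          using l0 m p unfolding normal_cone_def by blast+
        then show "inner (l0 + fst m, -1) (p - (z, r)) \<le> 0"
          using True by (simp add: inner_prod_def inner_add_left)
      qed
      then have "l0 + fst m \<in> subdiff g z" using subdiff_polyhedral_iff[OF assms(1,2)] by blast
      then have "(l0 + fst m) - l0 \<in> ?L" using assms(3) by (rule diff_in_parallel_subspace)
      then show ?thesis using True by simp
    next
      case False
      define s where "s = - snd m"
      have s: "s > 0" using le False unfolding s_def by simp
      have "(fst m /\<^sub>R s, -1) \<in> ?N" unfolding normal_cone_def
      proof (intro CollectI ballI)
        fix p assume p: "p \<in> epi g"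
        have "inner m (p - (z, r)) \<le> 0" using m p unfolding normal_cone_def by blast
        moreover have "(fst m /\<^sub>R s, -1) = m /\<^sub>R s" using s by (simp add: prod_eq_iff s_def)
        ultimately show "inner (fst m /\<^sub>R s, -1) (p - (z, r)) \<le> 0"
          using s by (simp add: mult_nonneg_nonpos)
      qed
      then have "fst m /\<^sub>R s \<in> subdiff g z" using subdiff_polyhedral_iff[OF assms(1,2)] by blast
      then have "fst m /\<^sub>R s - l0 \<in> ?L" using assms(3) by (rule diff_in_parallel_subspace)
      then have "s *\<^sub>R (fst m /\<^sub>R s - l0) \<in> ?L" by (simp add: subspace_scale)
      then show ?thesis using s by (simp add: scaleR_diff_right s_def)
    qed
  qed
  show ?thesis using assms(4)
  proof (induction rule: span_induct_alt)
    case base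
    then show ?case by (simp add: subspace_0)
  next
    case (step c m y)
    have "c *\<^sub>R (fst m + snd m *\<^sub>R l0) + (fst y + snd y *\<^sub>R l0) \<in> ?L"
      using base[OF step(1)] step(2) by (simp add: subspace_add subspace_scale)
    then show ?case by (simp add: algebra_simps)
  qed
qed

text \<open>Vertical rays force a nonpositive height coefficient \<open>d\<close> in every
  half-space containing the epigraph. If \<open>d = 0\<close>, the constraint depends on
  \<open>y\<close> alone and holds on the domain; if \<open>d < 0\<close>, raising the height by
  \<open>\<eta>\<close> makes it strict at \<open>z\<close> and hence valid nearby.\<close>

lemma polyhedral_fun_usc_on_dom:
  fixes g :: "'a::euclidean_space \<Rightarrow> ereal"
  assumes "polyhedral_fun g" "g z = ereal r" "\<eta> > 0"
  shows "\<forall>\<^sub>F y in nhds z. g y \<noteq> \<infinity> \<longrightarrow> g y \<le> ereal (r + \<eta>)"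
proof -
  obtain F where F: "finite F" "epi g = \<Inter> F" and hs: "\<And>h. h \<in> F \<Longrightarrow> \<exists>a b. h = {x. inner a x \<le> b}"
    using assms(1) unfolding polyhedral_fun_def polyhedron_def by metis
  have fin: "g y \<noteq> -\<infinity>" for y using assms(1) unfolding polyhedral_fun_def by blast
  have ev: "\<forall>\<^sub>F y in nhds z. g y \<noteq> \<infinity> \<longrightarrow> (y, r + \<eta>) \<in> h" if hF: "h \<in> F" for h
  proof -
    obtain n b where "h = {x. inner n x \<le> b}" using hs[OF hF] by blast
    then obtain c d where h: "h = {x. inner c (fst x) + d * snd x \<le> b}"
      using that by (cases n) (auto simp: inner_prod_def)
    have sub: "epi g \<subseteq> h" using F(2) hF by blast
    have ray: "inner c z + d * (r + s) \<le> b" if "s \<ge> 0" for s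
    proof -
      have "(z, r + s) \<in> epi g" using that assms(2) unfolding epi_def by simp
      then show ?thesis using sub h by auto
    qed
    have d: "d \<le> 0"
    proof (rule ccontr)
      assume "\<not> d \<le> 0"
      then have pos: "d > 0" by simp
      \<comment> \<open>A height for which \<open>d * e\<close> exceeds the slack of the constraint
        at \<open>(z, r)\<close>.\<close>
      define e where "e = (\<bar>b - inner c z - d * r\<bar> + 1) / d"
      have "e \<ge> 0" using pos unfolding e_def by simp
      then have "inner c z + d * (r + e) \<le> b" by (rule ray)
      moreover have "d * e = \<bar>b - inner c z - d * r\<bar> + 1"
        using pos unfolding e_def by (metis less_irrefl nonzero_mult_div_cancel_left times_divide_eq_right)
      ultimately have "inner c z + d * r + \<bar>b - inner c z - d * r\<bar> + 1 \<le> b"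
        by (simp add: distrib_left)
      then show False by linarith
    qed
    show ?thesis
    proof (cases "d = 0")
      case True
      have "(y, r + \<eta>) \<in> h" if y: "g y \<noteq> \<infinity>" for y
      proof -
        obtain a where "g y = ereal a" using y fin[of y] by (cases "g y") auto
        then have "(y, a) \<in> epi g" unfolding epi_def by simp
        then show ?thesis using sub h True by auto
      qed
      then show ?thesis by simp
    next
      case False
      have "d * (r + \<eta>) < d * (r + 0)" using d False assms(3) by (simp add: mult_less_cancel_left)
      then have "inner c z < b - d * (r + \<eta>)" using ray[of 0] by linarith
      then have "\<forall>\<^sub>F y in nhds z. y \<in> {y. inner c y < b - d * (r + \<eta>)}"
        by (intro eventually_nhds_in_open open_halfspace_lt) simp
      then show ?thesis by eventually_elim (simp add: h)
    qed
  qed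
  have "\<forall>\<^sub>F y in nhds z. \<forall>h\<in>F. g y \<noteq> \<infinity> \<longrightarrow> (y, r + \<eta>) \<in> h"
    by (rule eventually_ball_finite[OF F(1)]) (use ev in blast)
  then show ?thesis
  proof eventually_elim
    case (elim y)
    show ?case
    proof
      assume "g y \<noteq> \<infinity>"
      then have "(y, r + \<eta>) \<in> epi g" using elim F(2) by simp
      then show "g y \<le> ereal (r + \<eta>)" unfolding epi_def by simp
    qed
  qed
qed

text \<open>The affine minorant with slope \<open>l\<close> bounds \<open>g\<close> from below. The
  purpose is to bring the graph points over nearby \<open>y\<close> close to \<open>(z, r)\<close>,
  where local statements about the epigraph apply.\<close>

lemma polyhedral_fun_continuous_on_dom:
  fixes g :: "'a::euclidean_space \<Rightarrow> ereal"
  assumes g: "polyhedral_fun g" "g z = ereal r" and l: "l \<in> subdiff g z" and "\<eta> > 0"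
  shows "\<forall>\<^sub>F y in nhds z. \<forall>s. g y = ereal s \<longrightarrow> \<bar>s - r\<bar> < \<eta>"
proof -
  have "((\<lambda>y. inner l (y - z)) \<longlongrightarrow> inner l (z - z)) (nhds z)"
    by (intro tendsto_intros filterlim_ident)
  then have "\<forall>\<^sub>F y in nhds z. inner l (y - z) > - \<eta>"
    using assms(4) by (intro order_tendstoD(1)) auto
  moreover have "\<forall>\<^sub>F y in nhds z. g y \<noteq> \<infinity> \<longrightarrow> g y \<le> ereal (r + \<eta> / 2)"
    using assms(4) by (intro polyhedral_fun_usc_on_dom[OF g]) simp
  ultimately show ?thesis
  proof eventually_elim
    case (elim y)
    show ?case
    proof (intro allI impI)
      fix s assume s: "g y = ereal s"
      have "r + inner l (y - z) \<le> s" using subdiff_ineq[OF g l] s by simp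
      moreover have "s \<le> r + \<eta> / 2" using elim(2) s by simp
      ultimately show "\<bar>s - r\<bar> < \<eta>" using elim(1) assms(4) by linarith
    qed
  qed
qed

text \<open>Normal cones of the polyhedral epigraph can only shrink on moving away from
  \<open>(z, r)\<close>. Multipliers at nearby points thus lie in one fixed subdifferential, and
  their differences in one fixed subspace.\<close>

lemma subdiff_mono:
  fixes g :: "'a::euclidean_space \<Rightarrow> ereal"
  assumes g: "polyhedral_fun g" "g z = ereal r" and l: "l \<in> subdiff g z"
  shows "\<forall>\<^sub>F y in nhds z. subdiff g y \<subseteq> subdiff g z"
proof -
  have poly: "polyhedron (epi g)" using g(1) unfolding polyhedral_fun_def by blast
  have "(z, r) \<in> epi g" using g(2) unfolding epi_def by simp
  then obtain d where d: "d > 0"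
    and mono: "\<And>q. q \<in> epi g \<inter> ball (z, r) d \<Longrightarrow> normal_cone (epi g) q \<subseteq> normal_cone (epi g) (z, r)"
    using polyhedron_normal_cone_mono[OF poly] by blast
  have "\<forall>\<^sub>F y in nhds z. dist y z < d / 2"
    using d unfolding eventually_nhds_metric by (intro exI[of _ "d / 2"]) auto
  moreover have "\<forall>\<^sub>F y in nhds z. \<forall>s. g y = ereal s \<longrightarrow> \<bar>s - r\<bar> < d / 2"
    using d by (intro polyhedral_fun_continuous_on_dom[OF g l]) simp
  ultimately show ?thesis
  proof eventually_elim
    case (elim y)
    show ?case
    proof
      fix m assume m: "m \<in> subdiff g y"
      then obtain s where s: "g y = ereal s" using subdiff_finite by blast
      have "dist (y, s) (z, r) \<le> dist y z + dist s r"
        unfolding dist_prod_def by (simp add: sqrt_sum_squares_le_sum)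
      then have "dist (z, r) (y, s) < d" using elim s by (simp add: dist_real_def dist_commute)
      then have "(y, s) \<in> epi g \<inter> ball (z, r) d" using s unfolding epi_def by simp
      then show "m \<in> subdiff g z"
        using mono m subdiff_polyhedral_iff[OF g(1) s] subdiff_polyhedral_iff[OF g] by blast
    qed
  qed
qed

section \<open>The graph of the subdifferential at relative interior points\<close>

definition relatively_interior :: "'a::real_normed_vector \<Rightarrow> 'a set \<Rightarrow> real \<Rightarrow> bool" where
  "relatively_interior l1 C e \<longleftrightarrow>
     (\<forall>l\<in>parallel_subspace C. norm l < e \<longrightarrow> l1 + l \<in> C)"

lemma add_parallel_in_affine_hull:
  assumes "a \<in> C" "l \<in> parallel_subspace C"
  shows "a + l \<in> affine hull C"
  using assms(2) unfolding parallel_subspace_def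
proof (induction rule: span_induct_alt)
  case base
  then show ?case using assms(1) by (simp add: hull_inc)
next
  case (step c x y)
  then obtain u v where x: "x = u - v" "u \<in> C" "v \<in> C" by blast
  have "(a + y) + c *\<^sub>R (u - v) \<in> affine hull C"
    by (rule mem_affine_3_minus[OF affine_affine_hull step(2)]) (use x in \<open>auto intro: hull_inc\<close>)
  then show ?case unfolding x(1) by (simp add: algebra_simps)
qed

lemma rel_interior_imp_relatively_interior:
  fixes C :: "'a::euclidean_space set"
  assumes "a \<in> rel_interior C"
  shows "\<exists>e>0. relatively_interior a C e"
proof -
  obtain e where e: "a \<in> C" "e > 0" "ball a e \<inter> affine hull C \<subseteq> C"
    using assms unfolding mem_rel_interior_ball by blast
  have "a + l \<in> C" if "l \<in> parallel_subspace C" "norm l < e" for l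
  proof -
    have "a + l \<in> ball a e" using that(2) by (simp add: dist_norm)
    then show ?thesis using add_parallel_in_affine_hull[OF e(1) that(1)] e(3) by blast
  qed
  then show ?thesis using e(2) unfolding relatively_interior_def by blast
qed

text \<open>As a subgradient at both points, \<open>l\<close> makes the increment of
  \<open>g\<close> from \<open>z\<close> to \<open>y\<close> equal to
  \<open>inner l (y - z)\<close>. A small perturbation of \<open>l\<close> along \<open>h\<close> is
  still a subgradient at \<open>z\<close>, and its inequality leaves
  \<open>inner h (y - z) \<le> 0\<close>; the same for \<open>- h\<close> gives equality.\<close>

lemma subdiff_graph_flat_point:
  fixes g :: "'a::euclidean_space \<Rightarrow> ereal"
  assumes g: "polyhedral_fun g" "g z = ereal r"
    and l: "l \<in> subdiff g y" "subdiff g y \<subseteq> subdiff g z"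
    and int: "relatively_interior l (subdiff g z) e" "e > 0"
    and h: "h \<in> parallel_subspace (subdiff g z)"
  shows "inner h (y - z) = 0"
proof -
  obtain s where s: "g y = ereal s" using subdiff_finite[OF l(1)] by blast
  have half: "inner h (y - z) \<le> 0" if h: "h \<in> parallel_subspace (subdiff g z)" for h
  proof -
    \<comment> \<open>Makes the norm of \<open>t *\<^sub>R h\<close> at most \<open>e / 2\<close>;
      the added 1 covers \<open>h = 0\<close>.\<close>
    define t where "t = e / (2 * (norm h + 1))"
    have np: "norm h + 1 > 0" by (simp add: add_nonneg_pos)
    have t: "t > 0" using int(2) np unfolding t_def by simp
    have "t * norm h \<le> t * (norm h + 1)" using t by simp
    also have "\<dots> = e / 2" unfolding t_def using np by (simp add: field_simps)
    finally have "norm (t *\<^sub>R h) < e" using t int(2) by simp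
    then have "l + t *\<^sub>R h \<in> subdiff g z"
      using int(1) h unfolding relatively_interior_def by (simp add: subspace_scale)
    then have "r + inner (l + t *\<^sub>R h) (y - z) \<le> s"
      using s by (intro subdiff_ineq[OF g]) auto
    moreover have "s + inner l (z - y) \<le> r"
      using g(2) by (intro subdiff_ineq[OF g(1) s l(1)]) simp
    ultimately have "t * inner h (y - z) \<le> 0"
      by (simp add: inner_add_left inner_diff_right algebra_simps)
    then show ?thesis using t by (simp add: mult_le_0_iff)
  qed
  from half[OF h] half[of "- h"] h show ?thesis by (simp add: subspace_neg)
qed

lemma subdiff_graph_flat:
  fixes g :: "'a::euclidean_space \<Rightarrow> ereal"
  assumes g: "polyhedral_fun g" "g z = ereal r"
    and l1: "l1 \<in> rel_interior (subdiff g z)"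
  shows "\<forall>\<^sub>F p in nhds (z, l1). snd p \<in> subdiff g (fst p) \<longrightarrow>
     snd p - l1 \<in> parallel_subspace (subdiff g z) \<and>
     (\<forall>h\<in>parallel_subspace (subdiff g z). inner h (fst p - z) = 0)"
proof -
  obtain e where e: "e > 0" "relatively_interior l1 (subdiff g z) e"
    using rel_interior_imp_relatively_interior[OF l1] by blast
  have l1': "l1 \<in> subdiff g z" using l1 rel_interior_subset by blast
  have "\<forall>\<^sub>F y in nhds z. subdiff g y \<subseteq> subdiff g z" by (rule subdiff_mono[OF g l1'])
  moreover have "(fst \<longlongrightarrow> z) (nhds (z, l1))"
    using tendsto_fst[OF filterlim_ident[of "nhds (z, l1)"]] by simp
  ultimately have ev1: "\<forall>\<^sub>F p in nhds (z, l1). subdiff g (fst p) \<subseteq> subdiff g z"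
    by (rule eventually_compose_filterlim)
  have "\<forall>\<^sub>F l in nhds l1. norm (l - l1) < e / 2"
    using e(1) unfolding eventually_nhds_metric dist_norm by (intro exI[of _ "e / 2"]) auto
  moreover have "(snd \<longlongrightarrow> l1) (nhds (z, l1))"
    using tendsto_snd[OF filterlim_ident[of "nhds (z, l1)"]] by simp
  ultimately have ev2: "\<forall>\<^sub>F p in nhds (z, l1). norm (snd p - l1) < e / 2"
    by (rule eventually_compose_filterlim)
  show ?thesis using ev1 ev2
  proof eventually_elim
    case (elim p)
    show ?case
    proof
      assume p: "snd p \<in> subdiff g (fst p)"
      then have par: "snd p - l1 \<in> parallel_subspace (subdiff g z)"
        using elim(1) l1' diff_in_parallel_subspace by blast
      have "relatively_interior (snd p) (subdiff g z) (e / 2)"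
        unfolding relatively_interior_def
      proof (intro ballI impI)
        fix l assume l: "l \<in> parallel_subspace (subdiff g z)" "norm l < e / 2"
        have "norm (snd p - l1 + l) < e" using l(2) elim(2) norm_triangle_ineq[of "snd p - l1" l] by linarith
        moreover have "snd p - l1 + l \<in> parallel_subspace (subdiff g z)" using par l(1) by (simp add: subspace_add)
        ultimately have "l1 + (snd p - l1 + l) \<in> subdiff g z"
          using e(2) unfolding relatively_interior_def by blast
        then show "snd p + l \<in> subdiff g z" by (simp add: algebra_simps)
      qed
      then show "snd p - l1 \<in> parallel_subspace (subdiff g z) \<and>
         (\<forall>h\<in>parallel_subspace (subdiff g z). inner h (fst p - z) = 0)"
        using par subdiff_graph_flat_point[OF g p elim(1), of "e / 2"] e(1) by auto
    qed
  qed
qed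

text \<open>The position of \<open>l0\<close> in the subdifferential is arbitrary, so regular
  normals are produced at relative interior points \<open>l k\<close> tending to it. Graph points
  near these are displaced orthogonally to the parallel subspace in the first component, which makes
  \<open>(h, 0)\<close> a regular normal.\<close>

lemma parallel_subspace_subset_coderivative:
  fixes g :: "'a::euclidean_space \<Rightarrow> ereal"
  assumes g: "polyhedral_fun g" "g z = ereal r" and l0: "l0 \<in> subdiff g z"
  shows "parallel_subspace (subdiff g z) \<subseteq> coderivative (subdiff g) z l0 0"
proof
  let ?C = "subdiff g z"
  fix h assume h: "h \<in> parallel_subspace ?C"
  have conv: "convex ?C" by (rule convex_subdiff[OF g(1)])
  then obtain l' where l': "l' \<in> rel_interior ?C"
    using l0 rel_interior_eq_empty[OF conv] by blast
  define l where "l k = l0 - (1 / real (Suc k)) *\<^sub>R (l0 - l')" for k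
  have ri: "l k \<in> rel_interior ?C" for k
    unfolding l_def by (rule rel_interior_convex_shrink[OF conv l' l0]) auto
  have "(\<lambda>k. 1 / real (Suc k)) \<longlonglongrightarrow> 0"
    using LIMSEQ_inverse_real_of_nat by (simp add: inverse_eq_divide)
  then have "l \<longlonglongrightarrow> l0 - 0 *\<^sub>R (l0 - l')" unfolding l_def by (intro tendsto_intros)
  then have lim: "l \<longlonglongrightarrow> l0" by simp
  have reg: "(h, 0) \<in> regular_normal_cone (gph (subdiff g)) (z, l k)" for k
    unfolding regular_normal_cone_def polar_cone_def
  proof (intro CollectI ballI)
    fix w assume "w \<in> tangent_cone (gph (subdiff g)) (z, l k)"
    then obtain t w' where t: "\<And>j::nat. t j > (0::real)" "t \<longlonglongrightarrow> 0" and w': "w' \<longlonglongrightarrow> w"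
      and mem: "\<And>j. (z, l k) + t j *\<^sub>R w' j \<in> gph (subdiff g)"
      unfolding tangent_cone_def by blast
    have "(\<lambda>j. (z, l k) + t j *\<^sub>R w' j) \<longlonglongrightarrow> (z, l k) + 0 *\<^sub>R w"
      by (intro tendsto_intros t w')
    then have "filterlim (\<lambda>j. (z, l k) + t j *\<^sub>R w' j) (nhds (z, l k)) sequentially" by simp
    then have "\<forall>\<^sub>F j in sequentially. snd ((z, l k) + t j *\<^sub>R w' j) \<in> subdiff g (fst ((z, l k) + t j *\<^sub>R w' j)) \<longrightarrow>
        (\<forall>h\<in>parallel_subspace ?C. inner h (fst ((z, l k) + t j *\<^sub>R w' j) - z) = 0)"
      by (rule eventually_mono[OF eventually_compose_filterlim[OF subdiff_graph_flat[OF g ri[of k]]]]) blast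
    then have "\<forall>\<^sub>F j in sequentially. inner h (fst (w' j)) = 0"
    proof eventually_elim
      case (elim j)
      have "snd ((z, l k) + t j *\<^sub>R w' j) \<in> subdiff g (fst ((z, l k) + t j *\<^sub>R w' j))"
        using mem[of j] unfolding gph_def by (simp add: case_prod_beta)
      then have "inner h (fst ((z, l k) + t j *\<^sub>R w' j) - z) = 0" using elim h by blast
      then show ?case using t(1)[of j] by simp
    qed
    then have "(\<lambda>j. inner h (fst (w' j))) \<longlonglongrightarrow> 0" by (rule tendsto_eventually)
    moreover have "(\<lambda>j. inner h (fst (w' j))) \<longlonglongrightarrow> inner h (fst w)"
      by (intro tendsto_intros w')
    ultimately have "inner h (fst w) = 0" by (rule LIMSEQ_unique[symmetric])
    then show "inner (h, 0) w \<le> 0" by (simp add: inner_prod_def)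
  qed
  have "(h, - 0) \<in> limiting_normal_cone (gph (subdiff g)) (z, l0)"
  proof -
    have "(z, l k) \<in> gph (subdiff g)" for k
      using ri[of k] rel_interior_subset unfolding gph_def by blast
    moreover have "(\<lambda>k. (z, l k)) \<longlonglongrightarrow> (z, l0)" by (intro tendsto_intros lim)
    moreover have "(\<lambda>k::nat. (h, 0::'a)) \<longlonglongrightarrow> (h, - 0)" by simp
    ultimately show ?thesis using reg
      by (intro limiting_normal_coneI[of "\<lambda>k. (z, l k)" _ "\<lambda>_. (h, 0)"])
  qed
  then show "h \<in> coderivative (subdiff g) z l0 0" unfolding coderivative_def by simp
qed

section \<open>Composite functions\<close>

text \<open>The direction varies along with the step size, as in tangent cones and subderivatives.
  The filter is arbitrary because both sequences and the product filter of
  \<open>subderivative\<close> occur.\<close>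

lemma difference_quotient_tendsto:
  fixes F :: "'a::real_normed_vector \<Rightarrow> 'b::real_normed_vector"
  assumes "(F has_derivative D) (at x)"
    and t: "\<forall>\<^sub>F k in A. t k \<noteq> 0" "(t \<longlongrightarrow> 0) A" and w: "(w' \<longlongrightarrow> w) A"
  shows "((\<lambda>k. (F (x + t k *\<^sub>R w' k) - F x) /\<^sub>R t k) \<longlongrightarrow> D w) A"
proof -
  have bl: "bounded_linear D" using assms(1) by (rule has_derivative_bounded_linear)
  define R where "R h = norm (F (x + h) - F x - D h) / norm h" for h
  have R: "(R \<longlongrightarrow> 0) (at 0)"
    using assms(1) unfolding has_derivative_at R_def by blast
  \<comment> \<open>The increments \<open>t k *\<^sub>R w' k\<close> may vanish, so the remainder
    quotient needs its value at 0 and a limit along the full neighbourhood filter.\<close>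
  have R0: "R 0 = 0" unfolding R_def by simp
  have "(R \<longlongrightarrow> R 0) (nhds 0)"
    using R R0 tendsto_at_iff_tendsto_nhds by metis
  moreover have "((\<lambda>k. t k *\<^sub>R w' k) \<longlongrightarrow> 0 *\<^sub>R w) A" by (intro tendsto_intros t w)
  ultimately have "((\<lambda>k. R (t k *\<^sub>R w' k)) \<longlongrightarrow> 0) A"
    using R0 filterlim_compose[of R "nhds 0"] by simp
  then have lim: "((\<lambda>k. R (t k *\<^sub>R w' k) * norm (w' k)) \<longlongrightarrow> 0 * norm w) A"
    by (intro tendsto_intros w)
  have eq: "R (t k *\<^sub>R w' k) * norm (w' k) = norm ((F (x + t k *\<^sub>R w' k) - F x) /\<^sub>R t k - D (w' k))"
    if tk: "t k \<noteq> 0" for k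
  proof (cases "w' k = 0")
    case True
    then show ?thesis using linear_0[OF bounded_linear.linear[OF bl]] by simp
  next
    case False
    have "(F (x + t k *\<^sub>R w' k) - F x) /\<^sub>R t k - D (w' k)
        = (F (x + t k *\<^sub>R w' k) - F x - D (t k *\<^sub>R w' k)) /\<^sub>R t k"
      using tk by (simp add: scaleR_diff_right linear_cmul[OF bounded_linear.linear[OF bl]])
    then show ?thesis using tk False unfolding R_def by (simp add: divide_simps)
  qed
  have "((\<lambda>k. norm ((F (x + t k *\<^sub>R w' k) - F x) /\<^sub>R t k - D (w' k))) \<longlongrightarrow> 0) A"
  proof (rule Lim_transform_eventually)
    show "((\<lambda>k. R (t k *\<^sub>R w' k) * norm (w' k)) \<longlongrightarrow> 0) A" using lim by simp
    show "\<forall>\<^sub>F k in A. R (t k *\<^sub>R w' k) * norm (w' k) = norm ((F (x + t k *\<^sub>R w' k) - F x) /\<^sub>R t k - D (w' k))"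
      using t(1) by (rule eventually_mono) (rule eq)
  qed
  then have "((\<lambda>k. (F (x + t k *\<^sub>R w' k) - F x) /\<^sub>R t k - D (w' k)) \<longlongrightarrow> 0) A"
    by (rule tendsto_norm_zero_cancel)
  moreover have "((\<lambda>k. D (w' k)) \<longlongrightarrow> D w) A"
    using bounded_linear.tendsto[OF bl w] .
  ultimately have "((\<lambda>k. ((F (x + t k *\<^sub>R w' k) - F x) /\<^sub>R t k - D (w' k)) + D (w' k)) \<longlongrightarrow> 0 + D w) A"
    by (rule tendsto_add)
  then show ?thesis by simp
qed

text \<open>A linear map that is injective on a subspace is bounded below there, and half of this
  bound survives small perturbations. The uniform constant gives transversality at nearby points and
  bounds multipliers by the normals they represent.\<close>

lemma adjoint_bounded_below:
  fixes T :: "'x::t2_space \<Rightarrow> 'a::euclidean_space \<Rightarrow> 'b::euclidean_space"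
  assumes W: "open W" "x0 \<in> W"
    and lin: "\<And>x. x \<in> W \<Longrightarrow> linear (T x)"
    and cont: "\<And>h. continuous_on W (\<lambda>x. T x h)"
    and L: "subspace L"
    and inj: "\<And>n. n \<in> L \<Longrightarrow> (\<And>w. inner n (T x0 w) = 0) \<Longrightarrow> n = 0"
  shows "\<exists>c>0. \<forall>\<^sub>F x in nhds x0. \<forall>l\<in>L. c * norm l \<le> norm (adjoint (T x) l)"
proof -
  have adj: "linear (adjoint (T x0))" using adjoint_linear[OF lin[OF W(2)]] .
  have "\<forall>l\<in>L. adjoint (T x0) l = 0 \<longrightarrow> l = 0"
  proof (intro ballI impI)
    fix l assume l: "l \<in> L" "adjoint (T x0) l = 0"
    have "inner l (T x0 w) = 0" for w
      using adjoint_works[OF lin[OF W(2)], of w l] l(2) by (simp add: inner_commute)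
    then show "l = 0" using inj l(1) by blast
  qed
  then obtain e where e: "e > 0" "\<And>l. l \<in> L \<Longrightarrow> e * norm l \<le> norm (adjoint (T x0) l)"
    using injective_imp_isometric[OF closed_subspace[OF L] L linear_conv_bounded_linear[THEN iffD1, OF adj]]
    by metis
  define m where "m x = (\<Sum>b\<in>Basis. norm (T x b - T x0 b))" for x
  have "isCont (\<lambda>x. T x h) x0" for h using cont[of h] W by (simp add: continuous_on_eq_continuous_at)
  then have "(m \<longlongrightarrow> (\<Sum>b\<in>Basis. norm (T x0 b - T x0 b))) (at x0)"
    unfolding m_def isCont_def by (intro tendsto_intros) auto
  then have "(m \<longlongrightarrow> m x0) (at x0)" unfolding m_def by simp
  then have "(m \<longlongrightarrow> m x0) (nhds x0)" using tendsto_at_iff_tendsto_nhds by metis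
  then have "\<forall>\<^sub>F x in nhds x0. m x < e / 2"
    by (rule order_tendstoD(2)) (use e(1) in \<open>simp add: m_def\<close>)
  moreover have "\<forall>\<^sub>F x in nhds x0. x \<in> W" using W by (rule eventually_nhds_in_open)
  ultimately have "\<forall>\<^sub>F x in nhds x0. \<forall>l\<in>L. e / 2 * norm l \<le> norm (adjoint (T x) l)"
  proof eventually_elim
    case (elim x)
    show ?case
    proof
      fix l assume l: "l \<in> L"
      have rep: "adjoint (T y) l = (\<Sum>b\<in>Basis. inner (T y b) l *\<^sub>R b)" if "y \<in> W" for y
      proof -
        have "adjoint (T y) l = (\<Sum>b\<in>Basis. inner (adjoint (T y) l) b *\<^sub>R b)"
          by (simp add: euclidean_representation)
        also have "\<dots> = (\<Sum>b\<in>Basis. inner (T y b) l *\<^sub>R b)"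
          using adjoint_works[OF lin[OF that]] by (intro sum.cong refl) (metis inner_commute)
        finally show ?thesis .
      qed
      have "norm (adjoint (T x) l - adjoint (T x0) l) = norm (\<Sum>b\<in>Basis. inner (T x b - T x0 b) l *\<^sub>R b)"
        unfolding rep[OF elim(2)] rep[OF W(2)]
        by (simp add: inner_diff_left scaleR_left_diff_distrib sum_subtractf)
      also have "\<dots> \<le> (\<Sum>b\<in>Basis. norm (T x b - T x0 b) * norm l)"
        by (rule sum_norm_le) (simp add: Cauchy_Schwarz_ineq2)
      also have "\<dots> = m x * norm l" unfolding m_def by (simp add: sum_distrib_right)
      also have "\<dots> \<le> e / 2 * norm l" using elim(1) by (intro mult_right_mono) auto
      finally have "norm (adjoint (T x) l - adjoint (T x0) l) \<le> e / 2 * norm l" .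
      moreover have "norm (adjoint (T x0) l) \<le> norm (adjoint (T x) l) + norm (adjoint (T x) l - adjoint (T x0) l)"
        by (metis add.commute norm_minus_commute norm_triangle_sub)
      ultimately show "e / 2 * norm l \<le> norm (adjoint (T x) l)" using e(2)[OF l] by linarith
    qed
  qed
  then show ?thesis using e(1) by (intro exI[of _ "e / 2"]) simp
qed

section \<open>Composites transversal at the reference point and their chain rule\<close>

locale transversal_composite =
  fixes g :: "'b::euclidean_space \<Rightarrow> ereal" and \<phi> :: "'a::euclidean_space \<Rightarrow> ereal"
    and \<Phi> :: "'a \<Rightarrow> 'b" and \<Phi>' :: "'a \<Rightarrow> 'a \<Rightarrow> 'b" and W xbar r lbar
  assumes W: "open W" "xbar \<in> W"
    and der: "\<And>x. x \<in> W \<Longrightarrow> (\<Phi> has_derivative \<Phi>' x) (at x)"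
    and cont: "\<And>h. continuous_on W (\<lambda>x. \<Phi>' x h)"
    and \<phi>: "\<And>x. x \<in> W \<Longrightarrow> \<phi> x = g (\<Phi> x)"
    and g: "polyhedral_fun g" "g (\<Phi> xbar) = ereal r"
    and lbar: "lbar \<in> subdiff g (\<Phi> xbar)"
    and inj: "\<And>l. l \<in> parallel_subspace (subdiff g (\<Phi> xbar)) \<Longrightarrow> (\<And>w. inner l (\<Phi>' xbar w) = 0) \<Longrightarrow> l = 0"
begin

text \<open>\<open>F\<close> carries the height along, so above \<open>W\<close> the epigraph of
  \<open>\<phi>\<close> is the preimage of that of \<open>g\<close>. \<open>N\<close> takes the
  place of \<open>L\<close> at the level of epigraphs and also contains the horizontal
  normals.\<close>

abbreviation "L \<equiv> parallel_subspace (subdiff g (\<Phi> xbar))"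
abbreviation "F \<equiv> \<lambda>q::'a \<times> real. (\<Phi> (fst q), snd q)"
abbreviation "DF \<equiv> \<lambda>(q::'a \<times> real) (h::'a \<times> real). (\<Phi>' (fst q) (fst h), snd h)"
abbreviation "N \<equiv> span (normal_cone (epi g) (\<Phi> xbar, r))"

lemma lin\<Phi>: "x \<in> W \<Longrightarrow> linear (\<Phi>' x)" using has_derivative_linear[OF der] .

lemma isCont\<Phi>: "x \<in> W \<Longrightarrow> isCont \<Phi> x" using has_derivative_continuous[OF der] .

lemma isCont\<Phi>': "x \<in> W \<Longrightarrow> isCont (\<lambda>x. \<Phi>' x h) x"
  using cont[of h] W(1) by (simp add: continuous_on_eq_continuous_at)

lemma openWF: "open (W \<times> (UNIV :: real set))" using W(1) by (intro open_Times) auto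

lemma derF: "(F has_derivative DF q) (at q)" if "q \<in> W \<times> UNIV" for q
proof -
  have "fst q \<in> W" using that by (cases q) auto
  then have "((\<lambda>q. \<Phi> (fst q)) has_derivative (\<lambda>h. \<Phi>' (fst q) (fst h))) (at q)"
    by (intro has_derivative_compose[OF _ der] derivative_intros)
  then show ?thesis by (intro has_derivative_Pair derivative_intros)
qed

lemma contDF: "continuous_on (W \<times> UNIV) (\<lambda>q. DF q h)"
  by (intro continuous_intros continuous_on_compose2[OF cont]) auto

text \<open>Transversality passes from \<open>L\<close> to \<open>N\<close>: the vertical direction
  \<open>(0, 1)\<close> forces \<open>snd n = 0\<close>, and then
  \<open>span_normal_cone_epi\<close> places \<open>fst n\<close> in \<open>L\<close>, where
  \<open>inj\<close> applies.\<close>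

lemma injF: "n = 0" if "n \<in> N" "\<And>w. inner n (DF (xbar, s) w) = 0"
proof -
  have "inner n (DF (xbar, s) (0, 1)) = 0" using that(2) .
  then have "snd n = 0" using linear_0[OF lin\<Phi>[OF W(2)]] by (simp add: inner_prod_def)
  then have "fst n \<in> L" using span_normal_cone_epi[OF g lbar that(1)] by simp
  moreover have "inner (fst n) (\<Phi>' xbar w) = 0" for w
    using that(2)[of "(w, 0)"] \<open>snd n = 0\<close> by (simp add: inner_prod_def)
  ultimately have "fst n = 0" by (rule inj)
  then show ?thesis using \<open>snd n = 0\<close> by (simp add: prod_eq_iff)
qed

lemma epi\<phi>: "q \<in> W \<times> UNIV \<Longrightarrow> q \<in> epi \<phi> \<longleftrightarrow> F q \<in> epi g"
  using \<phi> unfolding epi_def by auto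

lemma epi_g: "convex (epi g)" "polyhedron (epi g)" "(\<Phi> xbar, r) \<in> epi g"
  using g unfolding polyhedral_fun_def epi_def by (auto simp: polyhedron_imp_convex)

lemma epi_g_locally_invariant:
  obtains B where "open B" "(\<Phi> xbar, r) \<in> B"
    "\<And>y z. y \<in> epi g \<inter> B \<Longrightarrow> z \<in> B \<Longrightarrow> (\<And>n. n \<in> N \<Longrightarrow> inner n z = inner n y) \<Longrightarrow> z \<in> epi g"
proof -
  obtain d where d: "d > 0"
    and loc: "\<And>y. y \<in> ball (\<Phi> xbar, r) d \<Longrightarrow>
      (\<forall>n\<in>normal_cone (epi g) (\<Phi> xbar, r). inner n (y - (\<Phi> xbar, r)) \<le> 0) \<Longrightarrow> y \<in> epi g"
    using polyhedron_locally_conic[OF epi_g(2,3)] by blast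
  have "z \<in> epi g" if y: "y \<in> epi g \<inter> ball (\<Phi> xbar, r) d" and z: "z \<in> ball (\<Phi> xbar, r) d"
    and eq: "\<And>n. n \<in> N \<Longrightarrow> inner n z = inner n y" for y z
  proof (rule loc[OF z], rule ballI)
    fix n assume n: "n \<in> normal_cone (epi g) (\<Phi> xbar, r)"
    have "inner n (y - (\<Phi> xbar, r)) \<le> 0" using n y unfolding normal_cone_def by blast
    then show "inner n (z - (\<Phi> xbar, r)) \<le> 0"
      using eq[OF span_base[OF n]] by (simp only: inner_diff_right)
  qed
  then show ?thesis using that[of "ball (\<Phi> xbar, r) d"] d by simp
qed

text \<open>The uniform lower bound on \<open>N\<close> yields transversality at all points near
  \<open>(xbar, r)\<close>. Applied to the normal \<open>n\<close> found there, it also controls its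
  norm, which is the compactness needed for limiting normals.\<close>

lemma regular_normals_epi:
  obtains Q c where "open Q" "(xbar, r) \<in> Q" "Q \<subseteq> W \<times> UNIV" "c > 0"
    "\<And>q \<nu>. q \<in> Q \<Longrightarrow> q \<in> epi \<phi> \<Longrightarrow> \<nu> \<in> regular_normal_cone (epi \<phi>) q \<Longrightarrow>
      \<exists>n\<in>normal_cone (epi g) (F q). (\<forall>w. inner \<nu> w = inner n (DF q w)) \<and> c * norm n \<le> norm \<nu>"
proof -
  obtain B where B: "open B" "(\<Phi> xbar, r) \<in> B"
    "\<And>y z. y \<in> epi g \<inter> B \<Longrightarrow> z \<in> B \<Longrightarrow> (\<And>n. n \<in> N \<Longrightarrow> inner n z = inner n y) \<Longrightarrow> z \<in> epi g"
    using epi_g_locally_invariant by metis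
  have q0: "(xbar, r) \<in> W \<times> UNIV" using W(2) by simp
  have linDF: "linear (DF q)" if "q \<in> W \<times> UNIV" for q
    using has_derivative_linear[OF derF[OF that]] .
  have "\<exists>c>0. \<forall>\<^sub>F q in nhds (xbar, r). \<forall>n\<in>N. c * norm n \<le> norm (adjoint (DF q) n)"
    by (rule adjoint_bounded_below[OF openWF q0, of DF]) (fact linDF contDF subspace_span | erule injF, assumption)+
  then obtain c where c: "c > 0" "\<forall>\<^sub>F q in nhds (xbar, r). \<forall>n\<in>N. c * norm n \<le> norm (adjoint (DF q) n)"
    by blast
  have "isCont F (xbar, r)" using has_derivative_continuous[OF derF[OF q0]] .
  then have "(F \<longlongrightarrow> F (xbar, r)) (nhds (xbar, r))"
    unfolding isCont_def by (rule tendsto_at_iff_tendsto_nhds[of F "(xbar, r)", THEN iffD1])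
  then have "\<forall>\<^sub>F q in nhds (xbar, r). F q \<in> B"
    using B(1,2) by (intro topological_tendstoD) auto
  moreover have "\<forall>\<^sub>F q in nhds (xbar, r). q \<in> W \<times> UNIV"
    using openWF q0 by (rule eventually_nhds_in_open)
  ultimately have "\<forall>\<^sub>F q in nhds (xbar, r). (\<forall>n\<in>N. c * norm n \<le> norm (adjoint (DF q) n)) \<and> F q \<in> B \<and> q \<in> W \<times> UNIV"
    using c(2) by eventually_elim blast
  then obtain Q where Q: "open Q" "(xbar, r) \<in> Q"
    and Qall: "\<forall>q\<in>Q. (\<forall>n\<in>N. c * norm n \<le> norm (adjoint (DF q) n)) \<and> F q \<in> B \<and> q \<in> W \<times> UNIV"
    unfolding eventually_nhds by blast
  have Q1: "\<And>q n. q \<in> Q \<Longrightarrow> n \<in> N \<Longrightarrow> c * norm n \<le> norm (adjoint (DF q) n)"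
    and Q2: "\<And>q. q \<in> Q \<Longrightarrow> F q \<in> B" and Q3: "\<And>q. q \<in> Q \<Longrightarrow> q \<in> W \<times> UNIV"
    using Qall by blast+
  have "\<exists>n\<in>normal_cone (epi g) (F q). (\<forall>w. inner \<nu> w = inner n (DF q w)) \<and> c * norm n \<le> norm \<nu>"
    if q: "q \<in> Q" and epi: "q \<in> epi \<phi>" and \<nu>: "\<nu> \<in> regular_normal_cone (epi \<phi>) q" for q \<nu>
  proof -
    have qW: "q \<in> W \<times> UNIV" by (rule Q3[OF q])
    have inj: "n = 0" if "n \<in> N" "\<And>w. inner n (DF q w) = 0" for n
    proof -
      have "inner (adjoint (DF q) n) w = 0" for w
        using adjoint_works[OF linDF[OF qW], of w n] that(2)[of w] by (metis inner_commute)
      then have "adjoint (DF q) n = 0" by (metis inner_eq_zero_iff)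
      then have "c * norm n \<le> 0" using Q1[OF q that(1)] by simp
      then show ?thesis using c(1) by (simp add: mult_le_0_iff)
    qed
    have "\<exists>n \<in> normal_cone (epi g) (F q) \<inter> N. \<forall>w. inner \<nu> w = inner n (DF q w)"
    proof (rule regular_normal_cone_preimage[of "W \<times> UNIV" q F DF N "epi g" B "epi \<phi>" \<nu>])
      show "open (W \<times> (UNIV::real set))" by (rule openWF)
      show "q \<in> W \<times> UNIV" by (rule qW)
      show "(F has_derivative DF x) (at x)" if "x \<in> W \<times> UNIV" for x by (rule derF[OF that])
      show "continuous_on (W \<times> UNIV) (\<lambda>x. DF x h)" for h by (rule contDF)
      show "subspace N" by (rule subspace_span)
      show "n = 0" if "n \<in> N" "\<And>w. inner n (DF q w) = 0" for n by (rule inj[OF that])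
      show "convex (epi g)" by (rule epi_g(1))
      show "F q \<in> epi g" using epi\<phi>[OF qW] epi by blast
      show "open B" by (rule B(1))
      show "F q \<in> B" by (rule Q2[OF q])
      show "z \<in> epi g" if "y \<in> epi g \<inter> B" "z \<in> B" "\<And>n. n \<in> N \<Longrightarrow> inner n z = inner n y" for y z
        by (rule B(3)[OF that])
      show "x \<in> epi \<phi>" if "x \<in> W \<times> UNIV" "F x \<in> epi g" for x using epi\<phi>[OF that(1)] that(2) by blast
      show "\<nu> \<in> regular_normal_cone (epi \<phi>) q" by (rule \<nu>)
    qed
    then obtain n where n: "n \<in> normal_cone (epi g) (F q)" "n \<in> N" "\<And>w. inner \<nu> w = inner n (DF q w)"
      by blast
    have "inner (adjoint (DF q) n) w = inner \<nu> w" for w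
      unfolding n(3)[of w] inner_commute[of "adjoint (DF q) n" w] adjoint_works[OF linDF[OF qW]]
      by (rule inner_commute)
    then have "adjoint (DF q) n = \<nu>" using vector_eq_rdot by blast
    then have "c * norm n \<le> norm \<nu>" using Q1[OF q n(2)] by simp
    then show ?thesis using n(1,3) by blast
  qed
  moreover have "Q \<subseteq> W \<times> UNIV" using Q3 by blast
  ultimately show ?thesis using that[of Q c] Q c(1) by blast
qed

text \<open>Limiting normals are limits of regular ones, whose bounded factors \<open>n\<close>
  converge along a subsequence. The normal cone inequalities of the convex set \<open>epi g\<close>
  pass to this limit.\<close>

lemma chain_rule:
  "\<forall>\<^sub>F x in nhds xbar. \<forall>v\<in>subdiff \<phi> x. \<exists>l\<in>subdiff g (\<Phi> x). \<forall>w. inner v w = inner l (\<Phi>' x w)"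
proof -
  obtain Q c where Q: "open Q" "(xbar, r) \<in> Q" "Q \<subseteq> W \<times> UNIV" and c: "c > 0"
    and reg: "\<And>q \<nu>. q \<in> Q \<Longrightarrow> q \<in> epi \<phi> \<Longrightarrow> \<nu> \<in> regular_normal_cone (epi \<phi>) q \<Longrightarrow>
      \<exists>n\<in>normal_cone (epi g) (F q). (\<forall>w. inner \<nu> w = inner n (DF q w)) \<and> c * norm n \<le> norm \<nu>"
    using regular_normals_epi by metis
  obtain A B where AB: "open A" "open B" "xbar \<in> A" "r \<in> B" "A \<times> B \<subseteq> Q"
    using Q(1,2) by (rule open_prod_elim) auto
  obtain e where e: "e > 0" "ball r e \<subseteq> B" using AB(2,4) openE by blast
  have "(\<Phi> \<longlongrightarrow> \<Phi> xbar) (nhds xbar)"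
    using isCont\<Phi>[OF W(2)] unfolding isCont_def by (rule tendsto_at_iff_tendsto_nhds[THEN iffD1])
  then have "\<forall>\<^sub>F x in nhds xbar. \<forall>s. g (\<Phi> x) = ereal s \<longrightarrow> \<bar>s - r\<bar> < e"
    by (rule eventually_compose_filterlim[OF polyhedral_fun_continuous_on_dom[OF g lbar e(1)]])
  moreover have "\<forall>\<^sub>F x in nhds xbar. x \<in> A" using AB by (intro eventually_nhds_in_open)
  ultimately show ?thesis
  proof eventually_elim
    case (elim x)
    show ?case
    proof
      fix v assume v: "v \<in> subdiff \<phi> x"
      obtain s where s: "\<phi> x = ereal s" using subdiff_finite[OF v] by blast
      have "(x, r) \<in> Q" using elim(2) AB by blast
      then have xW: "x \<in> W" using Q(3) by blast
      then have gs: "g (\<Phi> x) = ereal s" using \<phi> s by simp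
      \<comment> \<open>\<open>Q\<close> restricts heights as well; continuity of \<open>g\<close>
        on its domain keeps \<open>(x, s)\<close> inside.\<close>
      then have "s \<in> ball r e" using elim(1) by (simp add: dist_real_def abs_minus_commute)
      then have q: "(x, s) \<in> Q" using AB(5) elim(2) e(2) by blast
      have "(v, -1) \<in> limiting_normal_cone (epi \<phi>) (x, s)" using v s unfolding subdiff_def by simp
      then obtain q' \<nu> where q': "\<And>k::nat. q' k \<in> epi \<phi>" "q' \<longlonglongrightarrow> (x, s)"
        and \<nu>: "\<And>k. \<nu> k \<in> regular_normal_cone (epi \<phi>) (q' k)" "\<nu> \<longlonglongrightarrow> (v, -1)"
        unfolding limiting_normal_cone_def by blast
      have "\<forall>\<^sub>F k in sequentially. q' k \<in> Q" using q'(2) Q(1) q by (rule topological_tendstoD)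
      then obtain K where K: "\<And>k. k \<ge> K \<Longrightarrow> q' k \<in> Q" unfolding eventually_sequentially by blast
      define p where "p k = q' (k + K)" for k
      define \<mu> where "\<mu> k = \<nu> (k + K)" for k
      have p: "p \<longlonglongrightarrow> (x, s)" and \<mu>: "\<mu> \<longlonglongrightarrow> (v, -1)"
        unfolding p_def \<mu>_def using q'(2) \<nu>(2) by (auto intro: LIMSEQ_ignore_initial_segment)
      have pQ: "p k \<in> Q" for k unfolding p_def by (rule K) simp
      have "\<exists>n\<in>normal_cone (epi g) (F (p k)). (\<forall>w. inner (\<mu> k) w = inner n (DF (p k) w)) \<and> c * norm n \<le> norm (\<mu> k)" for k
        by (rule reg[OF pQ]) (simp_all add: p_def \<mu>_def q'(1) \<nu>(1))
      then obtain n where n: "\<And>k. n k \<in> normal_cone (epi g) (F (p k))"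
        "\<And>k w. inner (\<mu> k) w = inner (n k) (DF (p k) w)" "\<And>k. c * norm (n k) \<le> norm (\<mu> k)"
        by metis
      obtain b where b: "\<And>k. norm (\<mu> k) \<le> b"
        using convergent_imp_Bseq[OF convergentI[OF \<mu>]] unfolding Bseq_def by blast
      have "norm (n k) \<le> b / c" for k
        using order_trans[OF n(3) b, of k] c by (simp add: field_simps)
      then have "bounded (range n)" unfolding bounded_iff by blast
      then obtain m \<rho> where \<rho>: "strict_mono \<rho>" "(n \<circ> \<rho>) \<longlonglongrightarrow> m"
        using bounded_imp_convergent_subsequence by blast
      have p\<rho>: "(p \<circ> \<rho>) \<longlonglongrightarrow> (x, s)" and \<mu>\<rho>: "(\<mu> \<circ> \<rho>) \<longlonglongrightarrow> (v, -1)"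
        using LIMSEQ_subseq_LIMSEQ[OF p \<rho>(1)] LIMSEQ_subseq_LIMSEQ[OF \<mu> \<rho>(1)] by auto
      have xs: "(x, s) \<in> W \<times> UNIV" using xW by simp
      have "isCont F (x, s)" using has_derivative_continuous[OF derF[OF xs]] .
      then have Flim: "(\<lambda>k. F ((p \<circ> \<rho>) k)) \<longlonglongrightarrow> F (x, s)"
        by (rule isCont_tendsto_compose[OF _ p\<rho>])
      have eq: "inner (v, -1) w = inner m (DF (x, s) w)" for w
      proof -
        have "isCont (\<lambda>q. DF q w) (x, s)"
          using contDF[of w] openWF xs by (simp add: continuous_on_eq_continuous_at)
        then have "(\<lambda>k. DF ((p \<circ> \<rho>) k) w) \<longlonglongrightarrow> DF (x, s) w"
          by (rule isCont_tendsto_compose[OF _ p\<rho>])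
        then have "(\<lambda>k. inner ((n \<circ> \<rho>) k) (DF ((p \<circ> \<rho>) k) w)) \<longlonglongrightarrow> inner m (DF (x, s) w)"
          by (intro tendsto_inner \<rho>(2))
        moreover have "(\<lambda>k. inner ((\<mu> \<circ> \<rho>) k) w) \<longlonglongrightarrow> inner (v, -1) w"
          by (intro tendsto_inner \<mu>\<rho> tendsto_const)
        moreover have "(\<lambda>k. inner ((\<mu> \<circ> \<rho>) k) w) = (\<lambda>k. inner ((n \<circ> \<rho>) k) (DF ((p \<circ> \<rho>) k) w))"
          using n(2) by (intro ext) (simp only: o_def)
        ultimately show ?thesis using LIMSEQ_unique by metis
      qed
      have "inner m (y - F (x, s)) \<le> 0" if y: "y \<in> epi g" for y
      proof -
        have "inner ((n \<circ> \<rho>) k) (y - F ((p \<circ> \<rho>) k)) \<le> 0" for k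
          using n(1)[of "\<rho> k"] y unfolding normal_cone_def o_def by blast
        moreover have "(\<lambda>k. inner ((n \<circ> \<rho>) k) (y - F ((p \<circ> \<rho>) k))) \<longlonglongrightarrow> inner m (y - F (x, s))"
          by (intro tendsto_inner tendsto_diff tendsto_const \<rho>(2) Flim)
        ultimately show ?thesis by (meson LIMSEQ_le_const2)
      qed
      then have mN: "m \<in> normal_cone (epi g) (\<Phi> x, s)" unfolding normal_cone_def by simp
      \<comment> \<open>The vertical direction reads off the last component, so that the limit is a
        subgradient normal and not a horizontal one.\<close>
      have "snd m = -1"
        using eq[of "(0, 1)"] linear_0[OF lin\<Phi>[OF xW]] by (simp add: inner_prod_def)
      then have m: "m = (fst m, -1)" by (simp add: prod_eq_iff)
      have "fst m \<in> subdiff g (\<Phi> x)"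
        using mN m subdiff_polyhedral_iff[OF g(1) gs] by metis
      moreover have "inner v w = inner (fst m) (\<Phi>' x w)" for w
        using eq[of "(w, 0)"] by (simp add: inner_prod_def)
      ultimately show "\<exists>l\<in>subdiff g (\<Phi> x). \<forall>w. inner v w = inner l (\<Phi>' x w)" by blast
    qed
  qed
qed

text \<open>Dividing the subgradient inequality of \<open>g\<close> by the step sizes of a tangent
  sequence shows that \<open>(v, -1)\<close> is a regular normal to \<open>epi \<phi>\<close>;
  constant sequences make it a limiting one.\<close>

lemma subdiff_compositeI:
  assumes x: "x \<in> W" and l: "l \<in> subdiff g (\<Phi> x)" and v: "\<And>w. inner v w = inner l (\<Phi>' x w)"
  shows "v \<in> subdiff \<phi> x"
proof -
  obtain s where s: "g (\<Phi> x) = ereal s" using subdiff_finite[OF l] by blast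
  have \<phi>s: "\<phi> x = ereal s" using \<phi>[OF x] s by simp
  have "inner (v, -1) q \<le> 0" if q: "q \<in> tangent_cone (epi \<phi>) (x, s)" for q
  proof -
    obtain t q' where t: "\<And>k::nat. t k > (0::real)" "t \<longlonglongrightarrow> 0" and q': "q' \<longlonglongrightarrow> q"
      and mem: "\<And>k. (x, s) + t k *\<^sub>R q' k \<in> epi \<phi>"
      using q unfolding tangent_cone_def by blast
    define d where "d k = (\<Phi> (x + t k *\<^sub>R fst (q' k)) - \<Phi> x) /\<^sub>R t k" for k
    have fq: "(\<lambda>k. fst (q' k)) \<longlonglongrightarrow> fst q" by (intro tendsto_intros q')
    have d: "d \<longlonglongrightarrow> \<Phi>' x (fst q)"
      unfolding d_def using t(1)
      by (intro difference_quotient_tendsto[OF der[OF x]] t(2) fq always_eventually) (metis less_irrefl)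
    have "(\<lambda>k. x + t k *\<^sub>R fst (q' k)) \<longlonglongrightarrow> x + 0 *\<^sub>R fst q" by (intro tendsto_intros t(2) fq)
    then have "\<forall>\<^sub>F k in sequentially. x + t k *\<^sub>R fst (q' k) \<in> W"
      using W(1) x by (intro topological_tendstoD) auto
    then have "\<forall>\<^sub>F k in sequentially. inner l (d k) - snd (q' k) \<le> 0"
    proof eventually_elim
      case (elim k)
      have "\<phi> (x + t k *\<^sub>R fst (q' k)) \<le> ereal (s + t k * snd (q' k))"
        using mem[of k] unfolding epi_def by (simp add: case_prod_beta)
      then have "s + inner l (\<Phi> (x + t k *\<^sub>R fst (q' k)) - \<Phi> x) \<le> s + t k * snd (q' k)"
        using \<phi>[OF elim] by (intro subdiff_ineq[OF g(1) s l]) simp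
      moreover have "\<Phi> (x + t k *\<^sub>R fst (q' k)) - \<Phi> x = t k *\<^sub>R d k"
        unfolding d_def using t(1)[of k] by simp
      ultimately have "t k * inner l (d k) \<le> t k * snd (q' k)" by simp
      then show ?case using t(1)[of k] by simp
    qed
    moreover have "(\<lambda>k. inner l (d k) - snd (q' k)) \<longlonglongrightarrow> inner l (\<Phi>' x (fst q)) - snd q"
      by (intro tendsto_intros d q')
    ultimately have "inner l (\<Phi>' x (fst q)) - snd q \<le> 0"
      by (intro tendsto_upperbound[of _ _ sequentially]) auto
    then show ?thesis using v by (simp add: inner_prod_def)
  qed
  then have "(v, -1) \<in> regular_normal_cone (epi \<phi>) (x, s)"
    unfolding regular_normal_cone_def polar_cone_def by blast
  then have "(v, -1) \<in> limiting_normal_cone (epi \<phi>) (x, s)"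
    using \<phi>s by (intro limiting_normal_coneI[of "\<lambda>_. (x, s)" _ "\<lambda>_. (v, -1)"]) (auto simp: epi_def)
  then show ?thesis unfolding subdiff_def using \<phi>s by simp
qed

text \<open>A point of a convex set is relatively interior when every segment from the set to it can
  be prolonged beyond it. The prolongation is made from \<open>u\<close> through
  \<open>vbar\<close>, lifted back by the chain rule at \<open>xbar\<close>, and recognized as the
  one from \<open>l\<close> through \<open>lbar\<close> because the adjoint is injective on
  \<open>L\<close>.\<close>

lemma multiplier_rel_interior:
  assumes vbar: "vbar \<in> rel_interior (subdiff \<phi> xbar)" and v: "\<And>w. inner vbar w = inner lbar (\<Phi>' xbar w)"
  shows "lbar \<in> rel_interior (subdiff g (\<Phi> xbar))"
proof -
  let ?C = "subdiff g (\<Phi> xbar)" and ?D = "subdiff \<phi> xbar"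
  obtain e where e: "vbar \<in> ?D" "e > 0" "ball vbar e \<inter> affine hull ?D \<subseteq> ?D"
    using vbar unfolding mem_rel_interior_ball by blast
  have "\<exists>a>1. (1 - a) *\<^sub>R l + a *\<^sub>R lbar \<in> ?C" if l: "l \<in> ?C" for l
  proof -
    define u where "u = adjoint (\<Phi>' xbar) l"
    have u: "inner u w = inner l (\<Phi>' xbar w)" for w
      unfolding u_def using adjoint_works[OF lin\<Phi>[OF W(2)], of w l] by (metis inner_commute)
    have uD: "u \<in> ?D" by (rule subdiff_compositeI[OF W(2) l u])
    define \<delta> where "\<delta> = e / (2 * (norm (vbar - u) + 1))"
    have np: "norm (vbar - u) + 1 > 0" by (simp add: add_nonneg_pos)
    have \<delta>: "\<delta> > 0" using e(2) np unfolding \<delta>_def by simp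
    have "\<delta> * norm (vbar - u) \<le> \<delta> * (norm (vbar - u) + 1)" using \<delta> by simp
    also have "\<dots> = e / 2" unfolding \<delta>_def using np by (simp add: field_simps)
    finally have small: "norm (\<delta> *\<^sub>R (vbar - u)) < e" using \<delta> e(2) by simp
    have "vbar + \<delta> *\<^sub>R (vbar - u) \<in> affine hull ?D"
      by (rule mem_affine_3_minus[OF affine_affine_hull]) (use e(1) uD in \<open>auto intro: hull_inc\<close>)
    moreover have "vbar + \<delta> *\<^sub>R (vbar - u) \<in> ball vbar e" using small by (simp add: dist_norm)
    ultimately have "vbar + \<delta> *\<^sub>R (vbar - u) \<in> ?D" using e(3) by blast
    then obtain m where m: "m \<in> ?C" "\<And>w. inner (vbar + \<delta> *\<^sub>R (vbar - u)) w = inner m (\<Phi>' xbar w)"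
      using eventually_nhds_x_imp_x[OF chain_rule] by blast
    let ?k = "(1 - (1 + \<delta>)) *\<^sub>R l + (1 + \<delta>) *\<^sub>R lbar"
    have "?k - m = 0"
    proof (rule inj)
      have "?k - m = (lbar - m) + \<delta> *\<^sub>R (lbar - l)" by (simp add: algebra_simps)
      moreover have "(lbar - m) + \<delta> *\<^sub>R (lbar - l) \<in> L"
        using diff_in_parallel_subspace[OF lbar m(1)] diff_in_parallel_subspace[OF lbar l]
        by (intro subspace_add subspace_scale subspace_parallel_subspace)
      ultimately show "?k - m \<in> L" by (simp only:)
      show "inner (?k - m) (\<Phi>' xbar w) = 0" for w
        using m(2)[of w] u[of w] v[of w] by (simp add: inner_add_left inner_diff_left algebra_simps)
    qed
    then have "?k \<in> ?C" using m(1) by simp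
    then show ?thesis using \<delta> by (intro exI[of _ "1 + \<delta>"]) simp
  qed
  then show ?thesis
    using convex_rel_interior_iff[OF convex_subdiff[OF g(1)], of "\<Phi> xbar" lbar] lbar by blast
qed

section \<open>The critical subspace and the subderivative\<close>

definition K :: "'a set" where
  "K = {w. \<forall>l\<in>L. inner l (\<Phi>' xbar w) = 0}"

lemma subspace_K: "subspace K"
  unfolding subspace_def K_def using lin\<Phi>[OF W(2)]
  by (auto simp: linear_0 linear_add linear_cmul inner_add_right)

text \<open>For \<open>n\<close> in \<open>N\<close> the vector
  \<open>fst n + snd n *\<^sub>R lbar\<close> lies in \<open>L\<close>, so a flat step with height
  of slope \<open>lbar\<close> changes no inner product with \<open>N\<close> and stays in
  \<open>epi g\<close>. The subgradient inequality gives the reverse estimate.\<close>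

lemma g_on_flat:
  "\<forall>\<^sub>F y in nhds (\<Phi> xbar). (\<forall>l\<in>L. inner l (y - \<Phi> xbar) = 0) \<longrightarrow>
     g y = ereal (r + inner lbar (y - \<Phi> xbar))"
proof -
  let ?z = "\<Phi> xbar"
  obtain B where B: "open B" "(?z, r) \<in> B"
    "\<And>y z. y \<in> epi g \<inter> B \<Longrightarrow> z \<in> B \<Longrightarrow> (\<And>n. n \<in> N \<Longrightarrow> inner n z = inner n y) \<Longrightarrow> z \<in> epi g"
    using epi_g_locally_invariant by metis
  have "((\<lambda>y. (y, r + inner lbar (y - ?z))) \<longlongrightarrow> (?z, r + inner lbar (?z - ?z))) (nhds ?z)"
    by (intro tendsto_intros filterlim_ident)
  then have "\<forall>\<^sub>F y in nhds ?z. (y, r + inner lbar (y - ?z)) \<in> B"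
    using B(1,2) by (intro topological_tendstoD) auto
  then show ?thesis
  proof eventually_elim
    case (elim y)
    show ?case
    proof
      assume flat: "\<forall>l\<in>L. inner l (y - ?z) = 0"
      have "inner n (y, r + inner lbar (y - ?z)) = inner n (?z, r)" if n: "n \<in> N" for n
      proof -
        have "inner (fst n + snd n *\<^sub>R lbar) (y - ?z) = 0"
          using flat span_normal_cone_epi[OF g lbar n] by blast
        then show ?thesis by (simp add: inner_prod_def inner_add_left inner_diff_right algebra_simps)
      qed
      then have "(y, r + inner lbar (y - ?z)) \<in> epi g"
        using B(3)[of "(?z, r)"] elim B(2) epi_g(3) by blast
      then have le: "g y \<le> ereal (r + inner lbar (y - ?z))" unfolding epi_def by simp
      moreover have "g y \<noteq> -\<infinity>" using g(1) unfolding polyhedral_fun_def by blast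
      ultimately obtain s where s: "g y = ereal s" by (cases "g y") auto
      have "r + inner lbar (y - ?z) \<le> s" using s by (intro subdiff_ineq[OF g lbar]) simp
      then show "g y = ereal (r + inner lbar (y - ?z))" using le s by simp
    qed
  qed
qed

lemma subderivative_ge:
  assumes l: "l \<in> subdiff g (\<Phi> xbar)"
  shows "ereal (inner l (\<Phi>' xbar w)) \<le> subderivative \<phi> xbar w"
proof (rule ereal_le_epsilon2)
  fix e :: real assume e: "e > 0"
  let ?G = "at_right 0 \<times>\<^sub>F nhds w :: (real \<times> 'a) filter"
  let ?q = "\<lambda>p::real \<times> 'a. (\<Phi> (xbar + fst p *\<^sub>R snd p) - \<Phi> xbar) /\<^sub>R fst p"
  have f0: "filterlim fst (at_right 0) ?G" by (rule filterlim_fst)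
  have pos: "\<forall>\<^sub>F p in ?G. fst p > 0"
    using f0 unfolding filterlim_at by (auto elim: eventually_mono)
  have tf: "(fst \<longlongrightarrow> 0) ?G" using f0 unfolding filterlim_at by blast
  have ts: "(snd \<longlongrightarrow> w) ?G" by (rule filterlim_snd)
  have "(?q \<longlongrightarrow> \<Phi>' xbar w) ?G"
    using pos by (intro difference_quotient_tendsto[OF der[OF W(2)] _ tf ts]) (auto elim: eventually_mono)
  then have "((\<lambda>p. inner l (?q p)) \<longlongrightarrow> inner l (\<Phi>' xbar w)) ?G" by (intro tendsto_intros)
  then have ev1: "\<forall>\<^sub>F p in ?G. inner l (?q p) > inner l (\<Phi>' xbar w) - e"
    using e by (intro order_tendstoD(1)) auto
  have "((\<lambda>p. xbar + fst p *\<^sub>R snd p) \<longlongrightarrow> xbar + 0 *\<^sub>R w) ?G" by (intro tendsto_intros tf ts)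
  then have ev2: "\<forall>\<^sub>F p in ?G. xbar + fst p *\<^sub>R snd p \<in> W"
    using W by (intro topological_tendstoD) auto
  have "\<forall>\<^sub>F p in ?G. ereal (inner l (\<Phi>' xbar w) - e) \<le>
      (case p of (t, w') \<Rightarrow> (\<phi> (xbar + t *\<^sub>R w') - \<phi> xbar) / ereal t)"
    using pos ev1 ev2
  proof eventually_elim
    case (elim p)
    let ?t = "fst p" and ?y = "xbar + fst p *\<^sub>R snd p"
    have \<phi>r: "\<phi> xbar = ereal r" using \<phi>[OF W(2)] g(2) by simp
    have "ereal (inner l (\<Phi>' xbar w) - e) \<le> (\<phi> ?y - \<phi> xbar) / ereal ?t"
    proof (cases "g (\<Phi> ?y)")
      case (real s)
      have "r + inner l (\<Phi> ?y - \<Phi> xbar) \<le> s" using real by (intro subdiff_ineq[OF g l]) simp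
      then have "inner l (\<Phi> ?y - \<Phi> xbar) / ?t \<le> (s - r) / ?t"
        using elim(1) by (intro divide_right_mono) auto
      moreover have "inner l (?q p) = inner l (\<Phi> ?y - \<Phi> xbar) / ?t"
        by (simp add: divide_inverse mult.commute)
      ultimately have "inner l (\<Phi>' xbar w) - e \<le> (s - r) / ?t" using elim(2) by linarith
      then show ?thesis using \<phi>[OF elim(3)] real \<phi>r elim(1) by simp
    next
      case PInf
      then show ?thesis using \<phi>[OF elim(3)] \<phi>r elim(1) by simp
    next
      case MInf
      then show ?thesis using g(1) unfolding polyhedral_fun_def by metis
    qed
    then show ?case by (simp add: case_prod_beta)
  qed
  then have "ereal (inner l (\<Phi>' xbar w) - e) \<le> subderivative \<phi> xbar w"
    unfolding subderivative_def by (rule Liminf_bounded)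
  then show "ereal (inner l (\<Phi>' xbar w)) \<le> subderivative \<phi> xbar w + ereal e"
    by (cases "subderivative \<phi> xbar w") auto
qed

text \<open>\<open>DF\<close> maps \<open>(w, ?b)\<close> into the orthogonal complement of
  \<open>N\<close>, so this vector is tangent to \<open>epi \<phi>\<close>. Difference quotients
  along a tangent sequence are at most numbers tending to \<open>?b\<close>, which excludes a larger
  subderivative.\<close>

lemma subderivative_le:
  assumes w: "w \<in> K"
  shows "subderivative \<phi> xbar w \<le> ereal (inner lbar (\<Phi>' xbar w))"
proof (rule ccontr)
  let ?b = "inner lbar (\<Phi>' xbar w)"
  let ?G = "at_right 0 \<times>\<^sub>F nhds w :: (real \<times> 'a) filter"
  let ?X = "\<lambda>(t, w'). (\<phi> (xbar + t *\<^sub>R w') - \<phi> xbar) / ereal t"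
  assume "\<not> subderivative \<phi> xbar w \<le> ereal ?b"
  then obtain a where a: "ereal ?b < ereal a" "ereal a < subderivative \<phi> xbar w"
    using ereal_dense2[of "ereal ?b" "subderivative \<phi> xbar w"] by (auto simp: not_le)
  then have ev: "\<forall>\<^sub>F p in ?G. ereal a < ?X p"
    unfolding subderivative_def by (intro less_LiminfD)
  obtain B where B: "open B" "(\<Phi> xbar, r) \<in> B"
    "\<And>y z. y \<in> epi g \<inter> B \<Longrightarrow> z \<in> B \<Longrightarrow> (\<And>n. n \<in> N \<Longrightarrow> inner n z = inner n y) \<Longrightarrow> z \<in> epi g"
    using epi_g_locally_invariant by metis
  have q0: "(xbar, r) \<in> W \<times> UNIV" using W(2) by simp
  have "(w, ?b) \<in> tangent_cone (epi \<phi>) (xbar, r)"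
  \<comment> \<open>With \<open>F (xbar, r)\<close> itself as the target in the epigraph, the
    condition on the direction becomes orthogonality to \<open>N\<close>.\<close>
  proof (rule tangent_cone_preimage[of "W \<times> UNIV" "(xbar, r)" F DF N "epi g" "F (xbar, r)" B "epi \<phi>"])
    show "open (W \<times> (UNIV::real set))" by (rule openWF)
    show "(xbar, r) \<in> W \<times> UNIV" by (rule q0)
    show "(F has_derivative DF x) (at x)" if "x \<in> W \<times> UNIV" for x by (rule derF[OF that])
    show "continuous_on (W \<times> UNIV) (\<lambda>x. DF x h)" for h by (rule contDF)
    show "subspace N" by (rule subspace_span)
    show "n = 0" if "n \<in> N" "\<And>w. inner n (DF (xbar, r) w) = 0" for n by (rule injF[OF that])
    show "convex (epi g)" by (rule epi_g(1))
    show "F (xbar, r) \<in> epi g" "F (xbar, r) \<in> epi g" using epi_g(3) by simp_all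
    show "open B" by (rule B(1))
    show "F (xbar, r) \<in> B" using B(2) by simp
    show "z \<in> epi g" if "y \<in> epi g \<inter> B" "z \<in> B" "\<And>n. n \<in> N \<Longrightarrow> inner n z = inner n y" for y z
      by (rule B(3)[OF that])
    show "x \<in> epi \<phi>" if "x \<in> W \<times> UNIV" "F x \<in> epi g" for x using epi\<phi>[OF that(1)] that(2) by blast
    show "inner n (DF (xbar, r) (w, ?b)) = inner n (F (xbar, r) - F (xbar, r))" if n: "n \<in> N" for n
    proof -
      have "inner (fst n + snd n *\<^sub>R lbar) (\<Phi>' xbar w) = 0"
        using w span_normal_cone_epi[OF g lbar n] unfolding K_def by blast
      then show ?thesis by (simp add: inner_prod_def inner_add_left)
    qed
  qed
  then obtain t q where t: "\<And>k::nat. t k > (0::real)" "t \<longlonglongrightarrow> 0" and q: "q \<longlonglongrightarrow> (w, ?b)"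
    and mem: "\<And>k. (xbar, r) + t k *\<^sub>R q k \<in> epi \<phi>"
    unfolding tangent_cone_def by blast
  have fq: "(\<lambda>k. fst (q k)) \<longlonglongrightarrow> w" and sq: "(\<lambda>k. snd (q k)) \<longlonglongrightarrow> ?b"
    using tendsto_fst[OF q] tendsto_snd[OF q] by simp_all
  have "\<forall>\<^sub>F k in sequentially. t k \<in> {0<..} \<and> t k \<noteq> 0"
    using t(1) by (intro always_eventually allI) (metis greaterThan_iff less_irrefl)
  then have "filterlim t (at_right 0) sequentially"
    using t(2) unfolding filterlim_at by blast
  then have "filterlim (\<lambda>k. (t k, fst (q k))) ?G sequentially"
    using fq by (rule filterlim_Pair)
  then have "\<forall>\<^sub>F k in sequentially. ereal a < ?X (t k, fst (q k))"
    by (rule eventually_compose_filterlim[OF ev])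
  moreover have "\<forall>\<^sub>F k in sequentially. snd (q k) < a"
    by (rule order_tendstoD(2)[OF sq]) (use a(1) in simp)
  ultimately have "\<forall>\<^sub>F k in sequentially. False"
  proof eventually_elim
    case (elim k)
    have \<phi>r: "\<phi> xbar = ereal r" using \<phi>[OF W(2)] g(2) by simp
    have le: "\<phi> (xbar + t k *\<^sub>R fst (q k)) \<le> ereal (r + t k * snd (q k))"
      using mem[of k] unfolding epi_def by (simp add: case_prod_beta)
    have "?X (t k, fst (q k)) \<le> ereal (snd (q k))"
    proof (cases "\<phi> (xbar + t k *\<^sub>R fst (q k))")
      case (real s)
      then have "(s - r) / t k \<le> snd (q k)"
        using le t(1)[of k] by (simp add: pos_divide_le_eq algebra_simps)
      then show ?thesis using real \<phi>r t(1)[of k] by simp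
    next
      case PInf
      then show ?thesis using le by simp
    next
      case MInf
      then show ?thesis using \<phi>r t(1)[of k] by simp
    qed
    then have "ereal a < ereal (snd (q k))" using elim(1) by (rule less_le_trans[rotated])
    then show ?case using elim(2) by simp
  qed
  then show False by simp
qed

text \<open>The subderivative dominates \<open>inner l (\<Phi>' xbar w)\<close> for every
  subgradient \<open>l\<close>. Relative interiority admits perturbations of \<open>lbar\<close>
  both ways along \<open>L\<close>, so equality at \<open>lbar\<close> forces orthogonality to
  \<open>L\<close>.\<close>

lemma critical_cone_eq:
  assumes ri: "lbar \<in> rel_interior (subdiff g (\<Phi> xbar))"
    and v: "\<And>w. inner vbar w = inner lbar (\<Phi>' xbar w)"
  shows "critical_cone \<phi> xbar vbar = K"
proof
  show "K \<subseteq> critical_cone \<phi> xbar vbar"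
    using subderivative_ge[OF lbar] subderivative_le unfolding critical_cone_def v by (auto intro: antisym)
  show "critical_cone \<phi> xbar vbar \<subseteq> K"
  proof
    fix w assume "w \<in> critical_cone \<phi> xbar vbar"
    then have sub: "subderivative \<phi> xbar w = ereal (inner lbar (\<Phi>' xbar w))"
      unfolding critical_cone_def v by simp
    obtain e where e: "e > 0" "relatively_interior lbar (subdiff g (\<Phi> xbar)) e"
      using rel_interior_imp_relatively_interior[OF ri] by blast
    have half: "inner l (\<Phi>' xbar w) \<le> 0" if l: "l \<in> L" for l
    proof -
      define t where "t = e / (2 * (norm l + 1))"
      have np: "norm l + 1 > 0" by (simp add: add_nonneg_pos)
      have t: "t > 0" using e(1) np unfolding t_def by simp
      have "t * norm l \<le> t * (norm l + 1)" using t by simp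
      also have "\<dots> = e / 2" unfolding t_def using np by (simp add: field_simps)
      finally have "norm (t *\<^sub>R l) < e" using t e(1) by simp
      then have "lbar + t *\<^sub>R l \<in> subdiff g (\<Phi> xbar)"
        using e(2) l unfolding relatively_interior_def by (simp add: subspace_scale)
      then have "ereal (inner (lbar + t *\<^sub>R l) (\<Phi>' xbar w)) \<le> ereal (inner lbar (\<Phi>' xbar w))"
        using subderivative_ge sub by metis
      then show ?thesis using t by (simp add: inner_add_left mult_le_0_iff)
    qed
    have "inner l (\<Phi>' xbar w) = 0" if l: "l \<in> L" for l
      using half[OF l] half[of "- l"] l by (simp add: subspace_neg)
    then show "w \<in> K" unfolding K_def by blast
  qed
qed

section \<open>The graph of the subdifferential of the composite near the reference point\<close>

lemma adjoint\<Phi>: "x \<in> W \<Longrightarrow> inner (adjoint (\<Phi>' x) l) w = inner l (\<Phi>' x w)"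
  using adjoint_works[OF lin\<Phi>, of x w l] by (metis inner_commute)

lemma adjoint\<Phi>_eqI:
  assumes "x \<in> W" "\<And>w. inner v w = inner l (\<Phi>' x w)"
  shows "v = adjoint (\<Phi>' x) l"
  using vector_eq_rdot[of v "adjoint (\<Phi>' x) l"] assms adjoint\<Phi>[OF assms(1)] by simp

lemma adjoint\<Phi>_sum: "x \<in> W \<Longrightarrow> adjoint (\<Phi>' x) l = (\<Sum>b\<in>Basis. inner l (\<Phi>' x b) *\<^sub>R b)"
  using euclidean_representation[of "adjoint (\<Phi>' x) l", symmetric] by (simp add: adjoint\<Phi>)

text \<open>\<open>adjoint\<close> is defined by a choice, so its dependence on \<open>x\<close> is
  read off the basis expansion, valid on \<open>W\<close>.\<close>

lemma isCont_adjoint\<Phi>: "isCont (\<lambda>x. adjoint (\<Phi>' x) l) xbar"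
proof -
  have "isCont (\<lambda>x. \<Sum>b\<in>Basis. inner l (\<Phi>' x b) *\<^sub>R b) xbar"
    by (intro continuous_intros isCont\<Phi>'[OF W(2)])
  moreover have "\<forall>\<^sub>F x in nhds xbar. adjoint (\<Phi>' x) l = (\<Sum>b\<in>Basis. inner l (\<Phi>' x b) *\<^sub>R b)"
    using eventually_nhds_in_open[OF W] by eventually_elim (rule adjoint\<Phi>_sum)
  ultimately show ?thesis by (rule isCont_cong[THEN iffD2, rotated])
qed

definition flat :: "'a \<Rightarrow> bool" where
  "flat x \<longleftrightarrow> (\<forall>l\<in>L. inner l (\<Phi> x - \<Phi> xbar) = 0)"

text \<open>Together with \<open>subdiff_near_converse\<close>: near \<open>(xbar, vbar)\<close> the graph of \<open>\<partial>\<phi>\<close> is the manifold of all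
  \<open>(x, \<Phi>'(x)\<^sup>* l)\<close> with \<open>flat x\<close> and \<open>l \<in> lbar + L\<close>. The estimate says that \<open>l\<close> tends to \<open>lbar\<close>.\<close>

lemma subdiff_near:
  assumes ri: "lbar \<in> rel_interior (subdiff g (\<Phi> xbar))"
    and v: "\<And>w. inner vbar w = inner lbar (\<Phi>' xbar w)"
  shows "\<exists>c>0. \<forall>\<^sub>F p in nhds (xbar, vbar). snd p \<in> subdiff \<phi> (fst p) \<longrightarrow>
    fst p \<in> W \<and> flat (fst p) \<and> (\<exists>l. l - lbar \<in> L \<and> snd p = adjoint (\<Phi>' (fst p)) l \<and>
       c * norm (l - lbar) \<le> norm (snd p - adjoint (\<Phi>' (fst p)) lbar))"
proof -
  have "\<exists>c>0. \<forall>\<^sub>F x in nhds xbar. \<forall>l\<in>L. c * norm l \<le> norm (adjoint (\<Phi>' x) l)"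
    by (rule adjoint_bounded_below[OF W, of \<Phi>']) (fact lin\<Phi> cont subspace_parallel_subspace | erule inj, assumption)+
  then obtain c where c: "c > 0" "\<forall>\<^sub>F x in nhds xbar. \<forall>l\<in>L. c * norm l \<le> norm (adjoint (\<Phi>' x) l)"
    by blast
  have \<Phi>lim: "(\<Phi> \<longlongrightarrow> \<Phi> xbar) (nhds xbar)"
    using isCont\<Phi>[OF W(2)] unfolding isCont_def by (rule tendsto_at_iff_tendsto_nhds[THEN iffD1])
  have fst: "(fst \<longlongrightarrow> xbar) (nhds (xbar, vbar))" and snd: "(snd \<longlongrightarrow> vbar) (nhds (xbar, vbar))"
    using tendsto_fst[OF filterlim_ident[of "nhds (xbar, vbar)"]]
      tendsto_snd[OF filterlim_ident[of "nhds (xbar, vbar)"]] by simp_all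
  obtain A B where AB: "open A" "open B" "\<Phi> xbar \<in> A" "lbar \<in> B"
    and flatAB: "\<And>y l. y \<in> A \<Longrightarrow> l \<in> B \<Longrightarrow> l \<in> subdiff g y \<Longrightarrow> \<forall>h\<in>L. inner h (y - \<Phi> xbar) = 0"
  proof -
    obtain S where S: "open S" "(\<Phi> xbar, lbar) \<in> S"
      and flat: "\<forall>p\<in>S. snd p \<in> subdiff g (fst p) \<longrightarrow> snd p - lbar \<in> L \<and> (\<forall>h\<in>L. inner h (fst p - \<Phi> xbar) = 0)"
      using subdiff_graph_flat[OF g ri] unfolding eventually_nhds by blast
    obtain A B where "open A" "open B" "\<Phi> xbar \<in> A" "lbar \<in> B" "A \<times> B \<subseteq> S"
      using S by (rule open_prod_elim) auto
    then show ?thesis using that[of A B] flat by force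
  qed
  obtain e where e: "e > 0" "ball lbar e \<subseteq> B" using AB(2,4) openE by blast
  have "vbar = adjoint (\<Phi>' xbar) lbar" by (rule adjoint\<Phi>_eqI[OF W(2) v])
  moreover have "((\<lambda>x. adjoint (\<Phi>' x) lbar) \<longlongrightarrow> adjoint (\<Phi>' xbar) lbar) (nhds xbar)"
    using isCont_adjoint\<Phi>[of lbar] unfolding isCont_def
    by (rule tendsto_at_iff_tendsto_nhds[of "\<lambda>x. adjoint (\<Phi>' x) lbar", THEN iffD1])
  ultimately have "((\<lambda>p. norm (snd p - adjoint (\<Phi>' (fst p)) lbar)) \<longlongrightarrow> norm (vbar - vbar)) (nhds (xbar, vbar))"
    using filterlim_compose[OF _ fst] by (intro tendsto_norm tendsto_diff snd) simp
  then have "\<forall>\<^sub>F p in nhds (xbar, vbar). norm (snd p - adjoint (\<Phi>' (fst p)) lbar) < c * e"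
    by (rule order_tendstoD(2)) (use c(1) e(1) in simp)
  moreover have "\<forall>\<^sub>F x in nhds xbar. subdiff g (\<Phi> x) \<subseteq> subdiff g (\<Phi> xbar)"
    by (rule eventually_compose_filterlim[OF subdiff_mono[OF g lbar] \<Phi>lim])
  then have "\<forall>\<^sub>F p in nhds (xbar, vbar). subdiff g (\<Phi> (fst p)) \<subseteq> subdiff g (\<Phi> xbar)"
    by (rule eventually_compose_filterlim[OF _ fst])
  moreover have "\<forall>\<^sub>F p in nhds (xbar, vbar). \<forall>l\<in>L. c * norm l \<le> norm (adjoint (\<Phi>' (fst p)) l)"
    by (rule eventually_compose_filterlim[OF c(2) fst])
  moreover have "\<forall>\<^sub>F p in nhds (xbar, vbar). fst p \<in> W"
    using fst W by (rule topological_tendstoD)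
  moreover have "\<forall>\<^sub>F p in nhds (xbar, vbar). \<Phi> (fst p) \<in> A"
    using filterlim_compose[OF \<Phi>lim fst] AB(1,3) by (rule topological_tendstoD)
  moreover have "\<forall>\<^sub>F p in nhds (xbar, vbar). \<forall>v\<in>subdiff \<phi> (fst p). \<exists>l\<in>subdiff g (\<Phi> (fst p)). \<forall>w. inner v w = inner l (\<Phi>' (fst p) w)"
    by (rule eventually_compose_filterlim[OF chain_rule fst])
  ultimately have "\<forall>\<^sub>F p in nhds (xbar, vbar). snd p \<in> subdiff \<phi> (fst p) \<longrightarrow>
    fst p \<in> W \<and> flat (fst p) \<and> (\<exists>l. l - lbar \<in> L \<and> snd p = adjoint (\<Phi>' (fst p)) l \<and>
       c * norm (l - lbar) \<le> norm (snd p - adjoint (\<Phi>' (fst p)) lbar))"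
  proof eventually_elim
    case (elim p)
    show ?case
    proof
      assume "snd p \<in> subdiff \<phi> (fst p)"
      then obtain l where l: "l \<in> subdiff g (\<Phi> (fst p))" "\<And>w. inner (snd p) w = inner l (\<Phi>' (fst p) w)"
        using elim(6) by blast
      have eq: "snd p = adjoint (\<Phi>' (fst p)) l" by (rule adjoint\<Phi>_eqI[OF elim(4) l(2)])
      have par: "l - lbar \<in> L" using diff_in_parallel_subspace elim(2) l(1) lbar by blast
      \<comment> \<open>Flatness requires \<open>l\<close> close to \<open>lbar\<close>, while only
        \<open>p\<close> is known to be close to its limit; the lower bound on \<open>L\<close>
        turns the smallness of the right-hand side into that of \<open>l - lbar\<close>.\<close>
      have "adjoint (\<Phi>' (fst p)) (l - lbar) = snd p - adjoint (\<Phi>' (fst p)) lbar"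
        unfolding eq using linear_diff[OF adjoint_linear[OF lin\<Phi>[OF elim(4)]]] .
      then have le: "c * norm (l - lbar) \<le> norm (snd p - adjoint (\<Phi>' (fst p)) lbar)"
        using elim(3) par by metis
      then have "c * norm (l - lbar) < c * e" using elim(1) by linarith
      then have "l \<in> B" using c(1) e(2) by (auto simp: dist_norm norm_minus_commute)
      then have "flat (fst p)" unfolding flat_def using flatAB elim(5) l(1) by blast
      then show "fst p \<in> W \<and> flat (fst p) \<and> (\<exists>l. l - lbar \<in> L \<and> snd p = adjoint (\<Phi>' (fst p)) l \<and>
         c * norm (l - lbar) \<le> norm (snd p - adjoint (\<Phi>' (fst p)) lbar))"
        using elim(4) par eq le by blast
    qed
  qed
  then show ?thesis using c(1) by blast
qed

text \<open>On flat points \<open>g\<close> is affine with slope \<open>lbar\<close>, and any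
  \<open>l\<close> with \<open>l - lbar\<close> in \<open>L\<close> has the same inner products with
  flat increments. The subgradient inequality at \<open>\<Phi> xbar\<close> therefore moves
  unchanged to the nearby flat point.\<close>

lemma subdiff_near_converse:
  assumes ri: "lbar \<in> rel_interior (subdiff g (\<Phi> xbar))"
  shows "\<forall>\<^sub>F p in nhds (xbar, lbar). flat (fst p) \<and> snd p - lbar \<in> L \<longrightarrow>
    adjoint (\<Phi>' (fst p)) (snd p) \<in> subdiff \<phi> (fst p)"
proof -
  obtain e where e: "e > 0" "relatively_interior lbar (subdiff g (\<Phi> xbar)) e"
    using rel_interior_imp_relatively_interior[OF ri] by blast
  have \<Phi>lim: "(\<Phi> \<longlongrightarrow> \<Phi> xbar) (nhds xbar)"
    using isCont\<Phi>[OF W(2)] unfolding isCont_def by (rule tendsto_at_iff_tendsto_nhds[THEN iffD1])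
  have fst: "(fst \<longlongrightarrow> xbar) (nhds (xbar, lbar))" and snd: "(snd \<longlongrightarrow> lbar) (nhds (xbar, lbar))"
    using tendsto_fst[OF filterlim_ident[of "nhds (xbar, lbar)"]]
      tendsto_snd[OF filterlim_ident[of "nhds (xbar, lbar)"]] by simp_all
  have "\<forall>\<^sub>F p in nhds (xbar, lbar). fst p \<in> W" using fst W by (rule topological_tendstoD)
  moreover have "\<forall>\<^sub>F p in nhds (xbar, lbar). snd p \<in> ball lbar e"
    using snd by (rule topological_tendstoD) (use e(1) in auto)
  moreover have "\<forall>\<^sub>F p in nhds (xbar, lbar). (\<forall>l\<in>L. inner l (\<Phi> (fst p) - \<Phi> xbar) = 0) \<longrightarrow>
     g (\<Phi> (fst p)) = ereal (r + inner lbar (\<Phi> (fst p) - \<Phi> xbar))"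
    by (rule eventually_compose_filterlim[OF g_on_flat filterlim_compose[OF \<Phi>lim fst]])
  ultimately show ?thesis
  proof eventually_elim
    case (elim p)
    show ?case
    proof
      assume p: "flat (fst p) \<and> snd p - lbar \<in> L"
      let ?y = "\<Phi> (fst p)"
      have gy: "g ?y = ereal (r + inner lbar (?y - \<Phi> xbar))" using elim(3) p unfolding flat_def by blast
      have eq: "inner (snd p) (?y - \<Phi> xbar) = inner lbar (?y - \<Phi> xbar)"
      proof -
        have "inner (snd p - lbar) (?y - \<Phi> xbar) = 0" using p unfolding flat_def by blast
        then show ?thesis by (simp add: inner_diff_left)
      qed
      have "norm (snd p - lbar) < e" using elim(2) by (simp add: dist_norm norm_minus_commute)
      then have "lbar + (snd p - lbar) \<in> subdiff g (\<Phi> xbar)"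
        using e(2) p unfolding relatively_interior_def by blast
      then have sp: "snd p \<in> subdiff g (\<Phi> xbar)" by simp
      have "snd p \<in> subdiff g ?y"
      proof (rule subdiffI[OF g(1) gy])
        fix y b assume "g y \<le> ereal b"
        then have "r + inner (snd p) (y - \<Phi> xbar) \<le> b" by (rule subdiff_ineq[OF g sp])
        then show "r + inner lbar (?y - \<Phi> xbar) + inner (snd p) (y - ?y) \<le> b"
          unfolding eq[symmetric] by (simp add: inner_diff_right)
      qed
      then show "adjoint (\<Phi>' (fst p)) (snd p) \<in> subdiff \<phi> (fst p)"
        by (rule subdiff_compositeI[OF elim(1)]) (rule adjoint\<Phi>[OF elim(1)])
    qed
  qed
qed

text \<open>Testing with \<open>k\<close> in \<open>K\<close> hides the multiplier increment:
  elements of \<open>L\<close> annihilate \<open>\<Phi>' xbar k\<close>, so \<open>l\<close> acts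
  only on the increment of \<open>\<Phi>'\<close>. Plain convergence of \<open>l\<close> to
  \<open>lbar\<close> then suffices to pass to the limit in the difference quotients.\<close>

lemma tangent_cone_graph:
  assumes ri: "lbar \<in> rel_interior (subdiff g (\<Phi> xbar))"
    and v: "\<And>w. inner vbar w = inner lbar (\<Phi>' xbar w)"
    and f: "(f has_derivative f') (at xbar)"
    and \<Phi>2: "\<And>h. ((\<lambda>x. \<Phi>' x h) has_derivative (\<lambda>k. \<Phi>'' k h)) (at xbar)"
    and G: "\<And>x. G x = {f x + v | v. v \<in> subdiff \<phi> x}"
    and tan: "(w, z) \<in> tangent_cone (gph G) (xbar, f xbar + vbar)"
  shows "w \<in> K \<and> (\<forall>k\<in>K. inner z k = inner (f' w) k + inner lbar (\<Phi>'' w k))"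
proof -
  obtain t q where t: "\<And>k::nat. t k > (0::real)" "t \<longlonglongrightarrow> 0" and q: "q \<longlonglongrightarrow> (w, z)"
    and mem: "\<And>k. (xbar, f xbar + vbar) + t k *\<^sub>R q k \<in> gph G"
    using tan unfolding tangent_cone_def by blast
  define x where "x k = xbar + t k *\<^sub>R fst (q k)" for k
  define v' where "v' k = f xbar + vbar + t k *\<^sub>R snd (q k) - f (x k)" for k
  have tne: "\<forall>\<^sub>F k in sequentially. t k \<noteq> 0" using t(1) by (intro always_eventually allI) (metis less_irrefl)
  have fq: "(\<lambda>k. fst (q k)) \<longlonglongrightarrow> w" and sq: "(\<lambda>k. snd (q k)) \<longlonglongrightarrow> z"
    using tendsto_fst[OF q] tendsto_snd[OF q] by simp_all
  have "x \<longlonglongrightarrow> xbar + 0 *\<^sub>R w" unfolding x_def by (intro tendsto_intros t(2) fq)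
  then have xlim: "x \<longlonglongrightarrow> xbar" by simp
  have "(\<lambda>k. f (x k)) \<longlonglongrightarrow> f xbar"
    using has_derivative_continuous[OF f] xlim by (rule isCont_tendsto_compose)
  then have "v' \<longlonglongrightarrow> f xbar + vbar + 0 *\<^sub>R z - f xbar"
    unfolding v'_def by (intro tendsto_intros t(2) sq)
  then have vlim: "v' \<longlonglongrightarrow> vbar" by simp
  have sub: "v' k \<in> subdiff \<phi> (x k)" for k
  proof -
    have "f xbar + vbar + t k *\<^sub>R snd (q k) \<in> G (x k)"
      using mem[of k] unfolding gph_def x_def by (simp add: case_prod_beta)
    then show ?thesis unfolding G v'_def by auto
  qed
  obtain c where c: "c > 0" "\<forall>\<^sub>F p in nhds (xbar, vbar). snd p \<in> subdiff \<phi> (fst p) \<longrightarrow>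
    fst p \<in> W \<and> flat (fst p) \<and> (\<exists>l. l - lbar \<in> L \<and> snd p = adjoint (\<Phi>' (fst p)) l \<and>
       c * norm (l - lbar) \<le> norm (snd p - adjoint (\<Phi>' (fst p)) lbar))"
    using subdiff_near[OF ri v] by blast
  have "(\<lambda>k. (x k, v' k)) \<longlonglongrightarrow> (xbar, vbar)" by (intro tendsto_intros xlim vlim)
  from eventually_compose_filterlim[OF c(2) this]
  obtain k0 where k0: "\<And>k. k \<ge> k0 \<Longrightarrow> x k \<in> W \<and> flat (x k) \<and> (\<exists>l. l - lbar \<in> L \<and> v' k = adjoint (\<Phi>' (x k)) l \<and>
       c * norm (l - lbar) \<le> norm (v' k - adjoint (\<Phi>' (x k)) lbar))"
    using sub unfolding eventually_sequentially by auto
  then have "\<forall>k. \<exists>l. k \<ge> k0 \<longrightarrow> l - lbar \<in> L \<and> v' k = adjoint (\<Phi>' (x k)) l \<and>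
       c * norm (l - lbar) \<le> norm (v' k - adjoint (\<Phi>' (x k)) lbar)"
    by blast
  then obtain l where l: "\<And>k. k \<ge> k0 \<Longrightarrow> l k - lbar \<in> L" "\<And>k. k \<ge> k0 \<Longrightarrow> v' k = adjoint (\<Phi>' (x k)) (l k)"
       "\<And>k. k \<ge> k0 \<Longrightarrow> c * norm (l k - lbar) \<le> norm (v' k - adjoint (\<Phi>' (x k)) lbar)"
    by metis
  have big: "\<forall>\<^sub>F k in sequentially. k \<ge> k0" by (rule eventually_ge_at_top)
  have dq\<Phi>: "(\<lambda>k. (\<Phi> (x k) - \<Phi> xbar) /\<^sub>R t k) \<longlonglongrightarrow> \<Phi>' xbar w"
    unfolding x_def by (rule difference_quotient_tendsto[OF der[OF W(2)] tne t(2) fq])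
  have dqf: "(\<lambda>k. (f (x k) - f xbar) /\<^sub>R t k) \<longlonglongrightarrow> f' w"
    unfolding x_def by (rule difference_quotient_tendsto[OF f tne t(2) fq])
  have dq\<Phi>': "(\<lambda>k. (\<Phi>' (x k) h - \<Phi>' xbar h) /\<^sub>R t k) \<longlonglongrightarrow> \<Phi>'' w h" for h
    unfolding x_def by (rule difference_quotient_tendsto[OF \<Phi>2 tne t(2) fq])
  have wK: "w \<in> K" unfolding K_def
  proof (intro CollectI ballI)
    fix h assume h: "h \<in> L"
    have "\<forall>\<^sub>F k in sequentially. inner h ((\<Phi> (x k) - \<Phi> xbar) /\<^sub>R t k) = 0"
      using big by eventually_elim (use k0 h in \<open>simp add: flat_def\<close>)
    then have "(\<lambda>k. inner h ((\<Phi> (x k) - \<Phi> xbar) /\<^sub>R t k)) \<longlonglongrightarrow> 0" by (rule tendsto_eventually)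
    moreover have "(\<lambda>k. inner h ((\<Phi> (x k) - \<Phi> xbar) /\<^sub>R t k)) \<longlonglongrightarrow> inner h (\<Phi>' xbar w)"
      by (intro tendsto_intros dq\<Phi>)
    ultimately show "inner h (\<Phi>' xbar w) = 0" by (rule LIMSEQ_unique[symmetric])
  qed
  have llim: "(\<lambda>k. l k - lbar) \<longlonglongrightarrow> 0"
  proof -
    have "vbar = adjoint (\<Phi>' xbar) lbar" by (rule adjoint\<Phi>_eqI[OF W(2) v])
    moreover have "(\<lambda>k. adjoint (\<Phi>' (x k)) lbar) \<longlonglongrightarrow> adjoint (\<Phi>' xbar) lbar"
      using isCont_adjoint\<Phi> xlim by (rule isCont_tendsto_compose)
    ultimately have "(\<lambda>k. norm (v' k - adjoint (\<Phi>' (x k)) lbar) / c) \<longlonglongrightarrow> norm (vbar - vbar) / c"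
      using c(1) by (intro tendsto_intros vlim) auto
    then have "(\<lambda>k. norm (v' k - adjoint (\<Phi>' (x k)) lbar) / c) \<longlonglongrightarrow> 0" by simp
    moreover have "\<forall>\<^sub>F k in sequentially. norm (l k - lbar) \<le> norm (v' k - adjoint (\<Phi>' (x k)) lbar) / c"
      using big by eventually_elim (use l(3) c(1) in \<open>simp add: pos_le_divide_eq mult.commute\<close>)
    ultimately show ?thesis by (rule Lim_null_comparison[rotated])
  qed
  have "inner z h = inner (f' w) h + inner lbar (\<Phi>'' w h)" if h: "h \<in> K" for h
  proof -
    let ?d = "\<lambda>k. (\<Phi>' (x k) h - \<Phi>' xbar h) /\<^sub>R t k"
    have "\<forall>\<^sub>F k in sequentially. inner ((f (x k) - f xbar) /\<^sub>R t k) h + inner lbar (?d k) + inner (l k - lbar) (?d k) = inner (snd (q k)) h"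
      using big
    proof eventually_elim
      case (elim k)
      have "inner (l k - lbar) (\<Phi>' xbar h) = 0" using h l(1)[OF elim] unfolding K_def by blast
      moreover have "inner (v' k) h = inner (l k) (\<Phi>' (x k) h)"
        using l(2)[OF elim] adjoint\<Phi> k0[OF elim] by simp
      ultimately have "inner (v' k - vbar) h = inner (l k) (\<Phi>' (x k) h - \<Phi>' xbar h)"
        using v[of h] by (simp add: inner_diff_left inner_diff_right)
      moreover have "t k *\<^sub>R snd (q k) = (f (x k) - f xbar) + (v' k - vbar)"
        unfolding v'_def by simp
      then have "inner (t k *\<^sub>R snd (q k)) h = inner ((f (x k) - f xbar) + (v' k - vbar)) h" by simp
      ultimately have "t k * inner (snd (q k)) h = inner (f (x k) - f xbar) h + inner (l k) (\<Phi>' (x k) h - \<Phi>' xbar h)"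
        by (simp add: inner_add_left)
      then have "inner (snd (q k)) h = (inner (f (x k) - f xbar) h + inner (l k) (\<Phi>' (x k) h - \<Phi>' xbar h)) / t k"
        using t(1)[of k] by (simp add: field_simps)
      then show ?case by (simp add: inner_diff_left add_divide_distrib diff_divide_distrib divide_inverse algebra_simps)
    qed
    moreover have "(\<lambda>k. inner ((f (x k) - f xbar) /\<^sub>R t k) h + inner lbar (?d k) + inner (l k - lbar) (?d k))
        \<longlonglongrightarrow> inner (f' w) h + inner lbar (\<Phi>'' w h) + inner 0 (\<Phi>'' w h)"
      by (intro tendsto_intros dqf dq\<Phi>' llim)
    ultimately have "(\<lambda>k. inner (snd (q k)) h) \<longlonglongrightarrow> inner (f' w) h + inner lbar (\<Phi>'' w h) + inner 0 (\<Phi>'' w h)"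
      by (rule Lim_transform_eventually[rotated])
    moreover have "(\<lambda>k. inner (snd (q k)) h) \<longlonglongrightarrow> inner z h" by (intro tendsto_intros sq)
    ultimately show ?thesis using LIMSEQ_unique by fastforce
  qed
  then show ?thesis using wK by blast
qed

end

section \<open>The smooth localization of the solution map\<close>

lemma C1_on_locally_lipschitz:
  fixes \<sigma> :: "'a::real_normed_vector \<Rightarrow> 'b::real_normed_vector"
  assumes "open V" "u0 \<in> V" "C1_on V \<sigma>"
  obtains \<rho> C where "\<rho> > 0" "ball u0 \<rho> \<subseteq> V" "C-lipschitz_on (ball u0 \<rho>) \<sigma>"
proof -
  obtain D where der: "\<And>u. u \<in> V \<Longrightarrow> (\<sigma> has_derivative blinfun_apply (D u)) (at u)"
    and cont: "continuous_on V D"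
    using assms(3) unfolding C1_on_def by blast
  have "isCont D u0" using cont assms(1,2) by (simp add: continuous_on_eq_continuous_at)
  then have "(D \<longlongrightarrow> D u0) (nhds u0)"
    unfolding isCont_def by (rule tendsto_at_iff_tendsto_nhds[THEN iffD1])
  then have "((\<lambda>u. norm (D u)) \<longlongrightarrow> norm (D u0)) (nhds u0)" by (rule tendsto_norm)
  then have "\<forall>\<^sub>F u in nhds u0. norm (D u) < norm (D u0) + 1" by (rule order_tendstoD(2)) simp
  moreover have "\<forall>\<^sub>F u in nhds u0. u \<in> V" using assms(1,2) by (rule eventually_nhds_in_open)
  ultimately have "\<forall>\<^sub>F u in nhds u0. norm (D u) < norm (D u0) + 1 \<and> u \<in> V" by eventually_elim simp
  then obtain \<rho> where \<rho>: "\<rho> > 0" "\<And>u. dist u u0 < \<rho> \<Longrightarrow> norm (D u) < norm (D u0) + 1 \<and> u \<in> V"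
    unfolding eventually_nhds_metric by blast
  have "(norm (D u0) + 1)-lipschitz_on (ball u0 \<rho>) \<sigma>"
  proof (rule bounded_derivative_imp_lipschitz)
    show "(\<sigma> has_derivative blinfun_apply (D u)) (at u within ball u0 \<rho>)" if "u \<in> ball u0 \<rho>" for u
    proof -
      have "u \<in> V" using \<rho>(2)[of u] that by (simp add: dist_commute)
      then show ?thesis by (rule has_derivative_at_withinI[OF der])
    qed
    show "onorm (blinfun_apply (D u)) \<le> norm (D u0) + 1" if "u \<in> ball u0 \<rho>" for u
      using \<rho>(2)[of u] that by (auto simp: dist_commute norm_blinfun.rep_eq[symmetric])
  qed auto
  then show ?thesis
    by (rule that[OF \<rho>(1), rotated]) (use \<rho>(2) in \<open>auto simp: dist_commute\<close>)
qed

context transversal_composite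
begin

text \<open>\<open>\<sigma>\<close> forgets the multiplier in the inverse of the square system at
  \<open>(u, 0)\<close>. Single-valuedness takes both descriptions of the graph: one shows that
  \<open>\<sigma> u\<close> solves the inclusion, the other that every nearby solution has a
  multiplier near \<open>lbar\<close> and so solves the system.\<close>

lemma C1_localization:
  assumes ri: "lbar \<in> rel_interior (subdiff g (\<Phi> xbar))"
    and v: "\<And>w. inner vbar w = inner lbar (\<Phi>' xbar w)"
    and f: "\<And>x. (f has_derivative f' x) (at x)" "\<And>h. continuous_on UNIV (\<lambda>x. f' x h)"
    and \<Phi>2: "\<And>x h. x \<in> W \<Longrightarrow> ((\<lambda>x. \<Phi>' x h) has_derivative (\<lambda>k. \<Phi>'' x k h)) (at x)"
      "\<And>k h. continuous_on W (\<lambda>x. \<Phi>'' x k h)" "\<And>k. linear (\<Phi>'' xbar k)"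
    and G: "\<And>x. G x = {f x + v | v. v \<in> subdiff \<phi> x}"
    and nondeg: "\<And>w. w \<in> K \<Longrightarrow> (\<And>k. k \<in> K \<Longrightarrow> inner (f' xbar w) k + inner lbar (\<Phi>'' xbar w k) = 0) \<Longrightarrow> w = 0"
  shows "\<exists>\<sigma>. lipschitz_localization (setval_inverse G) (f xbar + vbar) xbar \<sigma> \<and>
      (\<exists>V. open V \<and> f xbar + vbar \<in> V \<and> C1_on V \<sigma>) \<and>
      (\<exists>\<sigma>'. (\<sigma> has_derivative \<sigma>') (at (f xbar + vbar)) \<and>
         (\<forall>h. \<sigma>' h \<in> K \<and> (\<forall>k\<in>K. inner (f' xbar (\<sigma>' h)) k + inner lbar (\<Phi>'' xbar (\<sigma>' h) k) = inner h k)))"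
proof -
  let ?z = "\<Phi> xbar" and ?q = "(xbar, lbar)" and ?u = "f xbar + vbar"
  obtain P where P: "linear P" "\<And>x. P x \<in> L" "\<And>x n. n \<in> L \<Longrightarrow> inner n (P x) = inner n x"
    using orthogonal_projection_exists[OF subspace_parallel_subspace] by metis
  have blP: "bounded_linear P" using P(1) by (simp add: linear_conv_bounded_linear)
  have P0: "P y = 0" if "\<And>n. n \<in> L \<Longrightarrow> inner n y = 0" for y
    using P(2)[of y] P(3)[OF P(2)[of y], of y] that[OF P(2)[of y]] by simp
  have PL: "P l = l" if "l \<in> L" for l
  proof -
    have "inner (P l - l) (P l - l) = 0"
      using P(2)[of l] P(3)[of "P l - l" l] that by (simp add: subspace_diff inner_diff_right)
    then show ?thesis by simp
  qed
  have second: "(P y + (l - P l) = 0) = ((\<forall>n\<in>L. inner n y = 0) \<and> l \<in> L)" for y l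
  proof
    assume a: "P y + (l - P l) = 0"
    have y: "inner n y = 0" if n: "n \<in> L" for n
    proof -
      have "inner n (P y + (l - P l)) = 0" unfolding a by simp
      then show ?thesis using P(3)[OF n] by (simp add: inner_add_right inner_diff_right)
    qed
    then have "l = P l" using a P0[of y] by simp
    then have "l \<in> L" using P(2)[of l] by metis
    then show "(\<forall>n\<in>L. inner n y = 0) \<and> l \<in> L" using y by blast
  next
    assume "(\<forall>n\<in>L. inner n y = 0) \<and> l \<in> L"
    then show "P y + (l - P l) = 0" using P0[of y] PL[of l] by simp
  qed
  \<comment> \<open>The summand \<open>l - lbar - P (l - lbar)\<close> forces \<open>l - lbar \<in> L\<close> and makes the system square without
    introducing a type for \<open>L\<close>.\<close>
  define H where "H q = (f (fst q) + (\<Sum>b\<in>Basis. inner (snd q) (\<Phi>' (fst q) b) *\<^sub>R b),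
      P (\<Phi> (fst q) - ?z) + ((snd q - lbar) - P (snd q - lbar)))" for q
  define DH where "DH q h = (f' (fst q) (fst h) + (\<Sum>b\<in>Basis.
      (inner (snd q) (\<Phi>'' (fst q) (fst h) b) + inner (snd h) (\<Phi>' (fst q) b)) *\<^sub>R b),
      P (\<Phi>' (fst q) (fst h)) + (snd h - P (snd h)))" for q h
  have opn: "open (W \<times> (UNIV :: 'b set))" using W(1) by (intro open_Times) auto
  have q0: "?q \<in> W \<times> UNIV" using W(2) by simp
  have derH: "(H has_derivative DH q) (at q)" if q: "q \<in> W \<times> UNIV" for q
  proof -
    have x: "fst q \<in> W" using q by auto
    have fstd: "(fst has_derivative fst) (at q)" by (intro derivative_intros)
    have d1: "((\<lambda>q::'a \<times> 'b. f (fst q)) has_derivative (\<lambda>h. f' (fst q) (fst h))) (at q)"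
      using fstd f(1) by (rule has_derivative_compose)
    have d2: "((\<lambda>q::'a \<times> 'b. \<Phi>' (fst q) b) has_derivative (\<lambda>h. \<Phi>'' (fst q) (fst h) b)) (at q)" for b
      using fstd \<Phi>2(1)[OF x, of b] by (rule has_derivative_compose)
    have d3: "((\<lambda>q::'a \<times> 'b. \<Phi> (fst q)) has_derivative (\<lambda>h. \<Phi>' (fst q) (fst h))) (at q)"
      using fstd der[OF x] by (rule has_derivative_compose)
    have d4: "((\<lambda>q::'a \<times> 'b. P (\<Phi> (fst q) - ?z)) has_derivative (\<lambda>h. P (\<Phi>' (fst q) (fst h) - 0))) (at q)"
      by (intro bounded_linear.has_derivative[OF blP] derivative_intros d3)
    have d5: "((\<lambda>q::'a \<times> 'b. P (snd q - lbar)) has_derivative (\<lambda>h. P (snd h - 0))) (at q)"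
      by (intro bounded_linear.has_derivative[OF blP] derivative_intros)
    show ?thesis
      unfolding H_def DH_def
      by (rule has_derivative_eq_rhs, (rule derivative_intros d1 d2 d4 d5)+) (simp add: fun_eq_iff)
  qed
  have contDH: "continuous_on (W \<times> UNIV) (\<lambda>q. DH q h)" for h
  proof -
    have c1: "continuous_on (W \<times> (UNIV::'b set)) (\<lambda>q. f' (fst q) k)" for k
      by (rule continuous_on_compose2[OF f(2)]) (auto intro!: continuous_intros)
    have c2: "continuous_on (W \<times> (UNIV::'b set)) (\<lambda>q. \<Phi>'' (fst q) k b)" for k b
      by (rule continuous_on_compose2[OF \<Phi>2(2)]) (auto intro!: continuous_intros)
    have c3: "continuous_on (W \<times> (UNIV::'b set)) (\<lambda>q. \<Phi>' (fst q) k)" for k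
      by (rule continuous_on_compose2[OF cont]) (auto intro!: continuous_intros)
    show ?thesis unfolding DH_def
      by (intro continuous_intros c1 c2 c3 bounded_linear.continuous_on[OF blP])
  qed
  \<comment> \<open>Pairing with \<open>k\<close> in \<open>K\<close> removes the multiplier part,
    as \<open>snd h\<close> lies in \<open>L\<close>, and leaves the reduced equation on
    \<open>K\<close>. The case \<open>y = 0\<close> gives injectivity, general \<open>y\<close> the
    derivative of \<open>\<sigma>\<close>.\<close>
  have solve: "fst h \<in> K \<and> snd h \<in> L \<and>
      (\<forall>k\<in>K. inner (f' xbar (fst h)) k + inner lbar (\<Phi>'' xbar (fst h) k) = inner y k)"
    if h: "DH ?q h = (y, 0)" for h y
  proof -
    have "P (\<Phi>' xbar (fst h)) + (snd h - P (snd h)) = 0" using h unfolding DH_def by simp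
    then have *: "(\<forall>n\<in>L. inner n (\<Phi>' xbar (fst h)) = 0) \<and> snd h \<in> L" using second by blast
    have "inner (f' xbar (fst h)) k + inner lbar (\<Phi>'' xbar (fst h) k) = inner y k" if k: "k \<in> K" for k
    proof -
      have krep: "(\<Sum>b\<in>Basis. inner b k *\<^sub>R b) = k" using euclidean_representation[of k] by (simp add: inner_commute)
      have rep: "(\<Sum>b\<in>Basis. inner l (T b) * inner b k) = inner l (T k)" if "linear T" for l and T :: "'a \<Rightarrow> 'b"
      proof -
        have "T k = T (\<Sum>b\<in>Basis. inner b k *\<^sub>R b)" unfolding krep ..
        also have "\<dots> = (\<Sum>b\<in>Basis. inner b k *\<^sub>R T b)"
          using that by (simp add: linear_sum linear_cmul)
        finally show ?thesis by (simp add: inner_sum_right mult.commute)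
      qed
      have "y = f' xbar (fst h) + (\<Sum>b\<in>Basis. (inner lbar (\<Phi>'' xbar (fst h) b) + inner (snd h) (\<Phi>' xbar b)) *\<^sub>R b)"
        using h unfolding DH_def by simp
      then have "inner y k = inner (f' xbar (fst h)) k +
         ((\<Sum>b\<in>Basis. inner lbar (\<Phi>'' xbar (fst h) b) * inner b k) + (\<Sum>b\<in>Basis. inner (snd h) (\<Phi>' xbar b) * inner b k))"
        by (simp add: inner_add_left inner_sum_left distrib_right sum.distrib)
      then have "inner y k = inner (f' xbar (fst h)) k + (inner lbar (\<Phi>'' xbar (fst h) k) + inner (snd h) (\<Phi>' xbar k))"
        by (simp add: rep \<Phi>2(3) lin\<Phi> W(2))
      moreover have "inner (snd h) (\<Phi>' xbar k) = 0" using k * unfolding K_def by blast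
      ultimately show ?thesis by simp
    qed
    then show ?thesis using * unfolding K_def by blast
  qed
  have injH: "h = 0" if "DH ?q h = 0" for h
  proof -
    have h: "DH ?q h = (0, 0)" using that by (simp add: zero_prod_def)
    have fh: "fst h = 0" using solve[OF h] by (intro nondeg) auto
    have "inner (snd h) (\<Phi>' xbar w) = 0" for w
    proof -
      have "f' xbar 0 = 0" using linear_0[OF has_derivative_linear[OF f(1)]] .
      moreover have "\<Phi>'' xbar 0 b = 0" for b
        using linear_0[OF has_derivative_linear[OF \<Phi>2(1)[OF W(2)]]] .
      ultimately have "(\<Sum>b\<in>Basis. inner (snd h) (\<Phi>' xbar b) *\<^sub>R b) = 0"
        using h fh unfolding DH_def by simp
      then have "adjoint (\<Phi>' xbar) (snd h) = 0" using adjoint\<Phi>_sum[OF W(2)] by simp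
      then show ?thesis using adjoint\<Phi>[OF W(2), of "snd h" w] by simp
    qed
    then have "snd h = 0" using solve[OF h] by (intro inj) auto
    then show ?thesis using fh by (simp add: prod_eq_iff)
  qed
  obtain U' V' R R' where UV: "open U'" "U' \<subseteq> W \<times> UNIV" "?q \<in> U'" "open V'" "H ?q \<in> V'"
    and hom: "homeomorphism U' V' H R"
    and R: "\<And>y. y \<in> V' \<Longrightarrow> (R has_derivative R' y) (at y)"
    and R': "\<And>y h. y \<in> V' \<Longrightarrow> DH (R y) (R' y h) = h"
    and C1R: "C1_on V' R"
    using C1_inverse_function[OF opn q0 derH contDH injH] by metis
  have vbar: "vbar = adjoint (\<Phi>' xbar) lbar" by (rule adjoint\<Phi>_eqI[OF W(2) v])
  have Hq: "H ?q = (?u, 0)"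
    unfolding H_def by (simp add: linear_0[OF P(1)] vbar adjoint\<Phi>_sum[OF W(2)])
  have u0: "(?u, 0) \<in> V'" using UV(5) Hq by simp
  have R0: "R (?u, 0) = ?q" using hom UV(3) Hq unfolding homeomorphism_def by metis
  have Heq: "H (x, l) = (u, 0) \<longleftrightarrow> u = f x + adjoint (\<Phi>' x) l \<and> flat x \<and> l - lbar \<in> L" if "x \<in> W" for x l u
    using second[of "\<Phi> x - ?z" "l - lbar"] adjoint\<Phi>_sum[OF that, of l] unfolding H_def flat_def by auto
  define \<sigma> where "\<sigma> u = fst (R (u, 0))" for u
  define V3 where "V3 = (\<lambda>u. (u, 0::'b)) -` V'"
  have V3: "open V3" "?u \<in> V3"
    unfolding V3_def using u0 by (auto intro!: open_vimage UV(4) continuous_intros)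
  have der\<sigma>: "(\<sigma> has_derivative (\<lambda>h. fst (R' (u, 0) (h, 0)))) (at u)" if "u \<in> V3" for u
  proof -
    have "((\<lambda>u. (u, 0::'b)) has_derivative (\<lambda>h. (h, 0))) (at u)" by (intro derivative_intros)
    then have "((\<lambda>u. R (u, 0)) has_derivative (\<lambda>h. R' (u, 0) (h, 0))) (at u)"
      by (rule has_derivative_compose) (use R that V3_def in auto)
    then show ?thesis unfolding \<sigma>_def by (intro derivative_intros)
  qed
  have C1\<sigma>: "C1_on V3 \<sigma>"
  proof -
    obtain D where D: "\<And>y. y \<in> V' \<Longrightarrow> (R has_derivative blinfun_apply (D y)) (at y)" "continuous_on V' D"
      using C1R unfolding C1_on_def by blast
    have "(\<sigma> has_derivative (\<lambda>h. fst (blinfun_apply (D (u, 0)) (h, 0)))) (at u)" if "u \<in> V3" for u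
      using der\<sigma>[OF that] has_derivative_unique[OF D(1) R, of "(u, 0)"] that unfolding V3_def by auto
    moreover have "continuous_on V3 (\<lambda>u. fst (blinfun_apply (D (u, 0)) (h, 0)))" for h
    proof -
      have "continuous_on V3 (\<lambda>u. D (u, 0))"
        by (rule continuous_on_compose2[OF D(2)]) (auto intro!: continuous_intros simp: V3_def)
      then show ?thesis by (intro continuous_intros)
    qed
    ultimately show ?thesis by (rule C1_onI)
  qed
  obtain \<rho> C where \<rho>: "\<rho> > 0" "ball ?u \<rho> \<subseteq> V3" "C-lipschitz_on (ball ?u \<rho>) \<sigma>"
    using C1_on_locally_lipschitz[OF V3 C1\<sigma>] by blast
  obtain c where c: "c > 0" "\<forall>\<^sub>F p in nhds (xbar, vbar). snd p \<in> subdiff \<phi> (fst p) \<longrightarrow>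
    fst p \<in> W \<and> flat (fst p) \<and> (\<exists>l. l - lbar \<in> L \<and> snd p = adjoint (\<Phi>' (fst p)) l \<and>
       c * norm (l - lbar) \<le> norm (snd p - adjoint (\<Phi>' (fst p)) lbar))"
    using subdiff_near[OF ri v] by blast
  obtain S1 where S1: "open S1" "?q \<in> S1"
    "\<And>p. p \<in> S1 \<Longrightarrow> flat (fst p) \<Longrightarrow> snd p - lbar \<in> L \<Longrightarrow> adjoint (\<Phi>' (fst p)) (snd p) \<in> subdiff \<phi> (fst p)"
    using subdiff_near_converse[OF ri] unfolding eventually_nhds by blast
  have "open (U' \<inter> S1)" "?q \<in> U' \<inter> S1" using UV S1 by auto
  then obtain A1 B1 where AB: "open A1" "open B1" "xbar \<in> A1" "lbar \<in> B1" "A1 \<times> B1 \<subseteq> U' \<inter> S1"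
    by (rule open_prod_elim) auto
  obtain e where e: "e > 0" "ball lbar e \<subseteq> B1" using AB(2,4) openE by blast
  have fst: "(fst \<longlongrightarrow> xbar) (nhds (xbar, ?u))" and snd: "(snd \<longlongrightarrow> ?u) (nhds (xbar, ?u))"
    using tendsto_fst[OF filterlim_ident[of "nhds (xbar, ?u)"]]
      tendsto_snd[OF filterlim_ident[of "nhds (xbar, ?u)"]] by simp_all
  have "(f \<longlongrightarrow> f xbar) (nhds xbar)"
    using has_derivative_continuous[OF f(1)] unfolding isCont_def
    by (rule tendsto_at_iff_tendsto_nhds[THEN iffD1])
  then have "((\<lambda>p. snd p - f (fst p)) \<longlongrightarrow> ?u - f xbar) (nhds (xbar, ?u))"
    by (intro tendsto_diff snd filterlim_compose[OF _ fst])
  then have vlim: "((\<lambda>p. snd p - f (fst p)) \<longlongrightarrow> vbar) (nhds (xbar, ?u))" by simp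
  have "((\<lambda>p. (fst p, snd p - f (fst p))) \<longlongrightarrow> (xbar, vbar)) (nhds (xbar, ?u))"
    by (intro tendsto_Pair fst vlim)
  from eventually_compose_filterlim[OF c(2) this]
  have ev1: "\<forall>\<^sub>F p in nhds (xbar, ?u). snd p - f (fst p) \<in> subdiff \<phi> (fst p) \<longrightarrow>
    fst p \<in> W \<and> flat (fst p) \<and> (\<exists>l. l - lbar \<in> L \<and> snd p - f (fst p) = adjoint (\<Phi>' (fst p)) l \<and>
       c * norm (l - lbar) \<le> norm (snd p - f (fst p) - adjoint (\<Phi>' (fst p)) lbar))"
    by simp
  have "((\<lambda>x. adjoint (\<Phi>' x) lbar) \<longlongrightarrow> adjoint (\<Phi>' xbar) lbar) (nhds xbar)"
    using isCont_adjoint\<Phi>[of lbar] unfolding isCont_def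
    by (rule tendsto_at_iff_tendsto_nhds[of "\<lambda>x. adjoint (\<Phi>' x) lbar", THEN iffD1])
  then have "((\<lambda>p. norm (snd p - f (fst p) - adjoint (\<Phi>' (fst p)) lbar)) \<longlongrightarrow> norm (vbar - adjoint (\<Phi>' xbar) lbar)) (nhds (xbar, ?u))"
    by (intro tendsto_norm tendsto_diff[OF vlim] filterlim_compose[OF _ fst])
  then have ev2: "\<forall>\<^sub>F p in nhds (xbar, ?u). norm (snd p - f (fst p) - adjoint (\<Phi>' (fst p)) lbar) < c * e"
    by (rule order_tendstoD(2)) (use c(1) e(1) vbar in simp)
  \<comment> \<open>\<open>S2\<close> is so small that the estimate forces multipliers into
    \<open>ball lbar e\<close>; pairs of solution and multiplier then fall into the domain
    \<open>U'\<close> where \<open>H\<close> is inverted.\<close>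
  obtain S2 where S2: "open S2" "(xbar, ?u) \<in> S2"
    "\<And>p. p \<in> S2 \<Longrightarrow> snd p - f (fst p) \<in> subdiff \<phi> (fst p) \<Longrightarrow>
      fst p \<in> W \<and> flat (fst p) \<and> (\<exists>l\<in>ball lbar e. l - lbar \<in> L \<and> snd p - f (fst p) = adjoint (\<Phi>' (fst p)) l)"
  proof -
    have "\<forall>\<^sub>F p in nhds (xbar, ?u). snd p - f (fst p) \<in> subdiff \<phi> (fst p) \<longrightarrow>
      fst p \<in> W \<and> flat (fst p) \<and> (\<exists>l\<in>ball lbar e. l - lbar \<in> L \<and> snd p - f (fst p) = adjoint (\<Phi>' (fst p)) l)"
      using ev1 ev2
    proof eventually_elim
      case (elim p)
      have "l \<in> ball lbar e" if "c * norm (l - lbar) \<le> norm (snd p - f (fst p) - adjoint (\<Phi>' (fst p)) lbar)" for l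
      proof -
        have "c * norm (l - lbar) < c * e" using that elim(2) by linarith
        then show ?thesis using c(1) by (simp add: dist_norm norm_minus_commute)
      qed
      then show ?case using elim(1) by blast
    qed
    then show ?thesis using that unfolding eventually_nhds by blast
  qed
  obtain A2 B2 where AB2: "open A2" "open B2" "xbar \<in> A2" "?u \<in> B2" "A2 \<times> B2 \<subseteq> S2"
    using S2(1,2) by (rule open_prod_elim) auto
  define U where "U = A1 \<inter> A2"
  have U: "open U" "xbar \<in> U" unfolding U_def using AB AB2 by auto
  have "isCont R (?u, 0)" using has_derivative_continuous[OF R[OF u0]] .
  then have Rlim: "(R \<longlongrightarrow> ?q) (nhds (?u, 0))"
    using R0 tendsto_at_iff_tendsto_nhds[of R "(?u, 0)"] unfolding isCont_def by simp
  have "((\<lambda>u. (u, 0::'b)) \<longlongrightarrow> (?u, 0)) (nhds ?u)" by (intro tendsto_Pair filterlim_ident tendsto_const)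
  then have "((\<lambda>u. R (u, 0)) \<longlongrightarrow> ?q) (nhds ?u)" by (rule filterlim_compose[OF Rlim])
  then have "\<forall>\<^sub>F u in nhds ?u. R (u, 0) \<in> U \<times> ball lbar e"
    using U e(1) by (intro topological_tendstoD) (auto intro: open_Times)
  then obtain T where T: "open T" "?u \<in> T" "\<And>u. u \<in> T \<Longrightarrow> R (u, 0) \<in> U \<times> ball lbar e"
    unfolding eventually_nhds by blast
  define V where "V = ball ?u \<rho> \<inter> T \<inter> B2"
  have V: "open V" "?u \<in> V" unfolding V_def using T AB2 \<rho>(1) by auto
  have VV': "(u, 0) \<in> V'" if "u \<in> V" for u using that \<rho>(2) unfolding V_def V3_def by auto
  have single: "setval_inverse G u \<inter> U = {\<sigma> u}" if u: "u \<in> V" for u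
  proof
    define x l where "x = fst (R (u, 0))" and "l = snd (R (u, 0))"
    have xl: "R (u, 0) = (x, l)" unfolding x_def l_def by simp
    have "R (u, 0) \<in> U \<times> ball lbar e" using u T(3) unfolding V_def by blast
    then have mem: "x \<in> U" "l \<in> ball lbar e" using xl by auto
    then have inS1: "(x, l) \<in> U' \<inter> S1" using AB(5) e(2) unfolding U_def by blast
    then have xW: "x \<in> W" using UV(2) by blast
    have "H (x, l) = (u, 0)" using hom VV'[OF u] xl unfolding homeomorphism_def by metis
    then have eq: "u = f x + adjoint (\<Phi>' x) l" "flat x" "l - lbar \<in> L" using Heq[OF xW] by auto
    then have "adjoint (\<Phi>' x) l \<in> subdiff \<phi> x" using S1(3)[of "(x, l)"] inS1 by simp
    then have "u \<in> G x" unfolding G using eq(1) by blast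
    then show "{\<sigma> u} \<subseteq> setval_inverse G u \<inter> U"
      using mem(1) unfolding \<sigma>_def setval_inverse_def x_def by simp
  next
    show "setval_inverse G u \<inter> U \<subseteq> {\<sigma> u}"
    proof
      fix x assume x: "x \<in> setval_inverse G u \<inter> U"
      then have sub: "u - f x \<in> subdiff \<phi> x" unfolding setval_inverse_def G by auto
      have "(x, u) \<in> S2" using x u AB2(5) unfolding U_def V_def by blast
      then have *: "x \<in> W \<and> flat x \<and> (\<exists>l\<in>ball lbar e. l - lbar \<in> L \<and> u - f x = adjoint (\<Phi>' x) l)"
        using S2(3)[of "(x, u)"] sub by simp
      then obtain l where l: "l \<in> ball lbar e" "l - lbar \<in> L" "u - f x = adjoint (\<Phi>' x) l" by blast
      have "u = f x + adjoint (\<Phi>' x) l" using l(3) by (simp add: algebra_simps)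
      then have "H (x, l) = (u, 0)" using Heq * l(2) by blast
      moreover have "(x, l) \<in> U'" using x l(1) AB(5) e(2) unfolding U_def by blast
      ultimately have "R (u, 0) = (x, l)" using hom unfolding homeomorphism_def by metis
      then show "x \<in> {\<sigma> u}" unfolding \<sigma>_def by simp
    qed
  qed
  have lip: "C-lipschitz_on V \<sigma>" using \<rho>(3) by (rule lipschitz_on_subset) (auto simp: V_def)
  have "xbar \<in> setval_inverse G ?u"
  proof -
    have "\<sigma> ?u = xbar" unfolding \<sigma>_def R0 by simp
    moreover have "\<sigma> ?u \<in> setval_inverse G ?u \<inter> U" unfolding single[OF V(2)] by simp
    ultimately show ?thesis by simp
  qed
  then have loc: "lipschitz_localization (setval_inverse G) ?u xbar \<sigma>"
    unfolding lipschitz_localization_def using U V single lip by blast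
  have "fst (R' (?u, 0) (h, 0)) \<in> K \<and> (\<forall>k\<in>K. inner (f' xbar (fst (R' (?u, 0) (h, 0)))) k
      + inner lbar (\<Phi>'' xbar (fst (R' (?u, 0) (h, 0))) k) = inner h k)" for h
    using solve[of "R' (?u, 0) (h, 0)" h] R'[OF u0, of "(h, 0)"] R0 by simp
  then show ?thesis using loc V3 C1\<sigma> der\<sigma>[OF V3(2)] by blast
qed

end

section \<open>Metric regularity and its linearized criteria\<close>

text \<open>A value \<open>y'\<close> of \<open>F x\<close> near \<open>y0\<close> satisfies
  \<open>x = \<sigma> y'\<close>, and the Lipschitz bound applies. A distant one is at least
  \<open>e / 2\<close> away from \<open>y\<close>, so that a large constant suffices.\<close>

lemma strongly_metrically_regular_imp_metrically_regular:
  fixes F :: "'a::metric_space \<Rightarrow> 'b::metric_space set"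
  assumes "strongly_metrically_regular F x0 y0"
  shows "metrically_regular F x0 y0"
proof -
  obtain \<sigma> U V C where x0: "x0 \<in> setval_inverse F y0" and UV: "open U" "x0 \<in> U" "open V" "y0 \<in> V"
    and single: "\<And>y. y \<in> V \<Longrightarrow> setval_inverse F y \<inter> U = {\<sigma> y}" and lip: "C-lipschitz_on V \<sigma>"
    using assms unfolding strongly_metrically_regular_def lipschitz_localization_def by blast
  obtain e where e: "e > 0" "ball y0 e \<subseteq> V" using UV(3,4) openE by blast
  have C: "C \<ge> 0" using lip by (rule lipschitz_on_nonneg)
  \<comment> \<open>An upper bound for \<open>dist x (\<sigma> y)\<close>, with 1 the radius in
    \<open>U0\<close>, divided by the least distance \<open>e / 2\<close> of a distant
    value.\<close>
  define M where "M = (1 + C * e) / (e / 2)"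
  have M: "M > 0" unfolding M_def using C e(1) by (intro divide_pos_pos add_pos_nonneg) auto
  define \<kappa> where "\<kappa> = C + M"
  have \<kappa>: "\<kappa> > 0" "C \<le> \<kappa>" "M \<le> \<kappa>" unfolding \<kappa>_def using C M by auto
  define U0 where "U0 = U \<inter> ball x0 1"
  define V0 where "V0 = ball y0 (e / 2)"
  have "x0 \<in> setval_inverse F y0 \<inter> U" using x0 UV(2) by blast
  then have \<sigma>0: "\<sigma> y0 = x0" unfolding single[OF UV(4)] by simp
  have "point_dist x (setval_inverse F y) \<le> ereal \<kappa> * point_dist y (F x)" if x: "x \<in> U0" and y: "y \<in> V0" for x y
  proof -
    have yV: "y \<in> V" using y e unfolding V0_def by force
    have bound: "dist x (\<sigma> y) \<le> \<kappa> * dist y y'" if y': "y' \<in> F x" for y'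
    proof (cases "y' \<in> ball y0 e")
      case True
      then have "y' \<in> V" using e(2) by blast
      moreover have "x \<in> setval_inverse F y' \<inter> U" using y' x unfolding setval_inverse_def U0_def by simp
      ultimately have "x = \<sigma> y'" using single[of y'] by (metis singletonD)
      then have "dist x (\<sigma> y) \<le> C * dist y' y" using lipschitz_onD[OF lip \<open>y' \<in> V\<close> yV] by simp
      also have "\<dots> \<le> \<kappa> * dist y y'" using \<kappa>(2) by (simp add: dist_commute mult_right_mono)
      finally show ?thesis .
    next
      case False
      have d: "dist y0 y < e / 2" using y unfolding V0_def by simp
      have "dist y0 y' \<le> dist y0 y + dist y y'" by (rule dist_triangle)
      then have far: "e / 2 \<le> dist y y'" using False d by simp
      have "dist x (\<sigma> y) \<le> dist x x0 + dist (\<sigma> y0) (\<sigma> y)" using dist_triangle[of x "\<sigma> y" x0] \<sigma>0 by simp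
      also have "\<dots> \<le> 1 + C * dist y0 y"
        using x lipschitz_onD[OF lip UV(4) yV] unfolding U0_def by (simp add: dist_commute)
      also have "\<dots> \<le> 1 + C * e" using C d e(1) by (intro add_left_mono mult_left_mono) auto
      also have "\<dots> = M * (e / 2)" unfolding M_def using e(1) by simp
      also have "\<dots> \<le> \<kappa> * dist y y'" using far \<kappa> M e(1) by (intro mult_mono) auto
      finally show ?thesis .
    qed
    \<comment> \<open>The bound is divided by \<open>\<kappa> > 0\<close> before the infimum is
      taken; for empty \<open>F x\<close> this infimum is \<open>\<infinity>\<close>.\<close>
    have "ereal (dist x (\<sigma> y) / \<kappa>) \<le> point_dist y (F x)"
      unfolding point_dist_def
    proof (rule INF_greatest)
      fix y' assume "y' \<in> F x"
      then show "ereal (dist x (\<sigma> y) / \<kappa>) \<le> ereal (dist y y')"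
        using bound \<kappa>(1) by (simp add: pos_divide_le_eq mult.commute)
    qed
    then have "ereal \<kappa> * ereal (dist x (\<sigma> y) / \<kappa>) \<le> ereal \<kappa> * point_dist y (F x)"
      using \<kappa>(1) by (intro ereal_mult_left_mono) auto
    moreover have "ereal \<kappa> * ereal (dist x (\<sigma> y) / \<kappa>) = ereal (dist x (\<sigma> y))" using \<kappa>(1) by simp
    moreover have "\<sigma> y \<in> setval_inverse F y" using single[OF yV] by blast
    then have "point_dist x (setval_inverse F y) \<le> ereal (dist x (\<sigma> y))"
      unfolding point_dist_def by (rule INF_lower)
    ultimately show ?thesis by simp
  qed
  moreover have "open U0" "x0 \<in> U0" "open V0" "y0 \<in> V0" unfolding U0_def V0_def using UV e by auto
  moreover have "y0 \<in> F x0" using x0 unfolding setval_inverse_def by simp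
  ultimately show ?thesis unfolding metrically_regular_def using less_imp_le[OF \<kappa>(1)] by blast
qed

text \<open>The estimate is used at the fixed point \<open>x0\<close> and at \<open>y0\<close>
  shifted by small multiples of \<open>h\<close>. It yields solutions whose distance from
  \<open>x0\<close> is of the order of the shift, so their difference quotients are bounded and
  accumulate at some direction.\<close>

lemma metrically_regular_imp_rge_graphical_derivative:
  fixes F :: "'a::euclidean_space \<Rightarrow> 'b::real_normed_vector set"
  assumes "metrically_regular F x0 y0"
  shows "rge (graphical_derivative F x0 y0) = UNIV"
proof -
  obtain \<kappa> U V where y0: "y0 \<in> F x0" and \<kappa>: "\<kappa> \<ge> 0" and UV: "open U" "x0 \<in> U" "open V" "y0 \<in> V"
    and reg: "\<And>x y. x \<in> U \<Longrightarrow> y \<in> V \<Longrightarrow> point_dist x (setval_inverse F y) \<le> ereal \<kappa> * point_dist y (F x)"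
    using assms unfolding metrically_regular_def by metis
  have "\<exists>w. (w, h) \<in> tangent_cone (gph F) (x0, y0)" for h
  proof -
    define s where "s k = 1 / real (Suc k)" for k
    have s: "s k > 0" for k unfolding s_def by simp
    have slim: "s \<longlonglongrightarrow> 0"
      unfolding s_def using LIMSEQ_inverse_real_of_nat by (simp add: inverse_eq_divide)
    have "(\<lambda>k. y0 + s k *\<^sub>R h) \<longlonglongrightarrow> y0 + 0 *\<^sub>R h" by (intro tendsto_intros slim)
    then have "\<forall>\<^sub>F k in sequentially. y0 + s k *\<^sub>R h \<in> V" using UV by (intro topological_tendstoD) auto
    then obtain k0 where k0: "\<And>k. k \<ge> k0 \<Longrightarrow> y0 + s k *\<^sub>R h \<in> V" unfolding eventually_sequentially by blast
    define t where "t k = s (k + k0)" for k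
    have t: "t k > 0" and tV: "y0 + t k *\<^sub>R h \<in> V" for k unfolding t_def using s k0 by auto
    have tlim: "t \<longlonglongrightarrow> 0" unfolding t_def using slim by (rule LIMSEQ_ignore_initial_segment)
    \<comment> \<open>Adding 1 makes the inequality strict, so that a point within the bound exists
      although the distance need not be attained.\<close>
    have "\<exists>x. y0 + t k *\<^sub>R h \<in> F x \<and> dist x0 x < (\<kappa> * norm h + 1) * t k" for k
    proof -
      have "point_dist (y0 + t k *\<^sub>R h) (F x0) \<le> ereal (dist (y0 + t k *\<^sub>R h) y0)"
        unfolding point_dist_def using y0 by (rule INF_lower)
      then have "ereal \<kappa> * point_dist (y0 + t k *\<^sub>R h) (F x0) \<le> ereal \<kappa> * ereal (t k * norm h)"
        using \<kappa> t[of k] by (intro ereal_mult_left_mono) (auto simp: dist_norm)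
      with reg[OF UV(2) tV] have "point_dist x0 (setval_inverse F (y0 + t k *\<^sub>R h)) \<le> ereal \<kappa> * ereal (t k * norm h)"
        by (rule order_trans)
      also have "\<dots> < ereal ((\<kappa> * norm h + 1) * t k)" using t[of k] by (simp add: algebra_simps)
      finally show ?thesis
        unfolding point_dist_def INF_less_iff setval_inverse_def by auto
    qed
    then obtain x where x: "\<And>k. y0 + t k *\<^sub>R h \<in> F (x k)" "\<And>k. dist x0 (x k) < (\<kappa> * norm h + 1) * t k"
      by metis
    define w where "w k = (x k - x0) /\<^sub>R t k" for k
    have "norm (w k) \<le> \<kappa> * norm h + 1" for k
    proof -
      have "norm (w k) = dist x0 (x k) / t k"
        using t[of k] unfolding w_def by (simp add: dist_norm norm_minus_commute divide_inverse mult.commute)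
      then show ?thesis using x(2)[of k] t[of k] by (simp add: pos_divide_le_eq)
    qed
    then have "bounded (range w)" unfolding bounded_iff by blast
    then obtain w0 \<rho> where \<rho>: "strict_mono \<rho>" "(w \<circ> \<rho>) \<longlonglongrightarrow> w0"
      using bounded_imp_convergent_subsequence by blast
    have "(\<lambda>k. t (\<rho> k)) \<longlonglongrightarrow> 0" using LIMSEQ_subseq_LIMSEQ[OF tlim \<rho>(1)] by (simp add: o_def)
    moreover have "(\<lambda>k. (w (\<rho> k), h)) \<longlonglongrightarrow> (w0, h)"
      using \<rho>(2) by (intro tendsto_intros) (simp add: o_def)
    moreover have "(x0, y0) + t (\<rho> k) *\<^sub>R (w (\<rho> k), h) \<in> gph F" for k
      using x(1)[of "\<rho> k"] t[of "\<rho> k"] unfolding gph_def w_def by simp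
    ultimately have "(\<forall>k. t (\<rho> k) > 0) \<and> (\<lambda>k. t (\<rho> k)) \<longlonglongrightarrow> 0 \<and> (\<lambda>k. (w (\<rho> k), h)) \<longlonglongrightarrow> (w0, h) \<and>
        (\<forall>k. (x0, y0) + t (\<rho> k) *\<^sub>R (w (\<rho> k), h) \<in> gph F)"
      using t by blast
    then have "(w0, h) \<in> tangent_cone (gph F) (x0, y0)"
      unfolding tangent_cone_def by (intro CollectI exI)
    then show ?thesis by blast
  qed
  then show ?thesis unfolding rge_def graphical_derivative_def by blast
qed

text \<open>The orthogonal complement of the sum on the left consists of the \<open>w\<close> in
  \<open>S\<close> with \<open>transpose A *v w\<close> orthogonal to \<open>S\<close>, and a
  subspace is everything exactly when its complement is zero.\<close>

lemma complement_sum_iff_transpose: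
  fixes A :: "real^'n^'n"
  assumes S: "subspace S"
  shows "{A *v w + z | w z. w \<in> S \<and> z \<in> orthogonal_comp S} = UNIV \<longleftrightarrow>
    {w. transpose A *v w \<in> orthogonal_comp S} \<inter> S = {0}"
proof
  assume sum: "{A *v w + z | w z. w \<in> S \<and> z \<in> orthogonal_comp S} = UNIV"
  have "w = 0" if w: "transpose A *v w \<in> orthogonal_comp S" "w \<in> S" for w
  proof -
    obtain k z where kz: "w = A *v k + z" "k \<in> S" "z \<in> orthogonal_comp S" using sum by blast
    have "inner w z = 0" using kz(3) w(2) unfolding orthogonal_comp_def Linear_Algebra.orthogonal_def by blast
    moreover have "inner k (transpose A *v w) = 0"
      using kz(2) w(1) unfolding orthogonal_comp_def Linear_Algebra.orthogonal_def by blast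
    then have "inner w (A *v k) = 0"
      using dot_lmul_matrix[of w A k] by (simp add: inner_commute vector_transpose_matrix)
    moreover have "inner w w = inner w (A *v k) + inner w z" using kz(1) by (metis inner_add_right)
    ultimately show "w = 0" by simp
  qed
  moreover have "transpose A *v 0 \<in> orthogonal_comp S" "0 \<in> S"
    using S by (simp_all add: subspace_0 subspace_orthogonal_comp)
  ultimately show "{w. transpose A *v w \<in> orthogonal_comp S} \<inter> S = {0}" by blast
next
  assume ker: "{w. transpose A *v w \<in> orthogonal_comp S} \<inter> S = {0}"
  let ?V = "{A *v w + z | w z. w \<in> S \<and> z \<in> orthogonal_comp S}"
  have eq: "?V = {x + y | x y. x \<in> (\<lambda>w. A *v w) ` S \<and> y \<in> orthogonal_comp S}" by blast
  have V: "subspace ?V"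
    unfolding eq by (intro subspace_sums linear_subspace_image S subspace_orthogonal_comp matrix_vector_mul_linear)
  have "w = 0" if w: "w \<in> orthogonal_comp ?V" for w
  proof -
    have o: "inner v w = 0" if "v \<in> ?V" for v
      using w that unfolding orthogonal_comp_def Linear_Algebra.orthogonal_def by blast
    have "inner z w = 0" if "z \<in> orthogonal_comp S" for z
    proof (rule o)
      have "z = A *v 0 + z" by simp
      then show "z \<in> ?V" using that subspace_0[OF S] by blast
    qed
    then have "w \<in> orthogonal_comp (orthogonal_comp S)"
      unfolding orthogonal_comp_def[of "orthogonal_comp S"] Linear_Algebra.orthogonal_def by blast
    then have wS: "w \<in> S" unfolding orthogonal_comp_self[OF S] .
    have "inner k (transpose A *v w) = 0" if "k \<in> S" for k
    proof -
      have "A *v k = A *v k + 0" by simp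
      then have "A *v k \<in> ?V" using that subspace_0[OF subspace_orthogonal_comp] by blast
      then have "inner (A *v k) w = 0" by (rule o)
      then show ?thesis using dot_lmul_matrix[of w A k] by (simp add: inner_commute vector_transpose_matrix)
    qed
    then have "transpose A *v w \<in> orthogonal_comp S"
      unfolding orthogonal_comp_def Linear_Algebra.orthogonal_def by blast
    then show ?thesis using ker wS by blast
  qed
  then have "orthogonal_comp ?V = {0}"
    using subspace_0[OF subspace_orthogonal_comp] by blast
  then have "orthogonal_comp (orthogonal_comp ?V) = UNIV" by simp
  then show "?V = UNIV" unfolding orthogonal_comp_self[OF V] .
qed

text \<open>The sum condition says that the compression of \<open>A\<close> to \<open>S\<close> is
  onto, the conclusion that it is injective. Completed by the identity on the complement it becomes
  the operator \<open>?T\<close>, for which the two agree by dimension.\<close>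

lemma complement_sum_imp_nondegenerate:
  fixes A :: "real^'n^'n"
  assumes S: "subspace S" and sum: "{A *v w + z | w z. w \<in> S \<and> z \<in> orthogonal_comp S} = UNIV"
    and w: "w \<in> S" "\<And>k. k \<in> S \<Longrightarrow> inner (A *v w) k = 0"
  shows "w = 0"
proof -
  obtain P where P: "linear P" "\<And>x. P x \<in> S" "\<And>x n. n \<in> S \<Longrightarrow> inner n (P x) = inner n x"
    using orthogonal_projection_exists[OF S] by metis
  have uniq: "a = b" if "a \<in> S" "b \<in> S" "\<And>n. n \<in> S \<Longrightarrow> inner n a = inner n b" for a b
  proof -
    have "inner (a - b) (a - b) = 0"
      using that(3)[of "a - b"] that(1,2) S by (simp add: subspace_diff inner_diff_right)
    then show ?thesis by simp
  qed
  have PS: "P k = k" if "k \<in> S" for k using uniq[OF P(2) that] P(3) by blast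
  let ?T = "\<lambda>x. P (A *v P x) + (x - P x)"
  have lin: "linear ?T"
    by (intro linearI) (simp_all add: linear_add[OF P(1)] linear_cmul[OF P(1)]
        matrix_vector_right_distrib matrix_vector_mult_scaleR algebra_simps)
  have "h \<in> range ?T" for h
  proof -
    obtain k z where kz: "h = A *v k + z" "k \<in> S" "z \<in> orthogonal_comp S" using sum by blast
    have "P h = P (A *v k)"
    proof (rule uniq[OF P(2) P(2)])
      fix n assume n: "n \<in> S"
      have "inner n z = 0" using kz(3) n unfolding orthogonal_comp_def Linear_Algebra.orthogonal_def by blast
      then show "inner n (P h) = inner n (P (A *v k))" using kz(1) P(3)[OF n] by (simp add: inner_add_right)
    qed
    \<comment> \<open>In the preimage of \<open>h\<close> under \<open>?T\<close>, \<open>k\<close>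
      produces the part in \<open>S\<close> and \<open>h - P h\<close> reproduces the rest.\<close>
    moreover have "P (k + (h - P h)) = k"
      using PS[OF kz(2)] PS[OF P(2), of h] by (simp add: linear_add[OF P(1)] linear_diff[OF P(1)])
    ultimately have "h = ?T (k + (h - P h))" by simp
    then show ?thesis by (rule range_eqI)
  qed
  then have "surj ?T" by blast
  then have "inj ?T" using linear_surjective_imp_injective[OF lin] by simp
  moreover have "?T w = ?T 0"
  proof -
    have "P (A *v w) = 0"
      by (rule uniq[OF P(2) subspace_0[OF S]]) (use w(2) P(3) in \<open>simp add: inner_commute\<close>)
    then show ?thesis using PS[OF w(1)] by (simp add: linear_0[OF P(1)])
  qed
  ultimately show ?thesis by (rule injD)
qed

section \<open>Compression of a matrix to a subspace with a given basis\<close>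

lemma columns_mult_sum:
  "c \<in> carrier_vec s \<Longrightarrow> columns_mult B c = (\<Sum>j<s. vec_index c j *\<^sub>R B j)"
  unfolding columns_mult_def by auto

lemma compression_mult:
  fixes A :: "real^'n^'n"
  assumes c: "c \<in> carrier_vec s" and i: "i < s"
  shows "vec_index (compression B s A *\<^sub>v c) i = inner (B i) (A *v columns_mult B c)"
proof -
  have "vec_index (compression B s A *\<^sub>v c) i = (\<Sum>j<s. inner (B i) (A *v B j) * vec_index c j)"
    using c i unfolding compression_def by (auto simp: scalar_prod_def atLeast0LessThan intro!: sum.cong)
  also have "A *v columns_mult B c = (\<Sum>j<s. vec_index c j *\<^sub>R (A *v B j))"
    unfolding columns_mult_sum[OF c]
    by (simp add: linear_sum[OF matrix_vector_mul_linear] matrix_vector_mult_scaleR)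
  then have "inner (B i) (A *v columns_mult B c) = (\<Sum>j<s. vec_index c j * inner (B i) (A *v B j))"
    by (simp add: inner_sum_right)
  ultimately show ?thesis by (simp add: mult.commute)
qed

text \<open>Invertibility of the compression is nondegeneracy in coordinates. Nondegeneracy also
  makes the equations for \<open>T\<close> uniquely solvable, so the formula only has to satisfy
  them, which is checked on the columns of \<open>B\<close>.\<close>

lemma compression_inverse:
  fixes A :: "real^'n^'n"
  assumes S: "subspace S" and B: "columns_basis B s S"
    and nondeg: "\<And>w. w \<in> S \<Longrightarrow> (\<And>k. k \<in> S \<Longrightarrow> inner (A *v w) k = 0) \<Longrightarrow> w = 0"
    and T: "\<And>h. T h \<in> S" "\<And>h k. k \<in> S \<Longrightarrow> inner (A *v T h) k = inner h k"
  shows "\<exists>M\<in>carrier_mat s s. inverts_mat (compression B s A) M \<and> inverts_mat M (compression B s A) \<and>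
    T = (\<lambda>h. columns_mult B (M *\<^sub>v columns_transpose_mult B s h))"
proof -
  let ?C = "compression B s A"
  have Bs: "B ` {..<s} \<subseteq> S" "S \<subseteq> span (B ` {..<s})" "inj_on B {..<s}" "independent (B ` {..<s})"
    using B unfolding columns_basis_def by auto
  have C: "?C \<in> carrier_mat s s" unfolding compression_def by simp
  have mem: "columns_mult B c \<in> S" if "c \<in> carrier_vec s" for c
    unfolding columns_mult_sum[OF that] using Bs(1) S by (intro subspace_sum subspace_scale) auto
  have zero: "w = 0" if w: "w \<in> S" "\<And>i. i < s \<Longrightarrow> inner (B i) (A *v w) = 0" for w
  proof (rule nondeg[OF w(1)])
    fix k assume "k \<in> S"
    then have "k \<in> span (B ` {..<s})" using Bs(2) by blast
    then show "inner (A *v w) k = 0"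
      by (induction rule: span_induct_alt) (auto simp: inner_add_right w(2) inner_commute[of _ "B _"])
  qed
  have ker: "c = 0\<^sub>v s" if c: "c \<in> carrier_vec s" "?C *\<^sub>v c = 0\<^sub>v s" for c
  proof -
    have "columns_mult B c = 0"
      using compression_mult[OF c(1), of _ B A] c(2) by (intro zero[OF mem[OF c(1)]]) simp
    then have "(\<Sum>j<s. vec_index c j *\<^sub>R B j) = 0" unfolding columns_mult_sum[OF c(1)] .
    \<comment> \<open>Independence concerns the set of columns, so the sum over indices is turned
      into one over that set.\<close>
    then have "(\<Sum>v\<in>B ` {..<s}. vec_index c (the_inv_into {..<s} B v) *\<^sub>R v) = 0"
      using Bs(3) by (simp add: sum.reindex the_inv_into_f_f)
    then have zeros: "\<forall>v\<in>B ` {..<s}. vec_index c (the_inv_into {..<s} B v) = 0"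
      using Bs(4) independent_explicit_finite_subsets[of "B ` {..<s}"] by (meson finite_imageI finite_lessThan subset_refl)
    then have "vec_index c j = 0" if "j < s" for j
    proof -
      have "vec_index c (the_inv_into {..<s} B (B j)) = 0" by (rule bspec[OF zeros]) (use that in simp)
      then show ?thesis using that the_inv_into_f_f[OF Bs(3), of j] by simp
    qed
    then show ?thesis using c(1) by (intro eq_vecI) auto
  qed
  have "det ?C \<noteq> 0" using det_0_iff_vec_prod_zero_field[OF C] ker by blast
  then have "?C \<in> Units (ring_mat TYPE(real) s ())" by (rule det_non_zero_imp_unit[OF C])
  then obtain M where M: "M \<in> carrier_mat s s" "M * ?C = 1\<^sub>m s" "?C * M = 1\<^sub>m s"
    unfolding Units_def ring_mat_def by auto
  have "T h = columns_mult B (M *\<^sub>v columns_transpose_mult B s h)" for h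
  proof -
    define b where "b = columns_transpose_mult B s h"
    have b: "b \<in> carrier_vec s" unfolding b_def columns_transpose_mult_def by simp
    define c where "c = M *\<^sub>v b"
    have c: "c \<in> carrier_vec s" unfolding c_def using M(1) b by simp
    have "?C *\<^sub>v c = (?C * M) *\<^sub>v b" unfolding c_def using assoc_mult_mat_vec[OF C M(1) b] by simp
    then have Cc: "?C *\<^sub>v c = b" using M(3) b by simp
    have "T h - columns_mult B c = 0"
    proof (rule zero)
      show "T h - columns_mult B c \<in> S" using T(1) mem[OF c] S by (simp add: subspace_diff)
      fix i assume i: "i < s"
      have "inner (B i) (A *v columns_mult B c) = inner (B i) h"
        using compression_mult[OF c i, of B A] i unfolding Cc b_def columns_transpose_mult_def by simp
      moreover have "inner (B i) (A *v T h) = inner (B i) h"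
        using T(2)[of "B i" h] Bs(1) i by (auto simp: inner_commute)
      ultimately show "inner (B i) (A *v (T h - columns_mult B c)) = 0"
        by (simp add: matrix_vector_mult_diff_distrib inner_diff_right)
    qed
    then show ?thesis unfolding c_def b_def by simp
  qed
  then show ?thesis using M C unfolding inverts_mat_def by (intro bexI[of _ M]) auto
qed

section \<open>The theorem on nondegenerate solutions\<close>

lemma has_derivative_imp_jacobian_mult:
  fixes F :: "real^'n \<Rightarrow> real^'m"
  assumes "(F has_derivative D) (at x)"
  shows "jacobian F (at x) *v w = D w"
proof -
  have "(F has_derivative (\<lambda>h. jacobian F (at x) *v h)) (at x)"
    using assms jacobian_works unfolding differentiable_def by blast
  then show ?thesis using has_derivative_unique[OF assms] by metis
qed

lemma inner_transpose_mult: "inner (transpose (A::real^'n^'m) *v l) w = inner l (A *v w)"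
  using dot_lmul_matrix[of l A w] by (simp add: vector_transpose_matrix)

lemma inner_linear_axis:
  fixes T :: "real^'n \<Rightarrow> real"
  assumes "linear T"
  shows "inner (\<chi> j. T (axis j 1)) k = T k"
proof -
  have "T k = T (\<Sum>j\<in>UNIV. vec_nth k j *\<^sub>R axis j 1)"
    using basis_expansion[of k] by (simp add: scalar_mult_eq_scaleR)
  also have "\<dots> = (\<Sum>j\<in>UNIV. vec_nth k j * T (axis j 1))"
    using assms by (simp add: linear_sum linear_cmul)
  finally show ?thesis by (simp add: inner_vec_def mult.commute)
qed

text \<open>\<open>hessian\<close> differentiates the gradient, for which the expression
  \<open>p\<close> is available on \<open>W\<close>; openness of \<open>W\<close> lets
  \<open>p\<close> replace it in the derivative at \<open>x\<close>.\<close>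

lemma hessian_inner:
  fixes \<Phi> :: "real^'n \<Rightarrow> real^'m"
  assumes W: "open W" "x \<in> W"
    and der: "\<And>y. y \<in> W \<Longrightarrow> (\<Phi> has_derivative \<Phi>' y) (at y)"
    and der2: "\<And>h. ((\<lambda>y. \<Phi>' y h) has_derivative (\<lambda>k. \<Phi>'' k h)) (at x)"
    and lin: "\<And>k. linear (\<Phi>'' k)"
  shows "inner (hessian (\<lambda>x. inner l (\<Phi> x)) x *v w) k = inner l (\<Phi>'' w k)"
proof -
  let ?h = "\<lambda>x. inner l (\<Phi> x)"
  define p where "p y = (\<Sum>j\<in>UNIV. inner l (\<Phi>' y (axis j 1)) *\<^sub>R (axis j 1 :: real^'n))" for y
  have vec: "(\<chi> j. a j) = (\<Sum>j\<in>UNIV. a j *\<^sub>R axis j 1)" for a :: "'n \<Rightarrow> real"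
    using basis_expansion[of "\<chi> j. a j"] by (simp add: scalar_mult_eq_scaleR)
  have grad: "gradient ?h y = p y" if "y \<in> W" for y
  proof -
    have "(?h has_derivative (\<lambda>k. inner l (\<Phi>' y k))) (at y)"
      by (intro has_derivative_inner_right der that)
    then have "frechet_derivative ?h (at y) = (\<lambda>k. inner l (\<Phi>' y k))"
      using frechet_derivative_at by metis
    then show ?thesis unfolding gradient_def p_def vec by simp
  qed
  have "(p has_derivative (\<lambda>k. \<Sum>j\<in>UNIV. inner l (\<Phi>'' k (axis j 1)) *\<^sub>R axis j 1)) (at x)"
    unfolding p_def
    by (intro has_derivative_sum has_derivative_scaleR_left has_derivative_inner_right der2)
  then have "(gradient ?h has_derivative (\<lambda>k. \<Sum>j\<in>UNIV. inner l (\<Phi>'' k (axis j 1)) *\<^sub>R axis j 1)) (at x)"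
    by (rule has_derivative_transform_within_open[OF _ W]) (simp add: grad)
  then have "hessian ?h x *v w = (\<Sum>j\<in>UNIV. inner l (\<Phi>'' w (axis j 1)) *\<^sub>R axis j 1)"
    unfolding hessian_def by (rule has_derivative_imp_jacobian_mult)
  also have "\<dots> = (\<chi> j. inner l (\<Phi>'' w (axis j 1)))" unfolding vec ..
  finally have eq: "hessian ?h x *v w = (\<chi> j. inner l (\<Phi>'' w (axis j 1)))" .
  have "linear (\<lambda>k. inner l (\<Phi>'' w k))"
    using lin[of w] by (intro linearI) (simp_all add: linear_add linear_cmul inner_add_right)
  then show ?thesis unfolding eq by (rule inner_linear_axis)
qed

text \<open>The equivalences come from one cycle: metric regularity, surjectivity of the graphical
  derivative, the sum condition \<open>?sum\<close>, strong metric regularity. The transposed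
  condition is attached to \<open>?sum\<close> by duality.\<close>

theorem theorem4p3:
  fixes f :: "real^'n \<Rightarrow> real^'n"
    and \<phi> :: "real^'n \<Rightarrow> ereal"
    and g :: "real^'m \<Rightarrow> ereal"
    and \<Phi> :: "real^'n \<Rightarrow> real^'m"
    and xbar ubar :: "real^'n"
    and lbar :: "real^'m"
    and G S :: "real^'n \<Rightarrow> (real^'n) set"
    and K :: "(real^'n) set"
    and A :: "real^'n^'n"
  assumes "C1_on UNIV f"
    and "\<bar>\<phi> xbar\<bar> \<noteq> \<infinity>"
    and "composite_representation \<phi> g \<Phi> xbar"
    and "ubar - f xbar \<in> rel_interior (subdiff \<phi> xbar)"
    and "multipliers g \<Phi> xbar (ubar - f xbar) = {lbar}"
    and "SOQC g \<Phi> xbar lbar"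
    and G_def: "G = (\<lambda>x. {f x + v | v. v \<in> subdiff \<phi> x})"
    and S_def: "S = setval_inverse G"
    and K_def: "K = critical_cone \<phi> xbar (ubar - f xbar)"
    and A_def: "A = jacobian f (at xbar) + hessian (\<lambda>x. inner lbar (\<Phi> x)) xbar"
  shows "(metrically_regular G xbar ubar \<longleftrightarrow> strongly_metrically_regular G xbar ubar)
    \<and> (metrically_regular G xbar ubar \<longleftrightarrow> {w. transpose A *v w \<in> orthogonal_comp K} \<inter> K = {0})
    \<and> (metrically_regular G xbar ubar \<longleftrightarrow> {A *v w + z | w z. w \<in> K \<and> z \<in> orthogonal_comp K} = UNIV)
    \<and> (metrically_regular G xbar ubar \<longleftrightarrow> rge (graphical_derivative G xbar ubar) = UNIV)
    \<and> (\<forall>B s. s = dim K \<and> columns_basis B s K \<longrightarrow>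
         (metrically_regular G xbar ubar \<longleftrightarrow>
           (\<exists>\<sigma>. lipschitz_localization S ubar xbar \<sigma>
              \<and> (\<exists>W. open W \<and> ubar \<in> W \<and> C1_on W \<sigma>)
              \<and> (\<exists>M \<in> carrier_mat s s.
                   inverts_mat (compression B s A) M \<and> inverts_mat M (compression B s A)
                   \<and> jacobian \<sigma> (at ubar)
                     = matrix (\<lambda>h. columns_mult B (M *\<^sub>v columns_transpose_mult B s h))))))"
proof -
  define vbar where "vbar = ubar - f xbar"
  have ubar: "ubar = f xbar + vbar" unfolding vbar_def by simp
  obtain Df where Df: "\<And>x. (f has_derivative blinfun_apply (Df x)) (at x)" "continuous_on UNIV Df"
    using assms(1) unfolding C1_on_def by blast
  obtain W0 N0 where W0: "open W0" "xbar \<in> W0" "C2_on W0 \<Phi>"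
    and N0: "open N0" "xbar \<in> N0" "\<And>x. x \<in> N0 \<Longrightarrow> \<phi> x = g (\<Phi> x)" and g: "polyhedral_fun g"
    using assms(3) unfolding composite_representation_def by blast
  obtain D\<Phi> where D\<Phi>: "\<And>x. x \<in> W0 \<Longrightarrow> (\<Phi> has_derivative blinfun_apply (D\<Phi> x)) (at x)" "C1_on W0 D\<Phi>"
    using W0(3) unfolding C2_on_def by blast
  obtain D2 where D2: "\<And>x. x \<in> W0 \<Longrightarrow> (D\<Phi> has_derivative blinfun_apply (D2 x)) (at x)" "continuous_on W0 D2"
    using D\<Phi>(2) unfolding C1_on_def by blast
  define W where "W = W0 \<inter> N0"
  have W: "open W" "xbar \<in> W" "W \<subseteq> W0" unfolding W_def using W0 N0 by auto
  define \<Phi>' where "\<Phi>' x = blinfun_apply (D\<Phi> x)" for x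
  define \<Phi>'' where "\<Phi>'' x k h = blinfun_apply (blinfun_apply (D2 x) k) h" for x k h
  have d2: "((\<lambda>x. \<Phi>' x h) has_derivative (\<lambda>k. \<Phi>'' x k h)) (at x)" if "x \<in> W" for x h
    unfolding \<Phi>'_def \<Phi>''_def using D2(1)[of x] that W(3)
    by (intro bounded_linear.has_derivative[OF blinfun.bounded_linear_left]) auto
  have contD\<Phi>: "continuous_on W D\<Phi>"
    using D2(1) W(3) by (intro continuous_at_imp_continuous_on ballI) (meson has_derivative_continuous subsetD)
  have lin2: "linear (\<Phi>'' x k)" for x k
    unfolding \<Phi>''_def by (simp add: blinfun.bounded_linear_right bounded_linear.linear)
  obtain r where r: "\<phi> xbar = ereal r" using assms(2) by (cases "\<phi> xbar") auto
  have gr: "g (\<Phi> xbar) = ereal r" using r N0(2,3) by simp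
  have "lbar \<in> multipliers g \<Phi> xbar vbar" using assms(5) unfolding vbar_def by simp
  then have lbar: "lbar \<in> subdiff g (\<Phi> xbar)"
    and veq: "transpose (jacobian \<Phi> (at xbar)) *v lbar = vbar"
    unfolding multipliers_def by auto
  have J: "jacobian \<Phi> (at xbar) *v w = \<Phi>' xbar w" for w
    unfolding \<Phi>'_def by (rule has_derivative_imp_jacobian_mult[OF D\<Phi>(1)[OF W0(2)]])
  have v: "inner vbar w = inner lbar (\<Phi>' xbar w)" for w
    unfolding veq[symmetric] inner_transpose_mult J ..
  interpret C: transversal_composite g \<phi> \<Phi> \<Phi>' W xbar r lbar
  proof
    show "open W" "xbar \<in> W" by (fact W)+
    show "(\<Phi> has_derivative \<Phi>' x) (at x)" if "x \<in> W" for x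
      unfolding \<Phi>'_def using D\<Phi>(1) that W(3) by blast
    show "continuous_on W (\<lambda>x. \<Phi>' x h)" for h
      unfolding \<Phi>'_def by (intro continuous_intros contD\<Phi>)
    show "\<phi> x = g (\<Phi> x)" if "x \<in> W" for x using N0(3) that unfolding W_def by blast
    show "polyhedral_fun g" "g (\<Phi> xbar) = ereal r" "lbar \<in> subdiff g (\<Phi> xbar)" by (fact g gr lbar)+
    show "l = 0" if l: "l \<in> parallel_subspace (subdiff g (\<Phi> xbar))" "\<And>w. inner l (\<Phi>' xbar w) = 0" for l
    proof -
      have "inner (transpose (jacobian \<Phi> (at xbar)) *v l) w = 0" for w
        unfolding inner_transpose_mult J by (rule l(2))
      then have "transpose (jacobian \<Phi> (at xbar)) *v l = 0" using inner_eq_zero_iff by blast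
      moreover have "l \<in> coderivative (subdiff g) (\<Phi> xbar) lbar 0"
        using parallel_subspace_subset_coderivative[OF g gr lbar] l(1) by blast
      ultimately show "l = 0" using assms(6) unfolding SOQC_def by blast
    qed
  qed
  have ri: "lbar \<in> rel_interior (subdiff g (\<Phi> xbar))"
    using C.multiplier_rel_interior[of vbar] assms(4) v unfolding vbar_def by blast
  have K: "K = C.K"
    unfolding K_def vbar_def[symmetric] by (rule C.critical_cone_eq[OF ri v])
  have sub: "subspace K" unfolding K by (rule C.subspace_K)
  have Aw: "inner (A *v w) k = inner (blinfun_apply (Df xbar) w) k + inner lbar (\<Phi>'' xbar w k)" for w k
  proof -
    have "inner (hessian (\<lambda>x. inner lbar (\<Phi> x)) xbar *v w) k = inner lbar (\<Phi>'' xbar w k)"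
      by (rule hessian_inner[OF W(1,2) C.der d2[OF W(2)] lin2])
    then show ?thesis
      unfolding A_def matrix_vector_mult_add_rdistrib has_derivative_imp_jacobian_mult[OF Df(1)]
      by (simp add: inner_add_left)
  qed
  have G: "G x = {f x + v | v. v \<in> subdiff \<phi> x}" for x unfolding G_def ..
  let ?sum = "{A *v w + z | w z. w \<in> K \<and> z \<in> orthogonal_comp K} = UNIV"
  have rge_imp: ?sum if rge: "rge (graphical_derivative G xbar ubar) = UNIV"
  proof -
    have "h \<in> {A *v w + z | w z. w \<in> K \<and> z \<in> orthogonal_comp K}" for h
    proof -
      have "h \<in> rge (graphical_derivative G xbar ubar)" unfolding rge by simp
      then obtain w where w: "(w, h) \<in> tangent_cone (gph G) (xbar, f xbar + vbar)"
        unfolding rge_def graphical_derivative_def ubar by blast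
      have tan: "w \<in> K \<and> (\<forall>k\<in>K. inner h k = inner (blinfun_apply (Df xbar) w) k + inner lbar (\<Phi>'' xbar w k))"
        unfolding K by (rule C.tangent_cone_graph[OF ri v Df(1) d2[OF W(2)] G w])
      have "inner k (h - A *v w) = 0" if "k \<in> K" for k
      proof -
        have "inner h k = inner (A *v w) k" using tan that Aw[of w k] by simp
        then show ?thesis by (simp add: inner_diff_right inner_commute)
      qed
      then have "h - A *v w \<in> orthogonal_comp K"
        unfolding orthogonal_comp_def Linear_Algebra.orthogonal_def by blast
      moreover have "h = A *v w + (h - A *v w)" by simp
      ultimately show ?thesis using tan by blast
    qed
    then show ?thesis by blast
  qed
  \<comment> \<open>The derivative is described by equations on \<open>K\<close> and not yet by a
    matrix: the equations are free of the basis \<open>B\<close>, so one \<open>\<sigma>\<close>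
    serves every choice of it.\<close>
  have loc: "\<exists>\<sigma>. lipschitz_localization S ubar xbar \<sigma> \<and> (\<exists>V. open V \<and> ubar \<in> V \<and> C1_on V \<sigma>) \<and>
      (\<exists>\<sigma>'. (\<sigma> has_derivative \<sigma>') (at ubar) \<and> (\<forall>h. \<sigma>' h \<in> K \<and> (\<forall>k\<in>K. inner (A *v \<sigma>' h) k = inner h k)))"
    if sum: ?sum
    unfolding S_def ubar Aw K
  proof (rule C.C1_localization[OF ri v, where f' = "\<lambda>x. blinfun_apply (Df x)"])
    show "(f has_derivative blinfun_apply (Df x)) (at x)" for x by (rule Df(1))
    show "continuous_on UNIV (\<lambda>x. blinfun_apply (Df x) h)" for h by (intro continuous_intros Df(2))
    show "((\<lambda>x. \<Phi>' x h) has_derivative (\<lambda>k. \<Phi>'' x k h)) (at x)" if "x \<in> W" for x h by (rule d2[OF that])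
    show "continuous_on W (\<lambda>x. \<Phi>'' x k h)" for k h
      unfolding \<Phi>''_def by (intro continuous_intros continuous_on_subset[OF D2(2) W(3)])
    show "linear (\<Phi>'' xbar k)" for k by (rule lin2)
    show "G x = {f x + v | v. v \<in> subdiff \<phi> x}" for x by (rule G)
    show "w = 0" if "w \<in> C.K"
      "\<And>k. k \<in> C.K \<Longrightarrow>
         inner (blinfun_apply (Df xbar) w) k + inner lbar (\<Phi>'' xbar w k) = 0" for w
      using that unfolding K[symmetric] Aw[symmetric]
      by (rule complement_sum_imp_nondegenerate[OF sub sum])
  qed
  have MR_rge: "metrically_regular G xbar ubar \<Longrightarrow> rge (graphical_derivative G xbar ubar) = UNIV"
    by (rule metrically_regular_imp_rge_graphical_derivative)
  have SMR_MR: "strongly_metrically_regular G xbar ubar \<Longrightarrow> metrically_regular G xbar ubar"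
    by (rule strongly_metrically_regular_imp_metrically_regular)
  have sum_SMR: "?sum \<Longrightarrow> strongly_metrically_regular G xbar ubar"
    using loc unfolding strongly_metrically_regular_def S_def by blast
  have sum_ker: "?sum \<longleftrightarrow> {w. transpose A *v w \<in> orthogonal_comp K} \<inter> K = {0}"
    by (rule complement_sum_iff_transpose[OF sub])
  have formula: "metrically_regular G xbar ubar \<longleftrightarrow>
           (\<exists>\<sigma>. lipschitz_localization S ubar xbar \<sigma>
              \<and> (\<exists>W. open W \<and> ubar \<in> W \<and> C1_on W \<sigma>)
              \<and> (\<exists>M \<in> carrier_mat s s.
                   inverts_mat (compression B s A) M \<and> inverts_mat M (compression B s A)
                   \<and> jacobian \<sigma> (at ubar)
                     = matrix (\<lambda>h. columns_mult B (M *\<^sub>v columns_transpose_mult B s h))))"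
    (is "_ \<longleftrightarrow> ?R") if B: "columns_basis B s K" for B s
  proof
    assume "metrically_regular G xbar ubar"
    then have sum: ?sum using MR_rge rge_imp by blast
    obtain \<sigma> \<sigma>' where \<sigma>: "lipschitz_localization S ubar xbar \<sigma>" "\<exists>V. open V \<and> ubar \<in> V \<and> C1_on V \<sigma>"
      and der\<sigma>: "(\<sigma> has_derivative \<sigma>') (at ubar)"
      and \<sigma>': "\<And>h. \<sigma>' h \<in> K" "\<And>h k. k \<in> K \<Longrightarrow> inner (A *v \<sigma>' h) k = inner h k"
      using loc[OF sum] by blast
    have "\<exists>M\<in>carrier_mat s s. inverts_mat (compression B s A) M \<and> inverts_mat M (compression B s A) \<and>
        \<sigma>' = (\<lambda>h. columns_mult B (M *\<^sub>v columns_transpose_mult B s h))"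
      by (rule compression_inverse[OF sub B complement_sum_imp_nondegenerate[OF sub sum] \<sigma>'])
    moreover have "jacobian \<sigma> (at ubar) = matrix \<sigma>'"
      unfolding jacobian_def frechet_derivative_at[OF der\<sigma>, symmetric] ..
    ultimately show ?R using \<sigma> by blast
  next
    assume ?R
    then show "metrically_regular G xbar ubar"
      using SMR_MR unfolding strongly_metrically_regular_def S_def by blast
  qed
  show ?thesis
    using MR_rge rge_imp sum_SMR SMR_MR sum_ker formula by blast
qed

end
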